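(* Assume that the reduced system $G(p,x)\in K$ enjoys Robinson stability at $(\bar p,\bar x)$, and that either ${\cal P}=P$ or $K$ is polyhedral. Then $$T_{\operatorname{gph}\Psi}(\bar p,\bar x,\bar x^* )=\Big\{(q,u,u^* )\ \Big|\ \exists\,z^*\in N_{T_{\operatorname{gph}\Gamma}(\bar z)}(q,u)\text{ with }\pi_{X^*}(z^* )=\bar x^*,\ \exists\,\hat\mu\in{\cal M}(\bar z,z^*;(q,u))\text{ such that } u^*\in\nabla(\nabla_xG(\cdot)^*\hat\mu)(\bar z)(q,u)+\pi_{X^*}\big(N_{{\cal K}_{\operatorname{gph}\Gamma}(\bar z,z^* )}(q,u)\big)\Big\}.$$ Consequently, for all $v=(q,u)\in Z$, $$D\Psi(\bar p,\bar x,\bar x^* )(v)=\bigcup\Big\{\nabla(\nabla_xG(\cdot)^*\hat\mu)(\bar z)v+\pi_{X^*}\big(N_{{\cal K}_{\operatorname{gph}\Gamma}(\bar z,z^* )}(v)\big)\ \Big|\ z^*\in N_{T_{\operatorname{gph}\Gamma}(\bar z)}(v),\ \pi_{X^*}(z^* )=\bar x^*,\ \hat\mu\in{\cal M}(\bar z,z^*;v)\Big\}.$$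
   Context: Notation: $X=\mathbb R^n$, $P=\mathbb R^m$, $Y=\mathbb R^l$, $Z:=P\times X$, and $E$ is finite-dimensional. Dual spaces are distinguished from primal ones, $Z^*=P^*\times X^*$, and $\pi_{X^*}(p^*,x^* ):=x^*$. $A^*$ denotes the adjoint of a linear map $A$, and $\operatorname{rge}A$ its range. For $\mu\in E^*$, $\nabla(\nabla_xG(\cdot)^*\mu)(\bar z)v\in X^*$ is the derivative at $\bar z$ of the map $z\mapsto\nabla_xG(z)^*\mu$, applied to $v$. For a cone $A$, $A^*:=\{a^*:\langle a^*,a\rangle\le0\ \forall a\in A\}$ is its polar, and for a closed convex cone $K$, $\operatorname{lin}K:=K\cap(-K)$. For a closed set $\Omega$ and $\bar z\in\Omega$: the tangent cone is $T_\Omega(\bar z):=\{w:\exists\, t_k\downarrow0,\ w_k\to w \text{ with } \bar z+t_kw_k\in\Omega\}$; the regular normal cone is $N_\Omega(\bar z):=\{z^*:\limsup_{z\to\bar z,\,z\in\Omega}\langle z^*,z-\bar z\rangle/\|z-\bar z\|\le0\}$ (for convex sets, this is the normal cone of convex analysis); and, for $z^*\in N_\Omega(\bar z)$, the critical cone is ${\cal K}_\Omega(\bar z,z^* ):=T_\Omega(\bar z)\cap\{z^*\}^\perp$. For a set-valued map $\Phi$, the graphical derivative is $D\Phi(\bar z,\bar u)(w):=\{v:(w,v)\in T_{\operatorname{gph}\Phi}(\bar z,\bar u)\}$. Setting: $g\colon P\times X\to Y$ is $C^2$ around $\bar z=(\bar p,\bar x)$. The set $C\subset Y$ is closed and $C^2$-cone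 reducible at $g(\bar z)$ to a closed convex cone $K\subset E$: there exist a neighborhood $V$ of $g(\bar z)$ and a $C^2$ map $h\colon V\to E$ with $h(g(\bar z))=0$, $\nabla h(g(\bar z))$ surjective, and $C\cap V=\{y\in V:h(y)\in K\}$. Set $\Gamma(p):=\{x:g(p,x)\in C\}$ with $\bar x\in\Gamma(\bar p)$, $\Psi(p,x):=N_{\Gamma(p)}(x)$, and fix $\bar x^*\in N_{\Gamma(\bar p)}(\bar x)$. Let $G:=h\circ g$, defined near $\bar z$, so that $G(\bar z)=0$. Near $\bar z$, $\operatorname{gph}\Gamma$ coincides with $\{z:G(z)\in K\}$, and for $p$ near $\bar p$, $\Gamma(p)$ coincides near $\bar x$ with $\{x:G(p,x)\in K\}$. The system $G(p,x)\in K$ enjoys Robinson stability (RS) at $(\bar p,\bar x)$ if there are $\kappa\ge0$ and neighborhoods $W$ of $\bar p$ and $U$ of $\bar x$ with ${\rm dist}(x;\{x':G(p,x')\in K\})\le\kappa\,{\rm dist}(G(p,x);K)$ for all $(p,x)\in W\times U$. Multiplier sets: for $z^*\in N_{\operatorname{gph}\Gamma}(\bar z)$, ${\cal M}(\bar z,z^* ):=\{\mu\in K^*:\nabla G(\bar z)^*\mu=z^*\}$, and for $v\in{\cal K}_{\operatorname{gph}\Gamma}(\bar z,z^* )$, ${\cal M}(\bar z,z^*;v):=\arg\max\{\langle\mu,\nabla^2G(\bar z)(v,v)\rangle:\mu\in{\cal M}(\bar z,z^* )\}$. The characteristic subspace is ${\cal P}:=\{q\in P:\nabla_pG(\bar z)q\in\operatorname{rge}\nabla_xG(\bar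 z)+\operatorname{lin}K\}$. *)

theory Defs
  imports "HOL-Analysis.Analysis"
begin

text \<open>Dual spaces are identified with the primal Euclidean spaces via the inner product;
  the pairing of z* and z is the inner product z* \<bullet> z.\<close>

definition tangent_cone :: "'a::real_normed_vector set \<Rightarrow> 'a \<Rightarrow> 'a set" where
  "tangent_cone \<Omega> z = {w. \<exists>t wk. (\<forall>k. t k > 0) \<and> t \<longlonglongrightarrow> 0 \<and> wk \<longlonglongrightarrow> w
        \<and> (\<forall>k. z + t k *\<^sub>R wk k \<in> \<Omega>)}"

text \<open>Regular (Frechet) normal cone; empty outside the set.  The condition
  limsup_{z'\<rightarrow>z, z'\<in>\<Omega>} <v, z'-z>/|z'-z| \<le> 0 is written out in epsilon-delta form.\<close>
definition regular_normal_cone :: "'a::real_inner set \<Rightarrow> 'a \<Rightarrow> 'a set" where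
  "regular_normal_cone \<Omega> z = {v. z \<in> \<Omega> \<and>
      (\<forall>\<epsilon>>0. \<exists>\<delta>>0. \<forall>z'\<in>\<Omega>. dist z' z < \<delta> \<longrightarrow> v \<bullet> (z' - z) \<le> \<epsilon> * norm (z' - z))}"

definition polar_cone :: "'a::real_inner set \<Rightarrow> 'a set" where
  "polar_cone A = {a'. \<forall>a\<in>A. a' \<bullet> a \<le> 0}"

definition lin_space :: "'a::real_vector set \<Rightarrow> 'a set" where
  "lin_space K = K \<inter> uminus ` K"

definition critical_cone :: "'a::real_inner set \<Rightarrow> 'a \<Rightarrow> 'a \<Rightarrow> 'a set" where
  "critical_cone \<Omega> z zs = tangent_cone \<Omega> z \<inter> {w. zs \<bullet> w = 0}"

definition gph :: "('a \<Rightarrow> 'b set) \<Rightarrow> ('a \<times> 'b) set" where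
  "gph F = {(a, b). b \<in> F a}"

definition graphical_derivative ::
  "('a::real_normed_vector \<Rightarrow> 'b::real_normed_vector set) \<Rightarrow> 'a \<Rightarrow> 'b \<Rightarrow> 'a \<Rightarrow> 'b set" where
  "graphical_derivative F z u w = {v. (w, v) \<in> tangent_cone (gph F) (z, u)}"

text \<open>f is C^2 on the open set U (Frechet derivatives; in finite dimensions, existence of the
  first derivative, differentiability of each directional derivative and continuity of
  all second directional derivatives is exactly C^2).\<close>
definition C2_on :: "'a::euclidean_space set \<Rightarrow> ('a \<Rightarrow> 'b::euclidean_space) \<Rightarrow> bool" where
  "C2_on U f \<longleftrightarrow> open U \<and>
     (\<forall>z\<in>U. f differentiable (at z)) \<and>
     (\<forall>v. \<forall>z\<in>U. (\<lambda>z'. frechet_derivative f (at z') v) differentiable (at z)) \<and>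
     (\<forall>v w. continuous_on U (\<lambda>z. frechet_derivative (\<lambda>z'. frechet_derivative f (at z') v) (at z) w))"

definition C2_around :: "('a::euclidean_space \<Rightarrow> 'b::euclidean_space) \<Rightarrow> 'a \<Rightarrow> bool" where
  "C2_around f z \<longleftrightarrow> (\<exists>U. z \<in> U \<and> C2_on U f)"

definition D1 :: "('a::real_normed_vector \<Rightarrow> 'b::real_normed_vector) \<Rightarrow> 'a \<Rightarrow> 'a \<Rightarrow> 'b" where
  "D1 f z = frechet_derivative f (at z)"

definition D2 :: "('a::real_normed_vector \<Rightarrow> 'b::real_normed_vector) \<Rightarrow> 'a \<Rightarrow> 'a \<Rightarrow> 'a \<Rightarrow> 'b" where
  "D2 f z v w = frechet_derivative (\<lambda>z'. D1 f z' v) (at z) w"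

definition Dx :: "('p::real_normed_vector \<times> 'x::real_normed_vector \<Rightarrow> 'e::real_normed_vector)
     \<Rightarrow> 'p \<times> 'x \<Rightarrow> 'x \<Rightarrow> 'e" where
  "Dx F z u = D1 F z (0, u)"

definition Dp :: "('p::real_normed_vector \<times> 'x::real_normed_vector \<Rightarrow> 'e::real_normed_vector)
     \<Rightarrow> 'p \<times> 'x \<Rightarrow> 'p \<Rightarrow> 'e" where
  "Dp F z q = D1 F z (q, 0)"

definition mult_set :: "('z::euclidean_space \<Rightarrow> 'e::euclidean_space) \<Rightarrow> 'e set \<Rightarrow> 'z \<Rightarrow> 'z \<Rightarrow> 'e set" where
  "mult_set G K z zs = {\<mu> \<in> polar_cone K. adjoint (D1 G z) \<mu> = zs}"

definition mult_set_dir ::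
  "('z::euclidean_space \<Rightarrow> 'e::euclidean_space) \<Rightarrow> 'e set \<Rightarrow> 'z \<Rightarrow> 'z \<Rightarrow> 'z \<Rightarrow> 'e set" where
  "mult_set_dir G K z zs v = {\<mu> \<in> mult_set G K z zs.
      \<forall>\<mu>'\<in>mult_set G K z zs. \<mu>' \<bullet> D2 G z v v \<le> \<mu> \<bullet> D2 G z v v}"

definition char_subspace ::
  "('p::euclidean_space \<times> 'x::euclidean_space \<Rightarrow> 'e::euclidean_space) \<Rightarrow> 'e set \<Rightarrow> 'p \<times> 'x \<Rightarrow> 'p set" where
  "char_subspace G K z = {q. Dp G z q \<in> {a + b | a b. a \<in> range (Dx G z) \<and> b \<in> lin_space K}}"

text \<open>Robinson stability of the system G(p,x) \<in> K at (p0,x0), where G is only meaningful on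
  the open set Vg (the domain where G = h o g is defined).  The distance to the empty
  set is +\<infinity>, hence the nonemptiness requirement.\<close>
definition robinson_stable ::
  "('p::euclidean_space \<times> 'x::euclidean_space \<Rightarrow> 'e::euclidean_space) \<Rightarrow> ('p \<times> 'x) set \<Rightarrow> 'e set
     \<Rightarrow> 'p \<Rightarrow> 'x \<Rightarrow> bool" where
  "robinson_stable G Vg K p0 x0 \<longleftrightarrow>
     (\<exists>\<kappa>\<ge>0. \<exists>W U. open W \<and> p0 \<in> W \<and> open U \<and> x0 \<in> U \<and>
        (\<forall>p\<in>W. \<forall>x\<in>U. (p, x) \<in> Vg \<longrightarrow>
            {x'. (p, x') \<in> Vg \<and> G (p, x') \<in> K} \<noteq> {} \<and>
            infdist x {x'. (p, x') \<in> Vg \<and> G (p, x') \<in> K} \<le> \<kappa> * infdist (G (p, x)) K))"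

end

theory Submission
  imports Defs "HOL-Real_Asymp.Real_Asymp"
begin

text \<open>Write \<open>A = DG(zb)\<close>.  A tangent direction \<open>(v, us)\<close> to the graph comes with multipliers \<open>\<mu>\<^sub>k\<close> at
  the approximating points, bounded by Robinson stability; a limit \<open>\<mu>\<close> yields \<open>zs = A\<^sup>* \<mu>\<close>.  Only the
  x-component of \<open>A\<^sup>*(\<mu>\<^sub>k - \<mu>) / t\<^sub>k\<close> is known to converge; a full characteristic subspace makes the
  p-component a linear function of it, while for polyhedral \<open>K\<close> closedness of finitely generated cones
  replaces convergence.

  Conversely, approximate dual solutions of the conic program defining the directional multipliers
  give, after a Robinson correction, a feasible arc that is optimal to second order.  Maximizing a
  linear function with a quadratic penalty over \<open>\<Gamma>(p)\<close> near that arc produces graph points with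
  the prescribed tangent.\<close>

section \<open>Local estimates for twice continuously differentiable maps\<close>

text \<open>Multipliers need not be unique, so first-order data cannot single out the right one; the
  selection happens at order \<open>t\<^sup>2\<close>. Pairing the expansion of \<open>G\<close>
  with a vector of the polar cone bounds its pairing with half the Hessian by a quotient of
  first-order terms, with equality for multipliers that are complementary at the approximating
  points. Maximality of the limit multiplier results from comparing the inequality with the
  equality. Conversely, the dual variable of the conic program is a second-order correction
  \<open>s\<close> of the ray \<open>zb + t *\<^sub>R v\<close>. The dual optimum need not be
  attained, so \<open>s\<close> may blow up as the accuracy improves: the accuracy is fixed first,
  \<open>t\<close> afterwards, and a diagonal sequence is formed. An arc point carries no normal
  vector; the penalized maximization supplies one, at the price of perturbing \<open>us\<close> by
  \<open>\<rho>\<close> times the rescaled deviation from the centre. Optimality of the arc bounds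
  the pairing of \<open>\<mu>\<close> with that deviation from below, feasibility bounds it from
  above, and criticality of the limit direction forces the deviation to vanish.\<close>

lemma C2_on_has_derivative:
  assumes "C2_on U f" "z \<in> U"
  shows "(f has_derivative D1 f z) (at z)"
  using assms by (auto simp: C2_on_def D1_def frechet_derivative_works)

lemma C2_on_D1_differentiable:
  assumes "C2_on U f" "z \<in> U"
  shows "(\<lambda>z'. D1 f z' a) differentiable (at z)"
  using assms by (auto simp: C2_on_def D1_def)

text \<open>Continuity of second derivatives is given only for fixed directions, so compactness
  bounds one basis direction at a time. The sum of these bounds is an operator norm bound, and the
  mean value inequality on the convex ball yields a Lipschitz constant, still depending on
  \<open>a\<close>.\<close>

lemma C2_on_D1_lipschitz_dir:
  fixes f :: "'a::euclidean_space \<Rightarrow> 'b::euclidean_space"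
  assumes f: "C2_on U f" and sub: "cball z0 r \<subseteq> U"
  obtains B where "0 \<le> B"
    "\<And>z z'. z \<in> cball z0 r \<Longrightarrow> z' \<in> cball z0 r \<Longrightarrow> norm (D1 f z a - D1 f z' a) \<le> B * norm (z - z')"
proof -
  have "\<exists>b\<ge>0. \<forall>z\<in>cball z0 r. norm (D2 f z a c) \<le> b" for c
  proof -
    have "continuous_on U (\<lambda>z. D2 f z a c)"
      using f by (simp add: C2_on_def D2_def D1_def)
    then have "compact ((\<lambda>z. D2 f z a c) ` cball z0 r)"
      by (intro compact_continuous_image continuous_on_subset[OF _ sub]) auto
    then have "bounded ((\<lambda>z. D2 f z a c) ` cball z0 r)"
      by (rule compact_imp_bounded)
    then obtain b where "0 < b" "\<forall>x\<in>(\<lambda>z. D2 f z a c) ` cball z0 r. norm x \<le> b"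
      unfolding bounded_pos by blast
    then show ?thesis by (intro exI[of _ b]) auto
  qed
  then obtain b where b: "\<And>c. b c \<ge> 0" "\<And>c z. z \<in> cball z0 r \<Longrightarrow> norm (D2 f z a c) \<le> b c"
    by metis
  define B where "B = (\<Sum>c\<in>Basis. b c)"
  have B0: "0 \<le> B" unfolding B_def by (intro sum_nonneg b)
  have der: "((\<lambda>z'. D1 f z' a) has_derivative D2 f z a) (at z within cball z0 r)" if "z \<in> cball z0 r" for z
    using C2_on_D1_differentiable[OF f, of z a] sub that
    unfolding D2_def by (metis frechet_derivative_works has_derivative_at_withinI subsetD)
  have "onorm (D2 f z a) \<le> B" if z: "z \<in> cball z0 r" for z
  proof (rule onorm_le)
    fix w
    have lin: "linear (D2 f z a)"
      using der[OF z] has_derivative_linear by blast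
    have "D2 f z a w = D2 f z a (\<Sum>c\<in>Basis. (w \<bullet> c) *\<^sub>R c)" by (simp add: euclidean_representation)
    also have "\<dots> = (\<Sum>c\<in>Basis. (w \<bullet> c) *\<^sub>R D2 f z a c)"
      using lin by (simp add: linear_sum linear_cmul)
    finally have "norm (D2 f z a w) \<le> (\<Sum>c\<in>Basis. norm ((w \<bullet> c) *\<^sub>R D2 f z a c))"
      by (simp only: norm_sum)
    also have "\<dots> \<le> (\<Sum>c\<in>Basis. norm w * b c)"
      using b z by (intro sum_mono) (auto intro!: mult_mono Basis_le_norm)
    also have "\<dots> = B * norm w" by (simp add: B_def sum_distrib_left mult.commute)
    finally show "norm (D2 f z a w) \<le> B * norm w" .
  qed
  then have "norm (D1 f z a - D1 f z' a) \<le> B * norm (z - z')"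
    if "z \<in> cball z0 r" "z' \<in> cball z0 r" for z z'
    using differentiable_bound[OF convex_cball der] that by blast
  then show ?thesis using that B0 by blast
qed

text \<open>Linearity in \<open>a\<close> reduces all directions to the finitely many basis vectors,
  so that a single \<open>L\<close> serves them all. \<open>M\<close> adds the variation over the
  ball to the operator norm at the centre.\<close>

lemma C2_on_local_estimates:
  fixes f :: "'a::euclidean_space \<Rightarrow> 'b::euclidean_space"
  assumes f: "C2_on U f" and z0: "z0 \<in> U"
  obtains r L M where "0 < r" "0 \<le> L" "0 \<le> M" "ball z0 r \<subseteq> U"
    "\<And>z a. z \<in> ball z0 r \<Longrightarrow> norm (D1 f z a) \<le> M * norm a"
    "\<And>z z' a. z \<in> ball z0 r \<Longrightarrow> z' \<in> ball z0 r \<Longrightarrow>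
       norm (D1 f z a - D1 f z' a) \<le> L * norm (z - z') * norm a"
proof -
  obtain r where r: "0 < r" "cball z0 r \<subseteq> U"
    using f z0 unfolding C2_on_def open_contains_cball by blast
  have "\<exists>B\<ge>0. \<forall>z\<in>cball z0 r. \<forall>z'\<in>cball z0 r. norm (D1 f z a - D1 f z' a) \<le> B * norm (z - z')" for a
    by (meson C2_on_D1_lipschitz_dir[OF f r(2)])
  then obtain B where B: "\<And>a. B a \<ge> 0" and
    lipB: "\<And>a z z'. z \<in> cball z0 r \<Longrightarrow> z' \<in> cball z0 r \<Longrightarrow> norm (D1 f z a - D1 f z' a) \<le> B a * norm (z - z')"
    by metis
  define L where "L = (\<Sum>c\<in>Basis. B c)"
  have L0: "0 \<le> L" unfolding L_def by (intro sum_nonneg B)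
  have lin: "linear (D1 f z)" if "z \<in> ball z0 r" for z
    using C2_on_has_derivative[OF f] r(2) that ball_subset_cball has_derivative_linear by (metis subsetD)
  have lip: "norm (D1 f z a - D1 f z' a) \<le> L * norm (z - z') * norm a"
    if z: "z \<in> ball z0 r" "z' \<in> ball z0 r" for z z' a
  proof -
    have rep: "D1 f y a = (\<Sum>c\<in>Basis. (a \<bullet> c) *\<^sub>R D1 f y c)" if "y \<in> ball z0 r" for y
    proof -
      have "D1 f y a = D1 f y (\<Sum>c\<in>Basis. (a \<bullet> c) *\<^sub>R c)" by (simp add: euclidean_representation)
      then show ?thesis using lin[OF that] by (simp add: linear_sum linear_cmul)
    qed
    have "norm (D1 f z a - D1 f z' a) = norm (\<Sum>c\<in>Basis. (a \<bullet> c) *\<^sub>R (D1 f z c - D1 f z' c))"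
      by (simp add: rep[OF z(1)] rep[OF z(2)] sum_subtractf scaleR_diff_right)
    also have "\<dots> \<le> (\<Sum>c\<in>Basis. norm ((a \<bullet> c) *\<^sub>R (D1 f z c - D1 f z' c)))"
      by (rule norm_sum)
    also have "\<dots> \<le> (\<Sum>c\<in>Basis. norm a * (B c * norm (z - z')))"
      using lipB z by (intro sum_mono) (auto intro!: mult_mono Basis_le_norm)
    also have "\<dots> = L * norm (z - z') * norm a"
      by (simp add: L_def sum_distrib_left sum_distrib_right algebra_simps)
    finally show ?thesis .
  qed
  define M where "M = onorm (D1 f z0) + L * r"
  have bl: "bounded_linear (D1 f z0)"
    using C2_on_has_derivative[OF f z0] has_derivative_bounded_linear by blast
  have bnd: "norm (D1 f z a) \<le> M * norm a" if z: "z \<in> ball z0 r" for z a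
  proof -
    have "norm (D1 f z a) \<le> norm (D1 f z0 a) + norm (D1 f z a - D1 f z0 a)"
      by (metis norm_triangle_sub)
    also have "\<dots> \<le> onorm (D1 f z0) * norm a + L * norm (z - z0) * norm a"
      using onorm[OF bl, of a] lip[OF z, of z0 a] r by simp
    also have "\<dots> \<le> onorm (D1 f z0) * norm a + L * r * norm a"
      using z L0 by (auto simp: dist_norm norm_minus_commute intro!: mult_right_mono mult_left_mono)
    finally show ?thesis by (simp add: M_def algebra_simps)
  qed
  have "0 \<le> M" using onorm_pos_le[OF bl] L0 r by (simp add: M_def)
  moreover have "ball z0 r \<subseteq> U" using r(2) ball_subset_cball by blast
  ultimately show ?thesis by (intro that[of r L M, OF r(1) L0 _ _ bnd lip])
qed

text \<open>The later expansions rest on a derivative that is Lipschitz near \<open>z0\<close> and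
  differentiable at \<open>z0\<close>; both properties pass through the chain rule without a formula
  for the second derivative of the composition.\<close>

lemma C2_compose_local:
  fixes g :: "'a::euclidean_space \<Rightarrow> 'b::euclidean_space" and h :: "'b \<Rightarrow> 'c::euclidean_space"
  assumes g: "C2_on U g" and z0: "z0 \<in> U" and h: "C2_on V h" and gz0: "g z0 \<in> V"
    and f: "f = (\<lambda>z. h (g z))"
  obtains r L where "0 < r" "0 \<le> L" "ball z0 r \<subseteq> g -` V"
    "\<And>z. z \<in> ball z0 r \<Longrightarrow> (f has_derivative D1 f z) (at z)"
    "\<And>z z' a. z \<in> ball z0 r \<Longrightarrow> z' \<in> ball z0 r \<Longrightarrow>
       norm (D1 f z a - D1 f z' a) \<le> L * norm (z - z') * norm a"
    "\<And>a. (\<lambda>z. D1 f z a) differentiable (at z0)"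
proof -
  obtain rg Lg Mg where rg: "0 < rg" "0 \<le> Lg" "0 \<le> Mg" "ball z0 rg \<subseteq> U"
    and bg: "\<And>z a. z \<in> ball z0 rg \<Longrightarrow> norm (D1 g z a) \<le> Mg * norm a"
    and lg: "\<And>z z' a. z \<in> ball z0 rg \<Longrightarrow> z' \<in> ball z0 rg \<Longrightarrow>
       norm (D1 g z a - D1 g z' a) \<le> Lg * norm (z - z') * norm a"
    using C2_on_local_estimates[OF g z0] by metis
  obtain rh Lh Mh where rh: "0 < rh" "0 \<le> Lh" "0 \<le> Mh" "ball (g z0) rh \<subseteq> V"
    and bh: "\<And>z a. z \<in> ball (g z0) rh \<Longrightarrow> norm (D1 h z a) \<le> Mh * norm a"
    and lh: "\<And>z z' a. z \<in> ball (g z0) rh \<Longrightarrow> z' \<in> ball (g z0) rh \<Longrightarrow>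
       norm (D1 h z a - D1 h z' a) \<le> Lh * norm (z - z') * norm a"
    using C2_on_local_estimates[OF h gz0] by metis
  have dg: "(g has_derivative D1 g z) (at z)" if "z \<in> ball z0 rg" for z
    using C2_on_has_derivative[OF g] that rg by blast
  have "isCont g z0"
    using dg[of z0] rg has_derivative_continuous by fastforce
  then obtain d where d: "d > 0" "\<And>z. dist z z0 < d \<Longrightarrow> dist (g z) (g z0) < rh"
    using rh(1) unfolding continuous_at_eps_delta by metis
  define r where "r = min d rg"
  have r: "0 < r" "ball z0 r \<subseteq> ball z0 rg" "\<And>z. z \<in> ball z0 r \<Longrightarrow> g z \<in> ball (g z0) rh"
    using d rg by (auto simp: r_def dist_commute)
  have df': "(f has_derivative (\<lambda>a. D1 h (g z) (D1 g z a))) (at z)" if z: "z \<in> ball z0 r" for z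
    unfolding f
    using has_derivative_compose[OF dg C2_on_has_derivative[OF h], of z] r(2,3) z rh(4) by blast
  have D1f: "D1 f z = (\<lambda>a. D1 h (g z) (D1 g z a))" if z: "z \<in> ball z0 r" for z
    using frechet_derivative_at[OF df'[OF z]] by (simp add: D1_def)
  have df: "(f has_derivative D1 f z) (at z)" if z: "z \<in> ball z0 r" for z
    using df' D1f z by metis
  have lipg: "norm (g z - g z') \<le> Mg * norm (z - z')" if "z \<in> ball z0 r" "z' \<in> ball z0 r" for z z'
  proof (rule differentiable_bound[of "ball z0 r" g "D1 g"])
    fix x assume "x \<in> ball z0 r"
    then show "(g has_derivative D1 g x) (at x within ball z0 r)"
      using dg r(2) has_derivative_at_withinI by blast
    show "onorm (D1 g x) \<le> Mg"
      using bg r(2) \<open>x \<in> ball z0 r\<close> by (intro onorm_le) blast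
  qed (use that in auto)
  \<comment> \<open>Moving the base point of \<open>D1 h\<close> costs \<open>Lh * Mg\<close> and
    meets \<open>D1 g z a\<close>, which costs another \<open>Mg\<close>; moving the base point of
    \<open>D1 g\<close> costs \<open>Lg\<close> and is seen through \<open>D1 h\<close>, which costs
    \<open>Mh\<close>.\<close>
  define L where "L = Lh * Mg * Mg + Mh * Lg"
  have L0: "0 \<le> L" using rg rh by (simp add: L_def)
  have lin_h: "linear (D1 h y)" if "y \<in> ball (g z0) rh" for y
    using C2_on_has_derivative[OF h] rh(4) that has_derivative_linear by blast
  have lip: "norm (D1 f z a - D1 f z' a) \<le> L * norm (z - z') * norm a"
    if z: "z \<in> ball z0 r" "z' \<in> ball z0 r" for z z' a
  proof -
    have "D1 f z a - D1 f z' a = (D1 h (g z) (D1 g z a) - D1 h (g z') (D1 g z a))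
        + D1 h (g z') (D1 g z a - D1 g z' a)"
      using z by (simp add: D1f linear_diff[OF lin_h[OF r(3)]])
    then have "norm (D1 f z a - D1 f z' a) \<le> norm (D1 h (g z) (D1 g z a) - D1 h (g z') (D1 g z a))
        + norm (D1 h (g z') (D1 g z a - D1 g z' a))"
      using norm_triangle_ineq by metis
    also have "\<dots> \<le> Lh * norm (g z - g z') * norm (D1 g z a) + Mh * norm (D1 g z a - D1 g z' a)"
      using lh[OF r(3) r(3)] bh[OF r(3)] z by (intro add_mono) blast+
    also have "\<dots> \<le> Lh * (Mg * norm (z - z')) * (Mg * norm a) + Mh * (Lg * norm (z - z') * norm a)"
    proof -
      have zz: "z \<in> ball z0 rg" "z' \<in> ball z0 rg" using z r(2) by blast+
      show ?thesis
        using lipg[OF z] bg[OF zz(1), of a] lg[OF zz, of a] rg(2,3) rh(2,3)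
        by (intro add_mono mult_mono mult_left_mono) auto
    qed
    finally show ?thesis by (simp add: L_def algebra_simps)
  qed
  have "(\<lambda>z. D1 f z a) differentiable (at z0)" for a
  proof -
    \<comment> \<open>Expanding \<open>D1 g z a\<close> in the basis freezes the direction argument
      of \<open>D1 h\<close>, so that differentiability of its directional derivatives and the
      product rule apply.\<close>
    let ?F = "\<lambda>z. \<Sum>c\<in>Basis. (D1 g z a \<bullet> c) *\<^sub>R D1 h (g z) c"
    have "?F differentiable (at z0)"
    proof (rule differentiable_sum, simp, intro ballI)
      fix c :: 'b
      show "(\<lambda>z. (D1 g z a \<bullet> c) *\<^sub>R D1 h (g z) c) differentiable (at z0)"
      proof (rule differentiable_scaleR)
        show "(\<lambda>z. D1 g z a \<bullet> c) differentiable (at z0)"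
          using C2_on_D1_differentiable[OF g z0] by (intro differentiable_inner) auto
        have "((\<lambda>y. D1 h y c) \<circ> g) differentiable (at z0)"
          using C2_on_D1_differentiable[OF h gz0] dg[of z0] rg(1)
          by (intro differentiable_chain_at) (auto simp: differentiable_def)
        then show "(\<lambda>z. D1 h (g z) c) differentiable (at z0)" by (simp add: o_def)
      qed
    qed
    then obtain F' where F': "(?F has_derivative F') (at z0)" unfolding differentiable_def by blast
    have eq: "?F z = D1 f z a" if "z \<in> ball z0 r" for z
    proof -
      have "D1 f z a = D1 h (g z) (\<Sum>c\<in>Basis. (D1 g z a \<bullet> c) *\<^sub>R c)"
        using that by (simp add: D1f euclidean_representation)
      then show ?thesis using lin_h[OF r(3)[OF that]] by (simp add: linear_sum linear_cmul)
    qed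
    show ?thesis
      using has_derivative_transform_within_open[OF F' open_ball, of z0 r "\<lambda>z. D1 f z a"] eq r(1)
      unfolding differentiable_def by auto
  qed
  moreover have "ball z0 r \<subseteq> g -` V" using r(3) rh(4) by blast
  ultimately show ?thesis by (intro that[of r L, OF r(1) L0 _ df lip])
qed

section \<open>Expansions and the tangent cone of the feasible graph\<close>

lemma norm_divide_le:
  fixes y :: "'a::real_normed_vector"
  assumes "0 < t" "norm y \<le> t * c"
  shows "norm ((1 / t) *\<^sub>R y) \<le> c"
  using assms by (simp add: pos_divide_le_eq mult.commute)

text \<open>The remainder of a Frechet derivative is small uniformly over bounded directions, so the
  direction may vary together with the step.\<close>

lemma difference_quotient_tendsto:
  fixes f :: "'a::real_normed_vector \<Rightarrow> 'b::real_normed_vector"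
  assumes f: "(f has_derivative f') (at z)"
    and t: "(t \<longlongrightarrow> 0) F" "\<forall>\<^sub>F j in F. (t j::real) > 0" and v: "(v \<longlongrightarrow> v0) F"
  shows "((\<lambda>j. (1 / t j) *\<^sub>R (f (z + t j *\<^sub>R v j) - f z)) \<longlongrightarrow> f' v0) F"
proof -
  have bl: "bounded_linear f'" and alt: "\<And>e. e > 0 \<Longrightarrow> \<exists>d>0. \<forall>y. norm (y - z) < d \<longrightarrow>
      norm (f y - f z - f' (y - z)) \<le> e * norm (y - z)"
    using f unfolding has_derivative_at_alt by auto
  have tv: "((\<lambda>j. t j *\<^sub>R v j) \<longlongrightarrow> 0) F"
    using tendsto_scaleR[OF t(1) v] by simp
  have "((\<lambda>j. (1 / t j) *\<^sub>R (f (z + t j *\<^sub>R v j) - f z) - f' (v j)) \<longlongrightarrow> 0) F"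
  proof (rule tendstoI)
    fix e :: real assume e: "e > 0"
    have nv: "norm v0 + 2 \<noteq> 0" using norm_ge_zero[of v0] by linarith
    \<comment> \<open>The directions are eventually shorter than \<open>norm v0 + 1\<close>; the 2
      in the denominator makes the final estimate strict.\<close>
    define e' where "e' = e / (norm v0 + 2)"
    have e': "e' > 0" unfolding e'_def by (intro divide_pos_pos e add_nonneg_pos) auto
    then obtain d where d: "d > 0" and db: "\<And>y. norm (y - z) < d \<Longrightarrow>
      norm (f y - f z - f' (y - z)) \<le> e' * norm (y - z)" using alt by blast
    have "\<forall>\<^sub>F j in F. norm (t j *\<^sub>R v j) < d"
      using tendstoD[OF tv d] by (simp add: dist_norm)
    moreover have "\<forall>\<^sub>F j in F. norm (v j) < norm v0 + 1"
      using order_tendstoD(2)[OF tendsto_norm[OF v]] by simp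
    ultimately show "\<forall>\<^sub>F j in F. dist ((1 / t j) *\<^sub>R (f (z + t j *\<^sub>R v j) - f z) - f' (v j)) 0 < e"
      using t(2)
    proof eventually_elim
      case (elim j)
      have "(1 / t j) *\<^sub>R (f (z + t j *\<^sub>R v j) - f z) - f' (v j)
          = (1 / t j) *\<^sub>R (f (z + t j *\<^sub>R v j) - f z - f' (t j *\<^sub>R v j))"
        using elim(3) by (simp add: scaleR_diff_right linear_cmul[OF bounded_linear.linear[OF bl]])
      moreover have "norm (f (z + t j *\<^sub>R v j) - f z - f' (t j *\<^sub>R v j)) \<le> e' * norm (t j *\<^sub>R v j)"
        using db[of "z + t j *\<^sub>R v j"] elim(1) by simp
      ultimately have "norm ((1 / t j) *\<^sub>R (f (z + t j *\<^sub>R v j) - f z) - f' (v j)) \<le> e' * norm (v j)"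
        using elim(3) by (simp add: pos_divide_le_eq mult_ac)
      also have "\<dots> \<le> e' * (norm v0 + 1)" using elim(2) e' by (intro mult_left_mono) auto
      also have "\<dots> < e' * (norm v0 + 2)" using e' by simp
      also have "\<dots> = e" using nv by (simp add: e'_def)
      finally show ?case by simp
    qed
  qed
  from tendsto_add[OF this bounded_linear.tendsto[OF bl v]] show ?thesis by simp
qed

text \<open>All local hypotheses are stated on one common ball. The slack \<epsilon> in the Robinson
  estimate stands for an infimum that need not be attained, and the corrected point
  \<open>x'\<close> is allowed to leave the ball.\<close>

locale parametric_system =
  fixes G :: "'p::euclidean_space \<times> 'x::euclidean_space \<Rightarrow> 'e::euclidean_space"
    and K :: "'e set" and \<Gamma> :: "'p \<Rightarrow> 'x set" and zb :: "'p \<times> 'x" and r L \<kappa> :: real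
  assumes K: "closed K" "convex K" "cone K"
    and r_pos: "0 < r" and L_nonneg: "0 \<le> L" and \<kappa>_nonneg: "0 \<le> \<kappa>"
    and G_derivative: "\<And>z. z \<in> ball zb r \<Longrightarrow> (G has_derivative D1 G z) (at z)"
    and D1_lipschitz: "\<And>z z' a. z \<in> ball zb r \<Longrightarrow> z' \<in> ball zb r \<Longrightarrow>
       norm (D1 G z a - D1 G z' a) \<le> L * norm (z - z') * norm a"
    and D1_differentiable: "\<And>a. (\<lambda>z. D1 G z a) differentiable (at zb)"
    and G_zb: "G zb = 0"
    and zb_in: "snd zb \<in> \<Gamma> (fst zb)"
    and \<Gamma>_iff: "\<And>p x. (p, x) \<in> ball zb r \<Longrightarrow> x \<in> \<Gamma> p \<longleftrightarrow> G (p, x) \<in> K"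
    and robinson: "\<And>p x \<epsilon>. (p, x) \<in> ball zb r \<Longrightarrow> 0 < \<epsilon> \<Longrightarrow>
       \<exists>x'\<in>\<Gamma> p. norm (x' - x) \<le> \<kappa> * infdist (G (p, x)) K + \<epsilon>"
begin

abbreviation A where "A \<equiv> D1 G zb"

lemma zb_ball [simp]: "zb \<in> ball zb r"
  using r_pos by simp

lemma D1_linear: "z \<in> ball zb r \<Longrightarrow> linear (D1 G z)"
  using G_derivative has_derivative_linear by blast

lemma A_linear: "linear A"
  by (rule D1_linear[OF zb_ball])

lemma A_bounded_linear: "bounded_linear A"
  using A_linear linear_conv_bounded_linear by blast

lemma gph_iff: "z \<in> ball zb r \<Longrightarrow> z \<in> gph \<Gamma> \<longleftrightarrow> G z \<in> K"
  using \<Gamma>_iff[of "fst z" "snd z"] by (simp add: gph_def split_beta)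

lemma zero_in_K: "0 \<in> K"
  using gph_iff[OF zb_ball] zb_in by (simp add: G_zb gph_def split_beta)

lemma K_scaleR: "k \<in> K \<Longrightarrow> 0 \<le> c \<Longrightarrow> c *\<^sub>R k \<in> K"
  using K(3) by (simp add: cone_def)

lemma K_add: "k \<in> K \<Longrightarrow> k' \<in> K \<Longrightarrow> k + k' \<in> K"
  using K(2,3) convex_cone by blast

lemma D2_derivative: "((\<lambda>z. D1 G z a) has_derivative D2 G zb a) (at zb)"
  using D1_differentiable by (simp add: D2_def[abs_def] frechet_derivative_works)

text \<open>Subtracting the linear map \<open>D1 G b\<close> from \<open>G\<close> leaves a map
  whose derivative is at most \<open>L * \<rho>\<close> on \<open>S\<close>, and the mean value
  inequality applies to it. The base point \<open>b\<close> is kept separate from \<open>z\<close>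
  and \<open>z'\<close> so that two points near \<open>zb\<close> can be compared with each
  other.\<close>

lemma linearization_bound:
  assumes "convex S" "S \<subseteq> ball zb r" "b \<in> ball zb r" "\<And>y. y \<in> S \<Longrightarrow> norm (y - b) \<le> \<rho>"
    and "z \<in> S" "z' \<in> S"
  shows "norm (G z - G z' - D1 G b (z - z')) \<le> L * \<rho> * norm (z - z')"
proof -
  have lin: "linear (D1 G b)" by (rule D1_linear[OF assms(3)])
  have "norm ((G z - D1 G b z) - (G z' - D1 G b z')) \<le> (L * \<rho>) * norm (z - z')"
  proof (rule differentiable_bound[OF assms(1) _ _ assms(5,6)])
    fix y assume y: "y \<in> S"
    then have yb: "y \<in> ball zb r" using assms(2) by blast
    have "(G has_derivative D1 G y) (at y within S)"
      using G_derivative[OF yb] by (rule has_derivative_at_withinI)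
    moreover have "(D1 G b has_derivative D1 G b) (at y within S)"
      using lin by (simp add: linear_imp_has_derivative)
    ultimately show "((\<lambda>y. G y - D1 G b y) has_derivative (\<lambda>a. D1 G y a - D1 G b a)) (at y within S)"
      by (rule has_derivative_diff)
    show "onorm (\<lambda>a. D1 G y a - D1 G b a) \<le> L * \<rho>"
    proof (rule onorm_le)
      fix a
      have "norm (D1 G y a - D1 G b a) \<le> L * norm (y - b) * norm a"
        by (rule D1_lipschitz[OF yb assms(3)])
      also have "\<dots> \<le> L * \<rho> * norm a"
        using assms(4)[OF y] L_nonneg by (intro mult_right_mono mult_left_mono) auto
      finally show "norm (D1 G y a - D1 G b a) \<le> L * \<rho> * norm a" .
    qed
  qed
  moreover have "(G z - D1 G b z) - (G z' - D1 G b z') = G z - G z' - D1 G b (z - z')"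
    by (simp add: linear_diff[OF lin])
  ultimately show ?thesis by simp
qed

lemma linearization_bound_segment:
  assumes "b \<in> ball zb r" "b + d \<in> ball zb r"
  shows "norm (G (b + d) - G b - D1 G b d) \<le> L * norm d * norm d"
proof -
  have sub: "closed_segment b (b + d) \<subseteq> ball zb r"
    using assms by (simp add: closed_segment_subset)
  have "norm (y - b) \<le> norm d" if "y \<in> closed_segment b (b + d)" for y
    using segment_bound1[OF that] by simp
  from linearization_bound[OF convex_closed_segment sub assms(1) this, of "b + d" b]
  show ?thesis by simp
qed

text \<open>The derivative of \<open>z \<mapsto> D1 G z a\<close> is known for each fixed
  \<open>a\<close>. The Lipschitz bound makes the cost of replacing \<open>a j\<close> by its limit
  at most \<open>L * norm (v j) * norm (a j - a0)\<close>, independently of the step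
  \<open>t j\<close>.\<close>

lemma D1_quotient_tendsto:
  assumes t: "(t \<longlongrightarrow> 0) F" "\<forall>\<^sub>F j in F. (t j::real) > 0" and v: "(v \<longlongrightarrow> v0) F" and a: "(a \<longlongrightarrow> a0) F"
  shows "((\<lambda>j. (1 / t j) *\<^sub>R (D1 G (zb + t j *\<^sub>R v j) (a j) - A (a j))) \<longlongrightarrow> D2 G zb a0 v0) F"
proof -
  let ?f = "\<lambda>j a. (1 / t j) *\<^sub>R (D1 G (zb + t j *\<^sub>R v j) a - A a)"
  have tv: "((\<lambda>j. t j *\<^sub>R v j) \<longlongrightarrow> 0) F"
    using tendsto_scaleR[OF t(1) v] by simp
  have "((\<lambda>j. ?f j (a j) - ?f j a0) \<longlongrightarrow> 0) F"
  proof (rule Lim_null_comparison)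
    show "((\<lambda>j. L * norm (v j) * norm (a j - a0)) \<longlongrightarrow> 0) F"
      using tendsto_mult[OF tendsto_mult[OF tendsto_const[of L] tendsto_norm[OF v]]
          tendsto_norm[OF tendsto_diff[OF a tendsto_const[of a0]]]] by simp
    have "\<forall>\<^sub>F j in F. norm (t j *\<^sub>R v j) < r"
      using tendstoD[OF tv r_pos] by (simp add: dist_norm)
    then show "\<forall>\<^sub>F j in F. norm (?f j (a j) - ?f j a0) \<le> L * norm (v j) * norm (a j - a0)"
      using t(2)
    proof eventually_elim
      case (elim j)
      have z: "zb + t j *\<^sub>R v j \<in> ball zb r" using elim(1) by (simp add: dist_norm)
      have "?f j (a j) - ?f j a0 = ?f j (a j - a0)"
        by (simp add: linear_diff[OF D1_linear[OF z]] linear_diff[OF A_linear] scaleR_diff_right)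
      moreover have "norm (D1 G (zb + t j *\<^sub>R v j) (a j - a0) - A (a j - a0))
          \<le> t j * (L * norm (v j) * norm (a j - a0))"
        using D1_lipschitz[OF z zb_ball, of "a j - a0"] elim(2) by (simp add: mult_ac)
      ultimately show ?case using norm_divide_le[OF elim(2)] by metis
    qed
  qed
  from tendsto_add[OF this difference_quotient_tendsto[OF D2_derivative t v, of a0]]
  show ?thesis by simp
qed

text \<open>The second derivative is available at \<open>zb\<close> alone, so the remainder is
  treated as a function of the step \<open>s\<close>: its derivative is \<open>o(s)\<close>, and the
  mean value inequality on \<open>{0..t}\<close> turns this into
  \<open>o(t\<^sup>2)\<close>.\<close>

lemma second_order_ray:
  assumes "0 < \<epsilon>"
  obtains \<delta> where "0 < \<delta>"
    "\<And>t. 0 < t \<Longrightarrow> t < \<delta> \<Longrightarrow>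
      norm (G (zb + t *\<^sub>R v) - t *\<^sub>R A v - (t\<^sup>2 / 2) *\<^sub>R D2 G zb v v) \<le> \<epsilon> * t\<^sup>2"
proof -
  let ?H = "D2 G zb v v"
  have nv: "norm v + 1 \<noteq> 0" using norm_ge_zero[of v] by linarith
  define e where "e = \<epsilon> / (norm v + 1)"
  have e: "e > 0" unfolding e_def using assms by (intro divide_pos_pos add_nonneg_pos) auto
  obtain d where d: "d > 0" and db: "\<And>y. norm (y - zb) < d \<Longrightarrow>
      norm (D1 G y v - A v - D2 G zb v (y - zb)) \<le> e * norm (y - zb)"
    using D2_derivative[of v] e unfolding has_derivative_at_alt by blast
  define \<delta> where "\<delta> = min d r / (norm v + 1)"
  have \<delta>: "\<delta> > 0" unfolding \<delta>_def using d r_pos by (intro divide_pos_pos add_nonneg_pos) auto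
  have small: "norm (s *\<^sub>R v) < min d r" if "0 \<le> s" "s < \<delta>" for s
  proof -
    have "norm (s *\<^sub>R v) \<le> s * (norm v + 1)" using that by (simp add: mult_left_mono)
    also have "\<dots> < \<delta> * (norm v + 1)" using that by (intro mult_strict_right_mono add_nonneg_pos) auto
    also have "\<dots> = min d r" using nv by (simp add: \<delta>_def)
    finally show ?thesis .
  qed
  have "norm (G (zb + t *\<^sub>R v) - t *\<^sub>R A v - (t\<^sup>2 / 2) *\<^sub>R ?H) \<le> \<epsilon> * t\<^sup>2" if t: "0 < t" "t < \<delta>" for t
  proof -
    let ?\<phi> = "\<lambda>s. G (zb + s *\<^sub>R v) - s *\<^sub>R A v - (s\<^sup>2 / 2) *\<^sub>R ?H"
    let ?d = "\<lambda>s. D1 G (zb + s *\<^sub>R v) v - A v - s *\<^sub>R ?H"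
    have "norm (?\<phi> t - ?\<phi> 0) \<le> (\<epsilon> * t) * norm (t - 0)"
    proof (rule differentiable_bound[of "{0..t}" ?\<phi> "\<lambda>s h. h *\<^sub>R ?d s"])
      fix s assume "s \<in> {0..t}"
      then have s: "0 \<le> s" "s \<le> t" "s < \<delta>" using t by auto
      have z: "zb + s *\<^sub>R v \<in> ball zb r" using small[OF s(1,3)] by (simp add: dist_norm)
      have "((\<lambda>s. G (zb + s *\<^sub>R v)) has_derivative (\<lambda>h. D1 G (zb + s *\<^sub>R v) (h *\<^sub>R v))) (at s within {0..t})"
        by (rule has_derivative_compose[of "\<lambda>s. zb + s *\<^sub>R v" "\<lambda>h. h *\<^sub>R v", OF _ G_derivative[OF z]])
           (auto intro!: derivative_eq_intros)
      moreover have "((\<lambda>s. s *\<^sub>R A v) has_derivative (\<lambda>h. h *\<^sub>R A v)) (at s within {0..t})"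
        by (auto intro!: derivative_eq_intros)
      moreover have "((\<lambda>s. (s\<^sup>2 / 2) *\<^sub>R ?H) has_derivative (\<lambda>h. (s * h) *\<^sub>R ?H)) (at s within {0..t})"
        by (auto intro!: derivative_eq_intros)
      ultimately have "(?\<phi> has_derivative
          (\<lambda>h. D1 G (zb + s *\<^sub>R v) (h *\<^sub>R v) - h *\<^sub>R A v - (s * h) *\<^sub>R ?H)) (at s within {0..t})"
        by (intro has_derivative_diff)
      moreover have "(\<lambda>h. D1 G (zb + s *\<^sub>R v) (h *\<^sub>R v) - h *\<^sub>R A v - (s * h) *\<^sub>R ?H) = (\<lambda>h. h *\<^sub>R ?d s)"
        by (simp add: fun_eq_iff linear_cmul[OF D1_linear[OF z]] scaleR_diff_right mult.commute)
      ultimately show "(?\<phi> has_derivative (\<lambda>h. h *\<^sub>R ?d s)) (at s within {0..t})" by metis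
      have "norm (?d s) \<le> e * norm (s *\<^sub>R v)"
        using db[of "zb + s *\<^sub>R v"] small[OF s(1,3)]
          linear_cmul[OF has_derivative_linear[OF D2_derivative]] by simp
      also have "\<dots> = s * (e * norm v)" using s(1) by simp
      also have "\<dots> \<le> t * (e * (norm v + 1))" using s e by (intro mult_mono) auto
      also have "\<dots> = \<epsilon> * t" using nv by (simp add: e_def)
      finally have *: "norm (?d s) \<le> \<epsilon> * t" .
      show "onorm (\<lambda>h. h *\<^sub>R ?d s) \<le> \<epsilon> * t"
      proof (rule onorm_le)
        fix h :: real
        show "norm (h *\<^sub>R ?d s) \<le> \<epsilon> * t * norm h"
          using mult_right_mono[OF *, of "\<bar>h\<bar>"] by (simp add: mult.commute)
      qed
    qed (use t in auto)
    then show ?thesis using t by (simp add: G_zb power2_eq_square mult.assoc)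
  qed
  then show ?thesis using that \<delta> by blast
qed

text \<open>The subtracted first-order term uses the moving direction \<open>v j\<close> and not its
  limit, hence no rate of convergence of \<open>v\<close> is involved. The filter is general because
  the lemma serves both sequences and the one-sided limit in the construction of the feasible
  arc.\<close>

lemma second_order_tendsto:
  assumes t: "(t \<longlongrightarrow> 0) F" "\<forall>\<^sub>F j in F. (t j::real) > 0" and v: "(v \<longlongrightarrow> v0) F"
  shows "((\<lambda>j. (1 / (t j)\<^sup>2) *\<^sub>R (G (zb + t j *\<^sub>R v j) - t j *\<^sub>R A (v j))) \<longlongrightarrow> (1/2) *\<^sub>R D2 G zb v0 v0) F"
proof -
  let ?R = "\<lambda>j v. (1 / (t j)\<^sup>2) *\<^sub>R (G (zb + t j *\<^sub>R v) - t j *\<^sub>R A v)"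
  have ray: "((\<lambda>j. ?R j v0) \<longlongrightarrow> (1/2) *\<^sub>R D2 G zb v0 v0) F"
  proof (rule tendstoI)
    fix e :: real assume e: "e > 0"
    obtain \<delta> where \<delta>: "0 < \<delta>" "\<And>t. 0 < t \<Longrightarrow> t < \<delta> \<Longrightarrow>
      norm (G (zb + t *\<^sub>R v0) - t *\<^sub>R A v0 - (t\<^sup>2 / 2) *\<^sub>R D2 G zb v0 v0) \<le> e/2 * t\<^sup>2"
      using second_order_ray[of "e/2" v0] e by auto
    have "\<forall>\<^sub>F j in F. t j < \<delta>" using order_tendstoD(2)[OF t(1) \<delta>(1)] .
    then show "\<forall>\<^sub>F j in F. dist (?R j v0) ((1/2) *\<^sub>R D2 G zb v0 v0) < e"
      using t(2)
    proof eventually_elim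
      case (elim j)
      have "?R j v0 - (1/2) *\<^sub>R D2 G zb v0 v0 = (1 / (t j)\<^sup>2) *\<^sub>R
         (G (zb + t j *\<^sub>R v0) - t j *\<^sub>R A v0 - ((t j)\<^sup>2 / 2) *\<^sub>R D2 G zb v0 v0)"
        using elim(2) by (simp add: scaleR_diff_right)
      then have "dist (?R j v0) ((1/2) *\<^sub>R D2 G zb v0 v0) = 1 / (t j)\<^sup>2 *
         norm (G (zb + t j *\<^sub>R v0) - t j *\<^sub>R A v0 - ((t j)\<^sup>2 / 2) *\<^sub>R D2 G zb v0 v0)"
        by (simp add: dist_norm)
      also have "\<dots> \<le> 1 / (t j)\<^sup>2 * (e/2 * (t j)\<^sup>2)"
        using \<delta>(2)[OF elim(2,1)] by (intro mult_left_mono) auto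
      also have "\<dots> < e" using elim(2) e by simp
      finally show ?case .
    qed
  qed
  have "((\<lambda>j. ?R j (v j) - ?R j v0) \<longlongrightarrow> 0) F"
  proof (rule Lim_null_comparison)
    show "((\<lambda>j. L * (norm (v j) + norm v0) * norm (v j - v0)) \<longlongrightarrow> 0) F"
      using tendsto_mult[OF tendsto_mult[OF tendsto_const[of L]
            tendsto_add[OF tendsto_norm[OF v] tendsto_const[of "norm v0"]]]
          tendsto_norm[OF tendsto_diff[OF v tendsto_const[of v0]]]] by simp
    have "((\<lambda>j. t j * (norm (v j) + norm v0)) \<longlongrightarrow> 0) F"
      using tendsto_mult[OF t(1) tendsto_add[OF tendsto_norm[OF v] tendsto_const[of "norm v0"]]] by simp
    then have "\<forall>\<^sub>F j in F. t j * (norm (v j) + norm v0) < r"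
      using order_tendstoD(2) r_pos by blast
    then show "\<forall>\<^sub>F j in F. norm (?R j (v j) - ?R j v0) \<le> L * (norm (v j) + norm v0) * norm (v j - v0)"
      using t(2)
    proof eventually_elim
      case (elim j)
      let ?\<rho> = "t j * (norm (v j) + norm v0)"
      have "norm (G (zb + t j *\<^sub>R v j) - G (zb + t j *\<^sub>R v0) -
          A ((zb + t j *\<^sub>R v j) - (zb + t j *\<^sub>R v0))) \<le> L * ?\<rho> * norm ((zb + t j *\<^sub>R v j) - (zb + t j *\<^sub>R v0))"
      proof (rule linearization_bound[of "cball zb ?\<rho>"])
        show "cball zb ?\<rho> \<subseteq> ball zb r" using elim(1) by auto
      qed (use elim(2) r_pos in \<open>auto simp: dist_norm norm_minus_commute mult_left_mono\<close>)
      moreover have "(zb + t j *\<^sub>R v j) - (zb + t j *\<^sub>R v0) = t j *\<^sub>R (v j - v0)"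
        by (simp add: algebra_simps)
      moreover have "A (t j *\<^sub>R (v j - v0)) = t j *\<^sub>R (A (v j) - A v0)"
        by (simp add: linear_diff[OF A_linear] linear_cmul[OF A_linear])
      ultimately have "norm (G (zb + t j *\<^sub>R v j) - G (zb + t j *\<^sub>R v0) - t j *\<^sub>R (A (v j) - A v0))
          \<le> L * ?\<rho> * norm (t j *\<^sub>R (v j - v0))" by metis
      also have "\<dots> = (t j)\<^sup>2 * (L * (norm (v j) + norm v0) * norm (v j - v0))"
        using elim(2) by (simp add: power2_eq_square mult_ac)
      finally have b: "norm (G (zb + t j *\<^sub>R v j) - G (zb + t j *\<^sub>R v0) - t j *\<^sub>R (A (v j) - A v0))
          \<le> (t j)\<^sup>2 * (L * (norm (v j) + norm v0) * norm (v j - v0))" .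
      have "?R j (v j) - ?R j v0 = (1 / (t j)\<^sup>2) *\<^sub>R
          (G (zb + t j *\<^sub>R v j) - G (zb + t j *\<^sub>R v0) - t j *\<^sub>R (A (v j) - A v0))"
        by (simp add: algebra_simps)
      then show ?case using norm_divide_le[OF _ b] elim(2) by simp
    qed
  qed
  from tendsto_add[OF this ray] show ?thesis by simp
qed

lemma first_order_tendsto:
  assumes "(t \<longlongrightarrow> 0) F" "\<forall>\<^sub>F j in F. (t j::real) > 0" "(v \<longlongrightarrow> v0) F"
  shows "((\<lambda>j. (1 / t j) *\<^sub>R G (zb + t j *\<^sub>R v j)) \<longlongrightarrow> A v0) F"
  using difference_quotient_tendsto[OF G_derivative[OF zb_ball] assms] by (simp add: G_zb)

section \<open>Tangent directions of the feasible graph as solutions of the linearized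
  inclusion\<close>

lemma tangent_imp_A_in_K:
  assumes "w \<in> tangent_cone (gph \<Gamma>) zb"
  shows "A w \<in> K"
proof -
  obtain t wk where t: "\<And>k. t k > 0" "t \<longlonglongrightarrow> 0" "wk \<longlonglongrightarrow> w" and z: "\<And>k. zb + t k *\<^sub>R wk k \<in> gph \<Gamma>"
    using assms unfolding tangent_cone_def by blast
  have "(\<lambda>k. t k *\<^sub>R wk k) \<longlonglongrightarrow> 0" using tendsto_scaleR[OF t(2,3)] by simp
  then have "\<forall>\<^sub>F k in sequentially. norm (t k *\<^sub>R wk k) < r"
    using tendstoD[OF _ r_pos] by (fastforce simp: dist_norm)
  then have "\<forall>\<^sub>F k in sequentially. (1 / t k) *\<^sub>R G (zb + t k *\<^sub>R wk k) \<in> K"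
  proof eventually_elim
    case (elim k)
    then have "zb + t k *\<^sub>R wk k \<in> ball zb r" by (simp add: dist_norm)
    then have "G (zb + t k *\<^sub>R wk k) \<in> K" using gph_iff z by blast
    then show ?case using K_scaleR t(1)[of k] by simp
  qed
  moreover have "(\<lambda>k. (1 / t k) *\<^sub>R G (zb + t k *\<^sub>R wk k)) \<longlonglongrightarrow> A w"
    using first_order_tendsto[OF t(2) _ t(3)] t(1) by simp
  ultimately show ?thesis
    by (intro Lim_in_closed_set[OF K(1) _ sequentially_bot])
qed

text \<open>Along the ray, \<open>G\<close> stays within \<open>o(t)\<close> of the cone point
  \<open>t *\<^sub>R A w\<close>. The Robinson correction therefore shifts the x-component by
  \<open>o(t)\<close> only and leaves the tangent direction unchanged.\<close>

lemma A_in_K_imp_tangent: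
  assumes "A w \<in> K"
  shows "w \<in> tangent_cone (gph \<Gamma>) zb"
proof -
  define R where "R t = (1 / t) *\<^sub>R G (zb + t *\<^sub>R w) - A w" for t
  \<comment> \<open>The factor \<open>norm w + 1\<close> keeps every ray point in the ball. The
    slack used later is \<open>T k * T k\<close>, which is negligible against the step.\<close>
  define T where "T k = r / ((norm w + 1) * (real k + 2))" for k
  have nw: "norm w + 1 > 0" using norm_ge_zero[of w] by linarith
  have Tpos: "T k > 0" for k using nw r_pos unfolding T_def by simp
  have T0: "T \<longlonglongrightarrow> 0" unfolding T_def using nw by real_asymp
  have RT: "(\<lambda>k. R (T k)) \<longlonglongrightarrow> 0"
    using tendsto_diff[OF first_order_tendsto[of T sequentially "\<lambda>_. w" w] tendsto_const[of "A w"]] T0 Tpos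
    by (simp add: R_def)
  have Tr: "zb + T k *\<^sub>R w \<in> ball zb r" for k
  proof -
    have "norm (T k *\<^sub>R w) < T k * (norm w + 1)" using Tpos[of k] by (simp add: algebra_simps)
    also have "\<dots> = r / (real k + 2)" using nw by (simp add: T_def)
    also have "\<dots> \<le> r" using r_pos by (simp add: field_simps)
    finally show ?thesis by (simp add: dist_norm)
  qed
  have "\<exists>x'. x' \<in> \<Gamma> (fst (zb + T k *\<^sub>R w)) \<and>
     norm (x' - snd (zb + T k *\<^sub>R w)) \<le> T k * (\<kappa> * norm (R (T k)) + T k)" for k
  proof -
    have "infdist (G (zb + T k *\<^sub>R w)) K \<le> dist (G (zb + T k *\<^sub>R w)) (T k *\<^sub>R A w)"
      by (rule infdist_le[OF K_scaleR[OF assms less_imp_le[OF Tpos]]])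
    also have "G (zb + T k *\<^sub>R w) - T k *\<^sub>R A w = T k *\<^sub>R R (T k)"
      using Tpos[of k] by (simp add: R_def scaleR_diff_right)
    then have "dist (G (zb + T k *\<^sub>R w)) (T k *\<^sub>R A w) = T k * norm (R (T k))"
      using Tpos[of k] by (simp add: dist_norm)
    finally have i: "\<kappa> * infdist (G (zb + T k *\<^sub>R w)) K \<le> T k * (\<kappa> * norm (R (T k)))"
      using mult_left_mono[OF _ \<kappa>_nonneg] by (metis mult.left_commute)
    obtain x' where "x' \<in> \<Gamma> (fst (zb + T k *\<^sub>R w))"
      "norm (x' - snd (zb + T k *\<^sub>R w)) \<le> \<kappa> * infdist (G (zb + T k *\<^sub>R w)) K + T k * T k"
      using robinson[of "fst (zb + T k *\<^sub>R w)" "snd (zb + T k *\<^sub>R w)" "T k * T k"] Tr[of k] Tpos[of k]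
      unfolding prod.collapse by (metis mult_pos_pos)
    then show ?thesis using i by (intro exI[of _ x']) (simp add: algebra_simps)
  qed
  then obtain X where X: "\<And>k. X k \<in> \<Gamma> (fst (zb + T k *\<^sub>R w))"
    "\<And>k. norm (X k - snd (zb + T k *\<^sub>R w)) \<le> T k * (\<kappa> * norm (R (T k)) + T k)" by metis
  define E where "E k = (1 / T k) *\<^sub>R (X k - snd (zb + T k *\<^sub>R w))" for k
  have "E \<longlonglongrightarrow> 0"
  proof (rule Lim_null_comparison)
    show "(\<lambda>k. \<kappa> * norm (R (T k)) + T k) \<longlonglongrightarrow> 0"
      using tendsto_add[OF tendsto_mult[OF tendsto_const[of \<kappa>] tendsto_norm[OF RT]] T0] by simp
    show "\<forall>\<^sub>F k in sequentially. norm (E k) \<le> \<kappa> * norm (R (T k)) + T k"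
      unfolding E_def by (intro always_eventually allI norm_divide_le Tpos X(2))
  qed
  then have "(\<lambda>k. w + (0, E k)) \<longlonglongrightarrow> w"
    using tendsto_add[OF tendsto_const[of w] tendsto_Pair[OF tendsto_const[of 0]]]
    by (metis add.right_neutral zero_prod_def)
  moreover have "zb + T k *\<^sub>R (w + (0, E k)) \<in> gph \<Gamma>" for k
  proof -
    have "zb + T k *\<^sub>R (w + (0, E k)) = (fst (zb + T k *\<^sub>R w), X k)"
      using Tpos[of k] by (simp add: prod_eq_iff E_def scaleR_add_right)
    then show ?thesis using X(1) by (simp add: gph_def)
  qed
  ultimately show ?thesis unfolding tangent_cone_def using T0 Tpos by blast
qed

lemma tangent_gph: "tangent_cone (gph \<Gamma>) zb = {w. A w \<in> K}"
  using A_in_K_imp_tangent tangent_imp_A_in_K by blast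

end

section \<open>Polyhedral cones and bounded multipliers\<close>

lemma polar_cone_closed: "closed (polar_cone A)"
proof -
  have "polar_cone A = (\<Inter>a\<in>A. {x. a \<bullet> x \<le> 0})"
    by (auto simp: polar_cone_def inner_commute)
  then show ?thesis by (simp add: closed_INT closed_halfspace_le)
qed

lemma polar_cone_lin_space:
  assumes "\<mu> \<in> polar_cone K" "l \<in> lin_space K"
  shows "\<mu> \<bullet> l = 0"
proof -
  have "l \<in> K" "-l \<in> K" using assms(2) by (auto simp: lin_space_def)
  then have "\<mu> \<bullet> l \<le> 0" "\<mu> \<bullet> (-l) \<le> 0" using assms(1) unfolding polar_cone_def by blast+
  then show ?thesis by simp
qed

text \<open>The offsets of the halfspaces can be set to 0: a positive value of \<open>a h\<close> at
  a point of the cone grows beyond the offset under scaling, and \<open>0 \<in> K\<close> makes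
  every offset nonnegative.\<close>

lemma polyhedral_cone_halfspaces:
  fixes K :: "'a::euclidean_space set"
  assumes "polyhedron K" "cone K" "0 \<in> K"
  obtains F where "finite F" "K = {y. \<forall>a\<in>F. a \<bullet> y \<le> 0}"
proof -
  obtain H where H: "finite H" "K = \<Inter> H" and Hh: "\<forall>h\<in>H. \<exists>a b. a \<noteq> 0 \<and> h = {x. a \<bullet> x \<le> b}"
    using assms(1) unfolding polyhedron_def by blast
  obtain a b where ab: "\<And>h. h \<in> H \<Longrightarrow> h = {x. a h \<bullet> x \<le> (b h :: real)}"
    using Hh by metis
  have "K = {y. \<forall>c\<in>a ` H. c \<bullet> y \<le> 0}"
  proof (intro equalityI subsetI)
    fix y assume y: "y \<in> K"
    have "a h \<bullet> y \<le> 0" if h: "h \<in> H" for h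
    proof (rule ccontr)
      assume "\<not> a h \<bullet> y \<le> 0"
      then have pos: "a h \<bullet> y > 0" by simp
      define c where "c = (\<bar>b h\<bar> + 1) / (a h \<bullet> y)"
      have "c \<ge> 0" using pos by (simp add: c_def)
      then have "c *\<^sub>R y \<in> h" using assms(2) y H(2) h by (auto simp: cone_def)
      then have "a h \<bullet> (c *\<^sub>R y) \<le> b h" using ab[OF h] by blast
      then show False using pos by (simp add: c_def)
    qed
    then show "y \<in> {y. \<forall>c\<in>a ` H. c \<bullet> y \<le> 0}" by blast
  next
    fix y assume y: "y \<in> {y. \<forall>c\<in>a ` H. c \<bullet> y \<le> 0}"
    have "y \<in> h" if h: "h \<in> H" for h
    proof -
      have "0 \<in> h" using assms(3) H(2) h by blast
      then have "0 \<le> b h" using ab[OF h] by (metis inner_zero_right mem_Collect_eq)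
      then have "a h \<bullet> y \<le> b h" using y h by fastforce
      then show ?thesis using ab[OF h] by blast
    qed
    then show "y \<in> K" using H(2) by blast
  qed
  then show ?thesis using that[of "a ` H"] H(1) by blast
qed

lemma convex_cone_hull_leI:
  assumes "\<mu> \<in> convex_cone hull F" "\<And>a. a \<in> F \<Longrightarrow> a \<bullet> y \<le> 0"
  shows "\<mu> \<bullet> y \<le> 0"
proof -
  have "F \<subseteq> {x. y \<bullet> x \<le> 0}" using assms(2) by (auto simp: inner_commute)
  then have "convex_cone hull F \<subseteq> {x. y \<bullet> x \<le> 0}"
    by (rule hull_minimal) (rule convex_cone_halfspace_le)
  then show ?thesis using assms(1) by (auto simp: inner_commute)
qed

lemma convex_cone_hull_eq_zeroI:
  assumes "\<mu> \<in> convex_cone hull F" "\<And>a. a \<in> F \<Longrightarrow> a \<bullet> y = 0"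
  shows "\<mu> \<bullet> y = 0"
  using convex_cone_hull_leI[OF assms(1), of y] convex_cone_hull_leI[OF assms(1), of "- y"] assms(2)
  by force

text \<open>A vector outside the finitely generated cone on the right would be separated from it by a
  direction d; moving from y along d stays in K but increases the pairing with \<mu>.\<close>
lemma polyhedral_normal_cone:
  fixes F :: "'a::euclidean_space set"
  assumes F: "finite F" and K: "K = {y. \<forall>a\<in>F. a \<bullet> y \<le> 0}"
    and \<mu>: "\<mu> \<in> polar_cone K" and y: "y \<in> K" "\<mu> \<bullet> y = 0"
  shows "\<mu> \<in> convex_cone hull {a\<in>F. a \<bullet> y = 0}"
proof (rule ccontr)
  let ?C = "convex_cone hull {a\<in>F. a \<bullet> y = 0}"
  assume not_in: "\<mu> \<notin> ?C"
  have C_closed: "closed ?C" using F by (simp add: closed_convex_cone_hull)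
  obtain d0 b where d0: "d0 \<bullet> \<mu> < b" "\<And>x. x \<in> ?C \<Longrightarrow> d0 \<bullet> x > b"
    using separating_hyperplane_closed_point[OF convex_convex_cone_hull C_closed not_in] by blast
  define d where "d = - d0"
  have b0: "b < 0" using d0(2)[of 0] convex_cone_hull_contains_0[of "{a\<in>F. a \<bullet> y = 0}"] by simp
  have d\<mu>: "\<mu> \<bullet> d > 0" using d0(1) b0 by (simp add: d_def inner_commute)
  have act: "a \<bullet> d \<le> 0" if a: "a \<in> F" "a \<bullet> y = 0" for a
  proof (rule ccontr)
    assume "\<not> a \<bullet> d \<le> 0"
    then have neg: "d0 \<bullet> a < 0" by (simp add: d_def inner_commute)
    \<comment> \<open>At this scale the pairing of \<open>d0\<close> with the multiple of
      \<open>a\<close> equals \<open>b\<close>, which the strict separation excludes.\<close>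
    define c where "c = b / (d0 \<bullet> a)"
    have "c \<ge> 0" using neg b0 by (simp add: c_def divide_nonpos_neg)
    then have "c *\<^sub>R a \<in> ?C" using a by (intro convex_cone_hull_mul hull_inc) auto
    then have "b < d0 \<bullet> (c *\<^sub>R a)" by (rule d0(2))
    then show False using neg by (simp add: c_def)
  qed
  have "\<exists>s>0. \<forall>a\<in>F. a \<bullet> (y + s *\<^sub>R d) \<le> 0"
  proof -
    have "\<exists>s>0. \<forall>s'. 0 < s' \<and> s' \<le> s \<longrightarrow> a \<bullet> (y + s' *\<^sub>R d) \<le> 0" if a: "a \<in> F" for a
    proof (cases "a \<bullet> y = 0")
      case True
      then show ?thesis using act[OF a] by (intro exI[of _ 1]) (auto simp: inner_add_right mult_nonneg_nonpos)
    next
      case False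
      then have neg: "a \<bullet> y < 0" using y(1) a K by force
      \<comment> \<open>An inactive constraint tolerates a positive step along \<open>d\<close>; the
        added 1 guards against a zero denominator.\<close>
      define s where "s = - (a \<bullet> y) / (\<bar>a \<bullet> d\<bar> + 1)"
      have s: "s > 0" unfolding s_def using neg by (intro divide_pos_pos) auto
      have "a \<bullet> (y + s' *\<^sub>R d) \<le> 0" if "0 < s'" "s' \<le> s" for s'
      proof -
        have "s' * (a \<bullet> d) \<le> s' * (\<bar>a \<bullet> d\<bar> + 1)" using that by (intro mult_left_mono) auto
        also have "\<dots> \<le> s * (\<bar>a \<bullet> d\<bar> + 1)" using that by (intro mult_right_mono) auto
        also have "\<dots> = - (a \<bullet> y)" unfolding s_def by (simp add: field_simps)
        finally show ?thesis by (simp add: inner_add_right)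
      qed
      then show ?thesis using s by blast
    qed
    then obtain s where s: "\<And>a. a \<in> F \<Longrightarrow> s a > 0"
      "\<And>a s'. a \<in> F \<Longrightarrow> 0 < s' \<Longrightarrow> s' \<le> s a \<Longrightarrow> a \<bullet> (y + s' *\<^sub>R d) \<le> 0" by metis
    \<comment> \<open>The element 1 keeps the minimum defined when \<open>F\<close> is
      empty.\<close>
    define m where "m = Min (insert 1 (s ` F))"
    have "m > 0" unfolding m_def using F s(1) by (subst Min_gr_iff) auto
    moreover have "m \<le> s a" if "a \<in> F" for a unfolding m_def using F that by (intro Min_le) auto
    ultimately show ?thesis using s(2) by blast
  qed
  then obtain s where s: "s > 0" "y + s *\<^sub>R d \<in> K" using K by blast
  then have "\<mu> \<bullet> (y + s *\<^sub>R d) \<le> 0" using \<mu> by (auto simp: polar_cone_def)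
  then show False using y(2) d\<mu> s(1) by (simp add: inner_add_right mult_le_0_iff)
qed

section \<open>Norm-bounded multipliers for regular normals of the moving feasible set\<close>

context parametric_system
begin

lemma partial_x_linear: "z \<in> ball zb r \<Longrightarrow> linear (\<lambda>\<xi>. D1 G z (0, \<xi>))"
proof -
  assume "z \<in> ball zb r"
  then interpret D: linear "D1 G z" by (rule D1_linear)
  show ?thesis
    by (rule linearI) (simp_all add: D.add[symmetric] D.scaleR[symmetric] del: D.add D.scaleR)
qed

lemma Dx_linear: "z \<in> ball zb r \<Longrightarrow> linear (Dx G z)"
  using partial_x_linear by (simp add: Dx_def[abs_def])

text \<open>This is the primal form of the multiplier bound. For small \<open>t\<close> the point
  \<open>y + t *\<^sub>R (k - l *\<^sub>R y)\<close> lies in \<open>K\<close>, where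
  \<open>y = G (p, x)\<close>, and \<open>G\<close> at \<open>x + t *\<^sub>R \<xi>\<close> misses
  it by \<open>t\<close> times the norm on the right, up to \<open>o(t)\<close>. Robinson stability
  makes \<open>x + t *\<^sub>R \<xi>\<close> feasible at a cost of \<kappa> times that gap, and the
  normal inequality is tested at the corrected point.\<close>

lemma regular_normal_distance_bound:
  assumes z: "(p, x) \<in> ball zb r" and xs: "xs \<in> regular_normal_cone (\<Gamma> p) x"
    and k: "k \<in> K" and l: "0 \<le> l"
  shows "xs \<bullet> \<xi> \<le> \<kappa> * norm xs * norm (Dx G (p, x) \<xi> - (k - l *\<^sub>R G (p, x)))"
proof -
  define y where "y = G (p, x)"
  have x: "x \<in> \<Gamma> p" using xs by (simp add: regular_normal_cone_def)
  then have y: "y \<in> K" using \<Gamma>_iff[OF z] by (simp add: y_def)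
  define k0 where "k0 = k - l *\<^sub>R y"
  define R where "R t = (1 / t) *\<^sub>R (G ((p, x) + t *\<^sub>R (0, \<xi>)) - y)" for t :: real
  define c where "c = norm (Dx G (p, x) \<xi> - k0)"
  define T where "T n = 1 / (real n + 1)" for n
  have T: "\<And>n. T n > 0" "T \<longlonglongrightarrow> 0" unfolding T_def by (auto intro: LIMSEQ_inverse_real_of_nat[unfolded inverse_eq_divide of_nat_Suc add.commute[of 1]])
  have R: "(\<lambda>n. R (T n)) \<longlonglongrightarrow> Dx G (p, x) \<xi>"
    unfolding R_def y_def Dx_def
    using difference_quotient_tendsto[OF G_derivative[OF z] T(2) _ tendsto_const[of "(0, \<xi>)"]] T(1) by simp
  have tv: "(\<lambda>n. (p, x) + T n *\<^sub>R (0, \<xi>)) \<longlonglongrightarrow> (p, x)"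
    using tendsto_add[OF tendsto_const[of "(p, x)"] tendsto_scaleR[OF T(2) tendsto_const[of "(0, \<xi>)"]]] by simp
  have ev_ball: "\<forall>\<^sub>F n in sequentially. (p, x + T n *\<^sub>R \<xi>) \<in> ball zb r"
    using topological_tendstoD[OF tv open_ball z] by simp
  have "\<forall>\<^sub>F n in sequentially. T n * l < 1"
    using order_tendstoD(2)[OF tendsto_mult[OF T(2) tendsto_const[of l]], of 1] by simp
  with ev_ball have ev: "\<forall>\<^sub>F n in sequentially. \<exists>e. x + T n *\<^sub>R (\<xi> + e) \<in> \<Gamma> p \<and>
      norm e \<le> \<kappa> * norm (R (T n) - k0) + T n"
  proof eventually_elim
    case (elim n)
    have "y + T n *\<^sub>R k0 = (1 - T n * l) *\<^sub>R y + T n *\<^sub>R k"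
      by (simp add: k0_def algebra_simps)
    then have inK: "y + T n *\<^sub>R k0 \<in> K" using y k elim(2) T(1)[of n] by (auto intro!: K_add K_scaleR)
    have "infdist (G (p, x + T n *\<^sub>R \<xi>)) K \<le> dist (G (p, x + T n *\<^sub>R \<xi>)) (y + T n *\<^sub>R k0)"
      by (rule infdist_le[OF inK])
    also have "G (p, x + T n *\<^sub>R \<xi>) - (y + T n *\<^sub>R k0) = T n *\<^sub>R (R (T n) - k0)"
      using T(1)[of n] by (simp add: R_def scaleR_diff_right)
    then have "dist (G (p, x + T n *\<^sub>R \<xi>)) (y + T n *\<^sub>R k0) = T n * norm (R (T n) - k0)"
      using T(1)[of n] by (simp add: dist_norm)
    finally have i: "\<kappa> * infdist (G (p, x + T n *\<^sub>R \<xi>)) K \<le> T n * (\<kappa> * norm (R (T n) - k0))"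
      using mult_left_mono[OF _ \<kappa>_nonneg] by (metis mult.left_commute)
    obtain x' where x': "x' \<in> \<Gamma> p"
      "norm (x' - (x + T n *\<^sub>R \<xi>)) \<le> \<kappa> * infdist (G (p, x + T n *\<^sub>R \<xi>)) K + T n * T n"
      using robinson[OF elim(1), of "T n * T n"] T(1)[of n] by auto
    have "norm ((1 / T n) *\<^sub>R (x' - (x + T n *\<^sub>R \<xi>))) \<le> \<kappa> * norm (R (T n) - k0) + T n"
      by (rule norm_divide_le[OF T(1)]) (use x'(2) i in \<open>simp add: algebra_simps\<close>)
    moreover have "x + T n *\<^sub>R (\<xi> + (1 / T n) *\<^sub>R (x' - (x + T n *\<^sub>R \<xi>))) = x'"
      using T(1)[of n] by (simp add: scaleR_add_right)
    ultimately show ?case using x'(1) by metis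
  qed
  \<comment> \<open>Two limits in succession: for fixed \<epsilon> in the definition of the normal
    cone the step tends to 0, and only then \<epsilon> tends to 0.\<close>
  have "xs \<bullet> \<xi> \<le> \<kappa> * norm xs * c + \<epsilon> * (norm \<xi> + \<kappa> * c)" if \<epsilon>: "\<epsilon> > 0" for \<epsilon>
  proof -
    obtain \<delta> where \<delta>: "\<delta> > 0" "\<And>x'. x' \<in> \<Gamma> p \<Longrightarrow> dist x' x < \<delta> \<Longrightarrow> xs \<bullet> (x' - x) \<le> \<epsilon> * norm (x' - x)"
      using xs \<epsilon> unfolding regular_normal_cone_def by blast
    define f where "f n = \<kappa> * norm (R (T n) - k0) + T n" for n
    have f: "f \<longlonglongrightarrow> \<kappa> * c"
      using tendsto_add[OF tendsto_mult[OF tendsto_const[of \<kappa>] tendsto_norm[OF tendsto_diff[OF R tendsto_const[of k0]]]] T(2)]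
      by (simp add: f_def[abs_def] c_def)
    have "(\<lambda>n. T n * (norm \<xi> + f n)) \<longlonglongrightarrow> 0"
      using tendsto_mult[OF T(2) tendsto_add[OF tendsto_const[of "norm \<xi>"] f]] by simp
    then have "\<forall>\<^sub>F n in sequentially. T n * (norm \<xi> + f n) < \<delta>"
      using order_tendstoD(2) \<delta>(1) by blast
    with ev have "\<forall>\<^sub>F n in sequentially. xs \<bullet> \<xi> \<le> norm xs * f n + \<epsilon> * (norm \<xi> + f n)"
    proof eventually_elim
      case (elim n)
      then obtain e where e: "x + T n *\<^sub>R (\<xi> + e) \<in> \<Gamma> p" "norm e \<le> f n" by (auto simp: f_def)
      have nle: "norm (\<xi> + e) \<le> norm \<xi> + f n" using norm_triangle_ineq[of \<xi> e] e(2) by linarith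
      have "dist (x + T n *\<^sub>R (\<xi> + e)) x = T n * norm (\<xi> + e)" using T(1)[of n] by (simp add: dist_norm)
      also have "\<dots> \<le> T n * (norm \<xi> + f n)" using nle T(1)[of n] by (intro mult_left_mono) auto
      finally have "xs \<bullet> (x + T n *\<^sub>R (\<xi> + e) - x) \<le> \<epsilon> * norm (x + T n *\<^sub>R (\<xi> + e) - x)"
        using \<delta>(2)[OF e(1)] elim(2) by linarith
      then have "T n * (xs \<bullet> (\<xi> + e)) \<le> T n * (\<epsilon> * norm (\<xi> + e))" using T(1)[of n] by (simp add: mult_ac)
      then have "xs \<bullet> (\<xi> + e) \<le> \<epsilon> * norm (\<xi> + e)" using T(1)[of n] by simp
      also have "\<dots> \<le> \<epsilon> * (norm \<xi> + f n)" using nle \<epsilon> by (intro mult_left_mono) auto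
      finally have "xs \<bullet> \<xi> \<le> - (xs \<bullet> e) + \<epsilon> * (norm \<xi> + f n)" by (simp add: inner_add_right)
      moreover have "- (xs \<bullet> e) \<le> norm xs * f n"
        using norm_cauchy_schwarz[of xs "- e"] mult_left_mono[OF e(2), of "norm xs"] by simp
      ultimately show ?case by linarith
    qed
    moreover have "(\<lambda>n. norm xs * f n + \<epsilon> * (norm \<xi> + f n)) \<longlonglongrightarrow> norm xs * (\<kappa> * c) + \<epsilon> * (norm \<xi> + \<kappa> * c)"
      by (intro tendsto_intros f)
    ultimately have "xs \<bullet> \<xi> \<le> norm xs * (\<kappa> * c) + \<epsilon> * (norm \<xi> + \<kappa> * c)"
      by (intro tendsto_lowerbound[OF _ _ sequentially_bot])
    then show ?thesis by (simp add: mult_ac)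
  qed
  then have *: "\<forall>\<^sub>F \<epsilon> in at_right 0. xs \<bullet> \<xi> \<le> \<kappa> * norm xs * c + \<epsilon> * (norm \<xi> + \<kappa> * c)"
    by (auto simp: eventually_at_right_less intro: eventually_at_rightI[of 0 1])
  have "((\<lambda>\<epsilon>. \<kappa> * norm xs * c + \<epsilon> * (norm \<xi> + \<kappa> * c)) \<longlongrightarrow> \<kappa> * norm xs * c + 0 * (norm \<xi> + \<kappa> * c)) (at_right 0)"
    by (intro tendsto_intros)
  from tendsto_lowerbound[OF this *] show ?thesis by (simp add: c_def k0_def y_def)
qed

text \<open>The norm bound is built into the candidate set, which makes its image \<open>M\<close>
  compact and separation possible. If a direction \<xi> separated \<open>xs\<close> from
  \<open>M\<close>, the residual of \<open>B \<xi>\<close> at its projection onto the closure of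
  \<open>K\<close> minus the ray through \<open>y\<close>, scaled to length \<open>l\<close>, would
  be an admissible multiplier whose pairing with \<open>B \<xi>\<close> is \<open>l\<close> times
  the distance; this contradicts the distance bound.\<close>

lemma bounded_multiplier:
  assumes z: "(p, x) \<in> ball zb r" and xs: "xs \<in> regular_normal_cone (\<Gamma> p) x"
  obtains \<mu> where "\<mu> \<in> polar_cone K" "\<mu> \<bullet> G (p, x) = 0" "norm \<mu> \<le> \<kappa> * norm xs"
    "\<And>\<xi>. \<mu> \<bullet> Dx G (p, x) \<xi> = xs \<bullet> \<xi>"
proof -
  define y where "y = G (p, x)"
  define B where "B = Dx G (p, x)"
  define l where "l = \<kappa> * norm xs"
  have l: "0 \<le> l" using \<kappa>_nonneg by (simp add: l_def)
  have B: "linear B" using Dx_linear[OF z] by (simp add: B_def)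
  have y: "y \<in> K" using xs \<Gamma>_iff[OF z] by (simp add: regular_normal_cone_def y_def)
  define N where "N = polar_cone K \<inter> {\<mu>. \<mu> \<bullet> y = 0}"
  define M where "M = adjoint B ` (N \<inter> cball 0 l)"
  have N_convex: "convex N" and N_closed: "closed N"
  proof -
    have "polar_cone K = (\<Inter>a\<in>K. {x. a \<bullet> x \<le> 0})" by (auto simp: polar_cone_def inner_commute)
    then have "convex (polar_cone K)" by (simp add: convex_INT convex_halfspace_le)
    moreover have "{\<mu>. \<mu> \<bullet> y = 0} = {\<mu>. y \<bullet> \<mu> = 0}" by (simp add: inner_commute)
    ultimately show "convex N" "closed N"
      by (simp_all add: N_def convex_Int convex_hyperplane closed_Int polar_cone_closed closed_hyperplane)
  qed
  have "compact (N \<inter> cball 0 l)" using N_closed by (simp add: closed_Int_compact)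
  moreover have "continuous_on (N \<inter> cball 0 l) (adjoint B)"
    by (intro linear_continuous_on linear_linear[THEN iffD2] adjoint_linear B)
  ultimately have M_closed: "closed M" unfolding M_def
    by (intro compact_imp_closed compact_continuous_image)
  have M_convex: "convex M" unfolding M_def
    by (intro convex_linear_image convex_Int N_convex convex_cball adjoint_linear B)
  have "xs \<in> M"
  proof (rule ccontr)
    assume not_in: "xs \<notin> M"
    obtain \<xi>0 b where sep: "\<xi>0 \<bullet> xs < b" "\<And>m. m \<in> M \<Longrightarrow> \<xi>0 \<bullet> m > b"
      using separating_hyperplane_closed_point[OF M_convex M_closed not_in] by blast
    define \<xi> where "\<xi> = - \<xi>0"
    define S where "S = {k - c *\<^sub>R y | k c. k \<in> K \<and> 0 \<le> c}"
    define T where "T = closure S"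
    have S0: "0 \<in> S" unfolding S_def using zero_in_K by force
    have S_convex: "convex S"
    proof (rule convexI)
      fix a b u v assume ab: "a \<in> S" "b \<in> S" and uv: "0 \<le> u" "0 \<le> v" "u + v = (1::real)"
      obtain k c k' c' where kc: "a = k - c *\<^sub>R y" "b = k' - c' *\<^sub>R y" "k \<in> K" "k' \<in> K" "0 \<le> c" "0 \<le> c'"
        using ab unfolding S_def by blast
      have "u *\<^sub>R a + v *\<^sub>R b = (u *\<^sub>R k + v *\<^sub>R k') - (u * c + v * c') *\<^sub>R y"
        by (simp add: kc algebra_simps)
      moreover have "u *\<^sub>R k + v *\<^sub>R k' \<in> K" using kc uv by (intro K_add K_scaleR)
      moreover have "0 \<le> u * c + v * c'" using kc uv by simp
      ultimately show "u *\<^sub>R a + v *\<^sub>R b \<in> S" unfolding S_def by blast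
    qed
    have S_cone: "c *\<^sub>R a \<in> S" if a: "a \<in> S" and c: "0 \<le> c" for a c
    proof -
      obtain k d where kd: "a = k - d *\<^sub>R y" "k \<in> K" "0 \<le> d" using a unfolding S_def by blast
      have "c *\<^sub>R a = c *\<^sub>R k - (c * d) *\<^sub>R y" by (simp add: kd scaleR_diff_right)
      then show ?thesis unfolding S_def using kd c K_scaleR by (auto intro!: exI[of _ "c *\<^sub>R k"] exI[of _ "c * d"])
    qed
    have T: "closed T" "convex T" "T \<noteq> {}" "S \<subseteq> T"
      using S_convex S0 closure_subset[of S] by (auto simp: T_def convex_closure)
    have T_cone: "c *\<^sub>R a \<in> T" if a: "a \<in> T" and c: "0 \<le> c" for a c
    proof -
      obtain s where s: "\<And>n. s n \<in> S" "s \<longlonglongrightarrow> a" using a unfolding T_def closure_sequential by blast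
      then have "(\<lambda>n. c *\<^sub>R s n) \<longlonglongrightarrow> c *\<^sub>R a" by (intro tendsto_intros)
      then show ?thesis using S_cone[OF s(1) c] unfolding T_def closure_sequential by metis
    qed
    define c0 where "c0 = closest_point T (B \<xi>)"
    define res where "res = B \<xi> - c0"
    have c0: "c0 \<in> T" using closest_point_in_set[OF T(1,3)] by (simp add: c0_def)
    have var: "res \<bullet> (a - c0) \<le> 0" if "a \<in> T" for a
      using closest_point_dot[OF T(2,1) that] by (simp add: res_def c0_def)
    have resc0: "res \<bullet> c0 = 0"
      using var[OF T_cone[OF c0, of 0]] var[OF T_cone[OF c0, of 2]]
      by (simp add: inner_diff_right)
    have resT: "res \<bullet> a \<le> 0" if "a \<in> T" for a
      using var[OF that] resc0 by (simp add: inner_diff_right)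
    have resK: "res \<bullet> k \<le> 0" if "k \<in> K" for k
      using resT[of k] T(4) that unfolding S_def by force
    have "- y \<in> S" unfolding S_def using zero_in_K by (auto intro!: exI[of _ 0] exI[of _ 1])
    then have "res \<bullet> y = 0" using resT[of "- y"] resK[OF y] T(4) by auto
    then have resN: "c *\<^sub>R res \<in> N" if "0 \<le> c" for c
      using resK that unfolding N_def polar_cone_def by (auto simp: mult_nonneg_nonpos)
    \<comment> \<open>For \<open>res = 0\<close> the quotient is 0 by the convention for division,
      so \<open>\<mu> = 0\<close> and the pairing identity below holds with both sides zero.\<close>
    define \<mu> where "\<mu> = (l / norm res) *\<^sub>R res"
    have "norm \<mu> \<le> l" using l by (simp add: \<mu>_def)
    then have "adjoint B \<mu> \<in> M" unfolding M_def using resN l by (auto simp: \<mu>_def)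
    from sep(2)[OF this] have "\<xi> \<bullet> adjoint B \<mu> < - b" by (simp add: \<xi>_def)
    then have "B \<xi> \<bullet> \<mu> < - b" by (simp add: adjoint_works[OF B])
    moreover have "B \<xi> \<bullet> \<mu> = l * norm res"
    proof -
      have "B \<xi> \<bullet> res = res \<bullet> res" using resc0 by (simp add: res_def inner_diff inner_commute)
      then show ?thesis
        by (cases "res = 0") (simp_all add: \<mu>_def dot_square_norm power2_eq_square)
    qed
    \<comment> \<open>The projection \<open>c0\<close> may lie in the closure only, so the distance
      bound is extended from \<open>S\<close> by continuity.\<close>
    moreover have "S \<subseteq> {c. xs \<bullet> \<xi> \<le> l * norm (B \<xi> - c)}"
      using regular_normal_distance_bound[OF z xs] unfolding S_def l_def B_def y_def by blast
    then have "T \<subseteq> {c. xs \<bullet> \<xi> \<le> l * norm (B \<xi> - c)}" unfolding T_def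
      by (rule closure_minimal) (intro closed_Collect_le continuous_intros)
    then have "xs \<bullet> \<xi> \<le> l * norm res" using c0 by (auto simp: res_def)
    ultimately show False using sep(1) by (simp add: \<xi>_def inner_commute)
  qed
  then obtain \<mu> where \<mu>: "\<mu> \<in> N" "norm \<mu> \<le> l" "adjoint B \<mu> = xs" unfolding M_def by auto
  have "\<mu> \<bullet> B \<xi> = xs \<bullet> \<xi>" for \<xi>
    using adjoint_works[OF B, of \<xi> \<mu>] \<mu>(3) by (simp add: inner_commute)
  then show ?thesis using that[of \<mu>] \<mu> by (simp add: N_def l_def B_def y_def)
qed

end

section \<open>Tangents to the graph of the normal cone map\<close>

context parametric_system
begin

text \<open>The argument \<open>a\<close> sits inside the function being differentiated, so
  linearity in it follows from linearity of \<open>D1 G z\<close> near \<open>zb\<close> together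
  with uniqueness of derivatives.\<close>

lemma D2_linear: "linear (\<lambda>a. D2 G zb a w)"
proof (rule linearI)
  fix a b
  have "((\<lambda>z. D1 G z a + D1 G z b) has_derivative (\<lambda>w. D2 G zb a w + D2 G zb b w)) (at zb)"
    by (intro has_derivative_add D2_derivative)
  then have "((\<lambda>z. D1 G z (a + b)) has_derivative (\<lambda>w. D2 G zb a w + D2 G zb b w)) (at zb)"
    by (rule has_derivative_transform_within_open[OF _ open_ball zb_ball])
       (metis D1_linear linear_add)
  from has_derivative_unique[OF D2_derivative this]
  show "D2 G zb (a + b) w = D2 G zb a w + D2 G zb b w" by metis
next
  fix c :: real and a
  have "((\<lambda>z. c *\<^sub>R D1 G z a) has_derivative (\<lambda>w. c *\<^sub>R D2 G zb a w)) (at zb)"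
    by (intro has_derivative_scaleR_right D2_derivative)
  then have "((\<lambda>z. D1 G z (c *\<^sub>R a)) has_derivative (\<lambda>w. c *\<^sub>R D2 G zb a w)) (at zb)"
    by (rule has_derivative_transform_within_open[OF _ open_ball zb_ball])
       (metis D1_linear linear_cmul)
  from has_derivative_unique[OF D2_derivative this]
  show "D2 G zb (c *\<^sub>R a) w = c *\<^sub>R D2 G zb a w" by metis
qed

text \<open>The vector representing \<open>\<xi> \<mapsto> \<langle>\<mu>, D\<^sup>2G(zb)((0, \<xi>), v)\<rangle>\<close>, which is the derivative of
  \<open>z \<mapsto> (Dx G z)\<^sup>* \<mu>\<close> in direction \<open>v\<close>.\<close>
definition hess :: "'e \<Rightarrow> 'p \<times> 'x \<Rightarrow> 'x" where
  "hess \<mu> v = adjoint (\<lambda>\<xi>. D2 G zb (0, \<xi>) v) \<mu>"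

lemma hess_inner: "hess \<mu> v \<bullet> \<xi> = \<mu> \<bullet> D2 G zb (0, \<xi>) v"
proof -
  have "linear (\<lambda>\<xi>. (0 :: 'p, \<xi> :: 'x))" by (rule linearI) auto
  from linear_compose[OF this D2_linear] have "linear (\<lambda>\<xi>. D2 G zb (0, \<xi>) v)"
    by (simp add: o_def)
  then show ?thesis unfolding hess_def by (simp add: adjoint_clauses)
qed

text \<open>Links \<open>hess\<close> to the derivative in the main statement. The coordinates of
  the adjoint are \<open>D1 G z (0, b) \<bullet> \<mu>\<close>, differentiable at \<open>zb\<close>
  one by one; this representation relies on linearity of \<open>Dx G z\<close> and hence is
  transferred within the ball.\<close>

lemma frechet_derivative_hess:
  "frechet_derivative (\<lambda>z. adjoint (Dx G z) \<mu>) (at zb) v = hess \<mu> v"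
proof -
  let ?f = "\<lambda>z. \<Sum>b\<in>Basis. (D1 G z (0, b) \<bullet> \<mu>) *\<^sub>R b"
  have f': "(?f has_derivative (\<lambda>v. \<Sum>b\<in>Basis. (D2 G zb (0, b) v \<bullet> \<mu>) *\<^sub>R b)) (at zb)"
    by (intro has_derivative_sum has_derivative_scaleR_left has_derivative_inner_left D2_derivative)
  have f: "?f z = adjoint (Dx G z) \<mu>" if "z \<in> ball zb r" for z
  proof -
    have "adjoint (Dx G z) \<mu> = (\<Sum>b\<in>Basis. (adjoint (Dx G z) \<mu> \<bullet> b) *\<^sub>R b)"
      by (rule euclidean_representation[symmetric])
    also have "\<dots> = ?f z"
      by (simp add: adjoint_clauses[OF Dx_linear[OF that]] Dx_def inner_commute)
    finally show ?thesis by simp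
  qed
  have "((\<lambda>z. adjoint (Dx G z) \<mu>) has_derivative
      (\<lambda>v. \<Sum>b\<in>Basis. (D2 G zb (0, b) v \<bullet> \<mu>) *\<^sub>R b)) (at zb)"
    by (rule has_derivative_transform_within_open[OF f' open_ball zb_ball f])
  from frechet_derivative_at[OF this]
  have "frechet_derivative (\<lambda>z. adjoint (Dx G z) \<mu>) (at zb) v = (\<Sum>b\<in>Basis. (D2 G zb (0, b) v \<bullet> \<mu>) *\<^sub>R b)"
    by (rule fun_cong[OF sym])
  also have "\<dots> = (\<Sum>b\<in>Basis. (hess \<mu> v \<bullet> b) *\<^sub>R b)"
    by (simp add: hess_inner inner_commute[of \<mu>])
  finally show ?thesis by (simp add: euclidean_representation)
qed

definition normal_map :: "'p \<times> 'x \<Rightarrow> 'x set" where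
  "normal_map z = regular_normal_cone (\<Gamma> (fst z)) (snd z)"

lemma adjoint_A: "adjoint A \<mu> \<bullet> a = \<mu> \<bullet> A a"
  by (simp add: adjoint_clauses[OF A_linear])

end

text \<open>\<open>w\<close> is the limit of the x-component of \<open>A\<^sup>*(\<mu>\<^sub>k - \<mu>) / t\<^sub>k\<close>.\<close>
locale multiplier_sequence = parametric_system G K \<Gamma> zb r L \<kappa>
  for G :: "'p::euclidean_space \<times> 'x::euclidean_space \<Rightarrow> 'e::euclidean_space"
    and K \<Gamma> zb r L \<kappa> +
  fixes t :: "nat \<Rightarrow> real" and vk :: "nat \<Rightarrow> 'p \<times> 'x" and \<mu>k :: "nat \<Rightarrow> 'e"
    and v :: "'p \<times> 'x" and \<mu> :: 'e and w :: 'x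
  assumes t_pos: "\<And>k. t k > 0" and t_lim: "t \<longlonglongrightarrow> 0" and v_lim: "vk \<longlonglongrightarrow> v" and \<mu>_lim: "\<mu>k \<longlonglongrightarrow> \<mu>"
    and feasible: "\<And>k. G (zb + t k *\<^sub>R vk k) \<in> K"
    and \<mu>k_polar: "\<And>k. \<mu>k k \<in> polar_cone K"
    and complementary: "\<And>k. \<mu>k k \<bullet> G (zb + t k *\<^sub>R vk k) = 0"
    and w_lim: "\<And>\<xi>. (\<lambda>k. (1 / t k) * ((\<mu>k k - \<mu>) \<bullet> A (0, \<xi>))) \<longlonglongrightarrow> w \<bullet> \<xi>"
begin

lemma t_ev: "\<forall>\<^sub>F k in sequentially. t k > 0"
  using t_pos by simp

lemma G_lim: "(\<lambda>k. (1 / t k) *\<^sub>R G (zb + t k *\<^sub>R vk k)) \<longlonglongrightarrow> A v"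
  by (rule first_order_tendsto[OF t_lim t_ev v_lim])

text \<open>The rescaled second-order remainder. Pairing it with a polar vector converts the sign of
  the pairing with \<open>G\<close> into an inequality between curvature and first-order terms; for
  \<open>\<mu>k k\<close>, complementarity makes it an equality.\<close>

definition R where "R k = (1 / (t k)\<^sup>2) *\<^sub>R (G (zb + t k *\<^sub>R vk k) - t k *\<^sub>R A (vk k))"

lemma R_lim: "R \<longlonglongrightarrow> (1/2) *\<^sub>R D2 G zb v v"
  unfolding R_def[abs_def] by (rule second_order_tendsto[OF t_lim t_ev v_lim])

lemma inner_R: "\<nu> \<bullet> R k = (1 / (t k)\<^sup>2) * (\<nu> \<bullet> G (zb + t k *\<^sub>R vk k)) - (1 / t k) * (\<nu> \<bullet> A (vk k))"
  using t_pos[of k] by (simp add: R_def inner_diff_right right_diff_distrib power2_eq_square)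

lemma polar_inner_R_le:
  assumes "\<nu> \<in> polar_cone K"
  shows "\<nu> \<bullet> R k \<le> - ((1 / t k) * (\<nu> \<bullet> A (vk k)))"
proof -
  have "\<nu> \<bullet> G (zb + t k *\<^sub>R vk k) \<le> 0" using assms feasible by (auto simp: polar_cone_def)
  then have "(1 / (t k)\<^sup>2) * (\<nu> \<bullet> G (zb + t k *\<^sub>R vk k)) \<le> 0" by (intro mult_nonneg_nonpos) auto
  then show ?thesis by (simp add: inner_R)
qed

lemma Av_in_K: "A v \<in> K"
  using Lim_in_closed_set[OF K(1) _ sequentially_bot G_lim] feasible K_scaleR t_pos
  by (simp add: less_imp_le)

lemma \<mu>_polar: "\<mu> \<in> polar_cone K"
  using Lim_in_closed_set[OF polar_cone_closed _ sequentially_bot \<mu>_lim] \<mu>k_polar by simp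

lemma \<mu>_Av: "\<mu> \<bullet> A v = 0"
proof -
  have "(\<lambda>k. \<mu>k k \<bullet> ((1 / t k) *\<^sub>R G (zb + t k *\<^sub>R vk k))) \<longlonglongrightarrow> \<mu> \<bullet> A v"
    by (rule tendsto_inner[OF \<mu>_lim G_lim])
  then show ?thesis using complementary by (simp add: LIMSEQ_const_iff)
qed

text \<open>Polar vectors annihilate \<open>lin_space K\<close>, so their pairing with
  \<open>A (q, 0)\<close> equals the one with some \<open>A (0, s q)\<close>. Convergence of the
  x-component thus forces convergence of the whole rescaled difference of adjoints, and its limit
  \<zeta> is the required normal.\<close>

lemma full_characteristic_subspace:
  assumes full: "char_subspace G K zb = UNIV"
  shows "(\<exists>\<zeta>. snd \<zeta> = w \<and> \<zeta> \<bullet> v = 0 \<and> (\<forall>a. A a \<in> K \<longrightarrow> \<mu> \<bullet> A a = 0 \<longrightarrow> \<zeta> \<bullet> a \<le> 0)) \<and>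
    (\<forall>\<mu>'\<in>polar_cone K. adjoint A \<mu>' = adjoint A \<mu> \<longrightarrow> \<mu>' \<bullet> D2 G zb v v \<le> \<mu> \<bullet> D2 G zb v v)"
proof -
  have "\<exists>s l. A (q, 0) = A (0, s) + l \<and> l \<in> lin_space K" for q
    using full unfolding char_subspace_def Dp_def Dx_def by blast
  then obtain s l where s: "\<And>q. A (q, 0) = A (0, s q) + l q" "\<And>q. l q \<in> lin_space K" by metis
  define \<zeta>k where "\<zeta>k k = (1 / t k) *\<^sub>R adjoint A (\<mu>k k - \<mu>)" for k
  have \<zeta>k_inner: "\<zeta>k k \<bullet> a = (1 / t k) * ((\<mu>k k - \<mu>) \<bullet> A a)" for k a
    by (simp add: \<zeta>k_def adjoint_A)
  have lim: "(\<lambda>k. \<zeta>k k \<bullet> a) \<longlonglongrightarrow> w \<bullet> s (fst a) + w \<bullet> snd a" for a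
  proof -
    have "A a = A (fst a, 0) + A (0, snd a)" by (simp flip: linear_add[OF A_linear])
    moreover have "(\<mu>k k - \<mu>) \<bullet> l (fst a) = 0" for k
      using polar_cone_lin_space[OF \<mu>_polar s(2)] polar_cone_lin_space[OF \<mu>k_polar s(2)]
      by (simp add: inner_diff_left)
    ultimately have "\<zeta>k k \<bullet> a = (1 / t k) * ((\<mu>k k - \<mu>) \<bullet> A (0, s (fst a))) + (1 / t k) * ((\<mu>k k - \<mu>) \<bullet> A (0, snd a))" for k
      by (simp add: \<zeta>k_inner s(1) inner_add_right distrib_left)
    then show ?thesis using tendsto_add[OF w_lim w_lim] by simp
  qed
  \<comment> \<open>\<open>s\<close> comes from a choice and is not known to be linear, so the limit
    vector is assembled from its coordinates.\<close>
  define \<zeta> where "\<zeta> = (\<Sum>i\<in>Basis. (w \<bullet> s (fst i) + w \<bullet> snd i) *\<^sub>R i)"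
  have \<zeta>_lim: "\<zeta>k \<longlonglongrightarrow> \<zeta>"
  proof (subst tendsto_componentwise_iff, intro ballI)
    fix i :: "'p \<times> 'x" assume "i \<in> Basis"
    then show "(\<lambda>k. \<zeta>k k \<bullet> i) \<longlonglongrightarrow> \<zeta> \<bullet> i" using lim[of i] by (simp add: \<zeta>_def)
  qed
  have \<zeta>a: "(\<lambda>k. \<zeta>k k \<bullet> a) \<longlonglongrightarrow> \<zeta> \<bullet> a" for a
    by (intro tendsto_intros \<zeta>_lim)
  have "snd \<zeta> \<bullet> \<xi> = w \<bullet> \<xi>" for \<xi>
  proof -
    have "(\<lambda>k. \<zeta>k k \<bullet> (0, \<xi>)) \<longlonglongrightarrow> w \<bullet> \<xi>" using w_lim by (simp add: \<zeta>k_inner)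
    from LIMSEQ_unique[OF \<zeta>a this] show ?thesis by (simp add: inner_prod_def)
  qed
  then have snd: "snd \<zeta> = w" by (metis vector_eq_rdot)
  have polar: "\<zeta> \<bullet> a \<le> 0" if a: "A a \<in> K" "\<mu> \<bullet> A a = 0" for a
  proof (rule LIMSEQ_le_const2[OF \<zeta>a], intro exI allI impI)
    fix k
    have "\<mu>k k \<bullet> A a \<le> 0" using \<mu>k_polar[of k] a(1) by (auto simp: polar_cone_def)
    then show "\<zeta>k k \<bullet> a \<le> 0" using t_pos[of k] a(2)
      by (simp add: \<zeta>k_inner inner_diff_left divide_nonpos_pos)
  qed
  have \<zeta>v_lim: "(\<lambda>k. \<zeta>k k \<bullet> vk k) \<longlonglongrightarrow> \<zeta> \<bullet> v" by (intro tendsto_intros \<zeta>_lim v_lim)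
  have \<mu>R: "(\<lambda>k. \<mu> \<bullet> R k) \<longlonglongrightarrow> \<mu> \<bullet> ((1/2) *\<^sub>R D2 G zb v v)" by (intro tendsto_intros R_lim)
  have \<mu>kR: "(\<lambda>k. \<mu>k k \<bullet> R k) \<longlonglongrightarrow> \<mu> \<bullet> ((1/2) *\<^sub>R D2 G zb v v)" by (intro tendsto_intros R_lim \<mu>_lim)
  have \<zeta>k_R: "\<zeta>k k \<bullet> vk k = - (\<mu>k k \<bullet> R k) - (1 / t k) * (\<mu> \<bullet> A (vk k))" for k
    by (simp add: \<zeta>k_inner inner_R complementary inner_diff_left right_diff_distrib)
  \<comment> \<open>The opposite sign is polarity at \<open>v\<close>. Here
    \<open>\<zeta>k k \<bullet> vk k\<close> is expressed through the remainder: complementarity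
    gives an identity for \<open>\<mu>k k\<close>, feasibility an inequality for \<mu>, and the two
    curvature terms have the same limit.\<close>
  have "0 \<le> \<zeta> \<bullet> v"
  proof (rule LIMSEQ_le[OF _ \<zeta>v_lim])
    show "(\<lambda>k. \<mu> \<bullet> R k - \<mu>k k \<bullet> R k) \<longlonglongrightarrow> 0" using tendsto_diff[OF \<mu>R \<mu>kR] by simp
    show "\<exists>N. \<forall>k\<ge>N. \<mu> \<bullet> R k - \<mu>k k \<bullet> R k \<le> \<zeta>k k \<bullet> vk k"
      using polar_inner_R_le[OF \<mu>_polar] \<zeta>k_R by (intro exI[of _ 0] allI impI) (smt (verit))
  qed
  with polar[OF Av_in_K \<mu>_Av] have \<zeta>v: "\<zeta> \<bullet> v = 0" by simp
  \<comment> \<open>A competitor has the same first-order terms as \<mu>, so the inequality for it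
    and the identity for \<open>\<mu>k k\<close> compare the curvature terms up to
    \<open>\<zeta>k k \<bullet> vk k\<close>, which tends to 0.\<close>
  have "\<mu>' \<bullet> D2 G zb v v \<le> \<mu> \<bullet> D2 G zb v v"
    if \<mu>': "\<mu>' \<in> polar_cone K" "adjoint A \<mu>' = adjoint A \<mu>" for \<mu>'
  proof -
    have "\<mu>' \<bullet> ((1/2) *\<^sub>R D2 G zb v v) \<le> \<zeta> \<bullet> v + \<mu> \<bullet> ((1/2) *\<^sub>R D2 G zb v v)"
    proof (rule LIMSEQ_le)
      show "(\<lambda>k. \<mu>' \<bullet> R k) \<longlonglongrightarrow> \<mu>' \<bullet> ((1/2) *\<^sub>R D2 G zb v v)" by (intro tendsto_intros R_lim)
      show "(\<lambda>k. \<zeta>k k \<bullet> vk k + \<mu>k k \<bullet> R k) \<longlonglongrightarrow> \<zeta> \<bullet> v + \<mu> \<bullet> ((1/2) *\<^sub>R D2 G zb v v)"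
        by (rule tendsto_add[OF \<zeta>v_lim \<mu>kR])
      have "\<mu>' \<bullet> A (vk k) = \<mu> \<bullet> A (vk k)" for k using \<mu>'(2) adjoint_A by metis
      then show "\<exists>N. \<forall>k\<ge>N. \<mu>' \<bullet> R k \<le> \<zeta>k k \<bullet> vk k + \<mu>k k \<bullet> R k"
        using polar_inner_R_le[OF \<mu>'(1)] \<zeta>k_R by (intro exI[of _ 0] allI impI) (smt (verit))
    qed
    then show ?thesis using \<zeta>v by simp
  qed
  then show ?thesis using snd \<zeta>v polar by blast
qed

text \<open>Only finitely many active index sets occur, so one of them is constant along a subsequence;
  the cone it generates contains both the multipliers and their limit, and its linear images are
  closed.\<close>
lemma polyhedral_case:
  assumes poly: "polyhedron K"
  shows "(\<exists>\<zeta>. snd \<zeta> = w \<and> \<zeta> \<bullet> v = 0 \<and> (\<forall>a. A a \<in> K \<longrightarrow> \<mu> \<bullet> A a = 0 \<longrightarrow> \<zeta> \<bullet> a \<le> 0)) \<and>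
    (\<forall>\<mu>'\<in>polar_cone K. adjoint A \<mu>' = adjoint A \<mu> \<longrightarrow> \<mu>' \<bullet> D2 G zb v v \<le> \<mu> \<bullet> D2 G zb v v)"
proof -
  obtain F where F: "finite F" "K = {y. \<forall>a\<in>F. a \<bullet> y \<le> 0}"
    using polyhedral_cone_halfspaces[OF poly K(3) zero_in_K] .
  define act where "act k = {a\<in>F. a \<bullet> G (zb + t k *\<^sub>R vk k) = 0}" for k
  have "finite (range act)"
    by (rule finite_subset[of _ "Pow F"]) (auto simp: act_def F(1))
  then obtain k0 where "infinite {k. act k = act k0}"
    using pigeonhole_infinite[OF infinite_UNIV_nat, of act] by auto
  then obtain \<sigma> :: "nat \<Rightarrow> nat" where \<sigma>: "strict_mono \<sigma>" "\<And>n. act (\<sigma> n) = act k0"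
    using infinite_enumerate by (metis (mono_tags, lifting) mem_Collect_eq)
  define E where "E = act k0"
  have E: "finite E" "E \<subseteq> F" using F(1) by (auto simp: E_def act_def)
  have E_act: "a \<bullet> G (zb + t (\<sigma> n) *\<^sub>R vk (\<sigma> n)) = 0" if "a \<in> E" for a n
    using that \<sigma>(2)[of n] by (auto simp: E_def act_def)
  have \<mu>k_E: "\<mu>k (\<sigma> n) \<in> convex_cone hull E" for n
    using polyhedral_normal_cone[OF F \<mu>k_polar feasible complementary, of "\<sigma> n"] \<sigma>(2)[of n]
    by (simp add: E_def act_def)
  have "(\<lambda>n. \<mu>k (\<sigma> n)) \<longlonglongrightarrow> \<mu>"
    using LIMSEQ_subseq_LIMSEQ[OF \<mu>_lim \<sigma>(1)] by (simp add: o_def)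
  then have \<mu>_E: "\<mu> \<in> convex_cone hull E"
    by (rule Lim_in_closed_set[OF closed_convex_cone_hull[OF E(1)] always_eventually[OF allI[OF \<mu>k_E]] sequentially_bot])
  define B where "B = adjoint (Dx G zb)"
  have B: "linear B" unfolding B_def by (intro adjoint_linear Dx_linear zb_ball)
  have B_inner: "B \<nu> \<bullet> \<xi> = \<nu> \<bullet> A (0, \<xi>)" for \<nu> \<xi>
    unfolding B_def by (simp add: adjoint_clauses[OF Dx_linear[OF zb_ball]] Dx_def)
  \<comment> \<open>The extra generator \<open>- \<mu>\<close> places all rescaled differences of
    multipliers in one finitely generated cone. They may be unbounded, but the image of that cone
    under \<open>B\<close> is closed; a preimage \<nu> of \<open>w\<close> then stands in for their
    missing limit.\<close>
  define H where "H = insert (- \<mu>) E"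
  have wk: "(1 / t (\<sigma> n)) *\<^sub>R (\<mu>k (\<sigma> n) - \<mu>) \<in> convex_cone hull H" for n
  proof -
    have "\<mu>k (\<sigma> n) \<in> convex_cone hull H"
      using \<mu>k_E[of n] hull_mono[of E H] by (auto simp: H_def)
    moreover have "- \<mu> \<in> convex_cone hull H" by (intro hull_inc) (simp add: H_def)
    ultimately have "\<mu>k (\<sigma> n) + - \<mu> \<in> convex_cone hull H" by (rule convex_cone_hull_add)
    then show ?thesis using t_pos[of "\<sigma> n"] by (intro convex_cone_hull_mul) auto
  qed
  have "(\<lambda>n. B ((1 / t (\<sigma> n)) *\<^sub>R (\<mu>k (\<sigma> n) - \<mu>))) \<longlonglongrightarrow> w"
  proof (subst tendsto_componentwise_iff, intro ballI)
    fix i :: 'x assume "i \<in> Basis"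
    show "(\<lambda>n. B ((1 / t (\<sigma> n)) *\<^sub>R (\<mu>k (\<sigma> n) - \<mu>)) \<bullet> i) \<longlonglongrightarrow> w \<bullet> i"
      using LIMSEQ_subseq_LIMSEQ[OF w_lim \<sigma>(1), of i] by (simp add: B_inner o_def)
  qed
  moreover have "closed (B ` (convex_cone hull H))"
    using E(1) by (simp add: H_def closed_convex_cone_hull flip: convex_cone_hull_linear_image[OF B])
  ultimately have "w \<in> B ` (convex_cone hull H)"
    by (intro Lim_in_closed_set[OF _ always_eventually[OF allI[OF imageI[OF wk]]] sequentially_bot])
  then obtain \<nu> where \<nu>: "\<nu> \<in> convex_cone hull H" "w = B \<nu>" by blast
  have E_polar: "a \<bullet> k \<le> 0" if "a \<in> E" "k \<in> K" for a k
    using that E(2) F(2) by blast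
  have "(\<lambda>n. (1 / t (\<sigma> n)) *\<^sub>R G (zb + t (\<sigma> n) *\<^sub>R vk (\<sigma> n))) \<longlonglongrightarrow> A v"
    using LIMSEQ_subseq_LIMSEQ[OF G_lim \<sigma>(1)] by (simp add: o_def)
  then have a_lim: "(\<lambda>n. a \<bullet> ((1 / t (\<sigma> n)) *\<^sub>R G (zb + t (\<sigma> n) *\<^sub>R vk (\<sigma> n)))) \<longlonglongrightarrow> a \<bullet> A v" for a
    by (intro tendsto_intros)
  have E_Av: "a \<bullet> A v = 0" if "a \<in> E" for a
  proof -
    have "(\<lambda>n. 0) \<longlonglongrightarrow> a \<bullet> A v" using a_lim[of a] E_act[OF that] by simp
    then show ?thesis by (simp add: LIMSEQ_const_iff)
  qed
  define \<zeta> where "\<zeta> = adjoint A \<nu>"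
  have "snd \<zeta> \<bullet> \<xi> = w \<bullet> \<xi>" for \<xi>
  proof -
    have "snd \<zeta> \<bullet> \<xi> = \<zeta> \<bullet> (0, \<xi>)" by (simp add: inner_prod_def)
    then show ?thesis by (simp add: \<zeta>_def adjoint_A \<nu>(2) B_inner)
  qed
  then have "snd \<zeta> = w" by (metis vector_eq_rdot)
  moreover have "\<zeta> \<bullet> v = 0"
    unfolding \<zeta>_def adjoint_A by (rule convex_cone_hull_eq_zeroI[OF \<nu>(1)]) (auto simp: H_def E_Av \<mu>_Av)
  moreover have "\<zeta> \<bullet> a \<le> 0" if "A a \<in> K" "\<mu> \<bullet> A a = 0" for a
    unfolding \<zeta>_def adjoint_A
    by (rule convex_cone_hull_leI[OF \<nu>(1)]) (use that E_polar in \<open>auto simp: H_def\<close>)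
  moreover have "\<mu>' \<bullet> D2 G zb v v \<le> \<mu> \<bullet> D2 G zb v v"
    if \<mu>': "\<mu>' \<in> polar_cone K" "adjoint A \<mu>' = adjoint A \<mu>" for \<mu>'
  proof -
    have eq: "\<mu>' \<bullet> A a = \<mu> \<bullet> A a" for a using \<mu>'(2) adjoint_A by metis
    \<comment> \<open>On the subsequence the limit multiplier is itself complementary at the
      approximating points. The remainder inequality is an equality for \<mu> and an inequality for
      a competitor with the same first-order terms.\<close>
    have "\<mu> \<bullet> G (zb + t (\<sigma> n) *\<^sub>R vk (\<sigma> n)) = 0" for n
      by (rule convex_cone_hull_eq_zeroI[OF \<mu>_E E_act])
    then have "\<mu>' \<bullet> R (\<sigma> n) \<le> \<mu> \<bullet> R (\<sigma> n)" for n
      using polar_inner_R_le[OF \<mu>'(1), of "\<sigma> n"] by (simp add: inner_R[of \<mu>] eq)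
    moreover have "(\<lambda>n. R (\<sigma> n)) \<longlonglongrightarrow> (1/2) *\<^sub>R D2 G zb v v"
      using LIMSEQ_subseq_LIMSEQ[OF R_lim \<sigma>(1)] by (simp add: o_def)
    then have "(\<lambda>n. \<nu> \<bullet> R (\<sigma> n)) \<longlonglongrightarrow> \<nu> \<bullet> ((1/2) *\<^sub>R D2 G zb v v)" for \<nu>
      by (intro tendsto_intros)
    ultimately have "\<mu>' \<bullet> ((1/2) *\<^sub>R D2 G zb v v) \<le> \<mu> \<bullet> ((1/2) *\<^sub>R D2 G zb v v)"
      by (meson LIMSEQ_le)
    then show ?thesis by simp
  qed
  ultimately show ?thesis by blast
qed

end

section \<open>Multiplier sequences behind a tangent direction\<close>

context parametric_system
begin

text \<open>Subtracting the multiplier equation at \<open>zb\<close> from the one at the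
  approximating points expresses the rescaled x-part of \<open>adjoint A (\<mu>k k - \<mu>)\<close>
  through \<open>uk k\<close> and the difference quotient of \<open>D1 G\<close>. Both converge,
  although \<open>\<mu>k k - \<mu>\<close> divided by \<open>t k\<close> need not.\<close>

lemma graph_tangent_sequences:
  assumes tan: "(v, us) \<in> tangent_cone (gph normal_map) (zb, xbs)"
  obtains t vk \<mu>k \<mu> where "multiplier_sequence G K \<Gamma> zb r L \<kappa> t vk \<mu>k v \<mu> (us - hess \<mu> v)"
    "\<And>\<xi>. \<mu> \<bullet> A (0, \<xi>) = xbs \<bullet> \<xi>"
proof -
  obtain t0 wk where t0: "\<And>k. t0 k > 0" "t0 \<longlonglongrightarrow> 0" and wk: "wk \<longlonglongrightarrow> (v, us)"
    and in_gph: "\<And>k. (zb, xbs) + t0 k *\<^sub>R wk k \<in> gph normal_map"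
    using tan unfolding tangent_cone_def by blast
  have v0: "(\<lambda>k. fst (wk k)) \<longlonglongrightarrow> v" and u0: "(\<lambda>k. snd (wk k)) \<longlonglongrightarrow> us"
    using tendsto_fst[OF wk] tendsto_snd[OF wk] by simp_all
  have "(\<lambda>k. zb + t0 k *\<^sub>R fst (wk k)) \<longlonglongrightarrow> zb"
    using tendsto_add[OF tendsto_const[of zb] tendsto_scaleR[OF t0(2) v0]] by simp
  then have "\<forall>\<^sub>F k in sequentially. zb + t0 k *\<^sub>R fst (wk k) \<in> ball zb r"
    using topological_tendstoD open_ball zb_ball by blast
  moreover have "(\<lambda>k. xbs + t0 k *\<^sub>R snd (wk k)) \<longlonglongrightarrow> xbs"
    using tendsto_add[OF tendsto_const[of xbs] tendsto_scaleR[OF t0(2) u0]] by simp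
  then have "\<forall>\<^sub>F k in sequentially. norm (xbs + t0 k *\<^sub>R snd (wk k)) < norm xbs + 1"
    by (intro order_tendstoD(2)[OF tendsto_norm]) auto
  ultimately obtain N where N: "\<And>k. k \<ge> N \<Longrightarrow> zb + t0 k *\<^sub>R fst (wk k) \<in> ball zb r"
    "\<And>k. k \<ge> N \<Longrightarrow> norm (xbs + t0 k *\<^sub>R snd (wk k)) < norm xbs + 1"
    unfolding eventually_sequentially by (metis (no_types, lifting) le_cases order_trans)
  \<comment> \<open>The shift by \<open>N\<close> turns eventual properties into properties of every
    index, as \<open>multiplier_sequence\<close> demands.\<close>
  define zk where "zk k = zb + t0 (k + N) *\<^sub>R fst (wk (k + N))" for k
  define xk where "xk k = xbs + t0 (k + N) *\<^sub>R snd (wk (k + N))" for k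
  have zk: "zk k \<in> ball zb r" and xk: "norm (xk k) \<le> norm xbs + 1" for k
    using N[of "k + N"] by (auto simp: zk_def xk_def)
  have normal: "xk k \<in> regular_normal_cone (\<Gamma> (fst (zk k))) (snd (zk k))" for k
    using in_gph[of "k + N"] by (simp add: gph_def zk_def xk_def normal_map_def split_beta)
  have "\<exists>\<mu>. \<mu> \<in> polar_cone K \<and> \<mu> \<bullet> G (zk k) = 0 \<and> norm \<mu> \<le> \<kappa> * (norm xbs + 1) \<and>
      (\<forall>\<xi>. \<mu> \<bullet> D1 G (zk k) (0, \<xi>) = xk k \<bullet> \<xi>)" for k
  proof -
    have z: "(fst (zk k), snd (zk k)) \<in> ball zb r" using zk by simp
    obtain \<mu> where "\<mu> \<in> polar_cone K" "\<mu> \<bullet> G (zk k) = 0" "norm \<mu> \<le> \<kappa> * norm (xk k)"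
      "\<And>\<xi>. \<mu> \<bullet> D1 G (zk k) (0, \<xi>) = xk k \<bullet> \<xi>"
      using bounded_multiplier[OF z normal[of k]] unfolding Dx_def by auto
    then show ?thesis using mult_left_mono[OF xk[of k] \<kappa>_nonneg] by (intro exI[of _ \<mu>]) auto
  qed
  then obtain m where m: "\<And>k. m k \<in> polar_cone K" "\<And>k. m k \<bullet> G (zk k) = 0"
      "\<And>k. norm (m k) \<le> \<kappa> * (norm xbs + 1)" "\<And>k \<xi>. m k \<bullet> D1 G (zk k) (0, \<xi>) = xk k \<bullet> \<xi>"
    by metis
  have "\<forall>k. m k \<in> cball 0 (\<kappa> * (norm xbs + 1))" using m(3) by simp
  then obtain \<mu> \<sigma> where \<sigma>: "strict_mono (\<sigma> :: nat \<Rightarrow> nat)" "(m \<circ> \<sigma>) \<longlonglongrightarrow> \<mu>"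
    using compact_cball[of "0::'e" "\<kappa> * (norm xbs + 1)"] unfolding compact_def by metis
  define t where "t k = t0 (\<sigma> k + N)" for k
  define vk where "vk k = fst (wk (\<sigma> k + N))" for k
  define uk where "uk k = snd (wk (\<sigma> k + N))" for k
  define \<mu>k where "\<mu>k k = m (\<sigma> k)" for k
  have "strict_mono (\<lambda>k. \<sigma> k + N)" using \<sigma>(1) by (simp add: strict_mono_def)
  then have lims: "t \<longlonglongrightarrow> 0" "vk \<longlonglongrightarrow> v" "uk \<longlonglongrightarrow> us" "\<mu>k \<longlonglongrightarrow> \<mu>"
    using LIMSEQ_subseq_LIMSEQ[OF t0(2)] LIMSEQ_subseq_LIMSEQ[OF v0] LIMSEQ_subseq_LIMSEQ[OF u0] \<sigma>(2)
    unfolding t_def[abs_def] vk_def[abs_def] uk_def[abs_def] \<mu>k_def[abs_def] o_def by blast+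
  have tpos: "t k > 0" for k using t0(1) by (simp add: t_def)
  have z_eq: "zk (\<sigma> k) = zb + t k *\<^sub>R vk k" and x_eq: "xk (\<sigma> k) = xbs + t k *\<^sub>R uk k" for k
    by (simp_all add: zk_def xk_def t_def vk_def uk_def)
  have feas: "G (zk k) \<in> K" for k
    using normal[of k] zk[of k] \<Gamma>_iff[of "fst (zk k)" "snd (zk k)"]
    by (simp add: regular_normal_cone_def del: mem_ball)
  have mult: "\<mu>k k \<bullet> D1 G (zb + t k *\<^sub>R vk k) (0, \<xi>) = (xbs + t k *\<^sub>R uk k) \<bullet> \<xi>" for k \<xi>
    using m(4)[of "\<sigma> k" \<xi>] by (simp add: z_eq x_eq \<mu>k_def)
  have tev: "\<forall>\<^sub>F k in sequentially. t k > 0" using tpos by simp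
  have dq: "(\<lambda>k. (1 / t k) *\<^sub>R (D1 G (zb + t k *\<^sub>R vk k) a - A a)) \<longlonglongrightarrow> D2 G zb a v" for a
    by (rule D1_quotient_tendsto[OF lims(1) tev lims(2) tendsto_const])
  have adj: "\<mu> \<bullet> A (0, \<xi>) = xbs \<bullet> \<xi>" for \<xi>
  proof (rule LIMSEQ_unique)
    have "(\<lambda>k. A (0, \<xi>) + t k *\<^sub>R ((1 / t k) *\<^sub>R (D1 G (zb + t k *\<^sub>R vk k) (0, \<xi>) - A (0, \<xi>)))) \<longlonglongrightarrow>
      A (0, \<xi>) + 0 *\<^sub>R D2 G zb (0, \<xi>) v"
      by (intro tendsto_intros dq lims)
    then have "(\<lambda>k. D1 G (zb + t k *\<^sub>R vk k) (0, \<xi>)) \<longlonglongrightarrow> A (0, \<xi>)"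
      using tpos by (simp add: less_imp_neq[symmetric])
    from tendsto_inner[OF lims(4) this]
    show "(\<lambda>k. (xbs + t k *\<^sub>R uk k) \<bullet> \<xi>) \<longlonglongrightarrow> \<mu> \<bullet> A (0, \<xi>)" by (simp add: mult)
    have "(\<lambda>k. (xbs + t k *\<^sub>R uk k) \<bullet> \<xi>) \<longlonglongrightarrow> (xbs + 0 *\<^sub>R us) \<bullet> \<xi>"
      by (intro tendsto_intros lims)
    then show "(\<lambda>k. (xbs + t k *\<^sub>R uk k) \<bullet> \<xi>) \<longlonglongrightarrow> xbs \<bullet> \<xi>" by simp
  qed
  have wlim: "(\<lambda>k. (1 / t k) * ((\<mu>k k - \<mu>) \<bullet> A (0, \<xi>))) \<longlonglongrightarrow> (us - hess \<mu> v) \<bullet> \<xi>" for \<xi>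
  proof -
    have "(1 / t k) * ((\<mu>k k - \<mu>) \<bullet> A (0, \<xi>)) = uk k \<bullet> \<xi> -
        \<mu>k k \<bullet> ((1 / t k) *\<^sub>R (D1 G (zb + t k *\<^sub>R vk k) (0, \<xi>) - A (0, \<xi>)))" for k
      using tpos[of k] mult[of k \<xi>] adj[of \<xi>]
      by (simp add: inner_diff_left inner_diff_right inner_add_left field_simps)
    moreover have "(\<lambda>k. uk k \<bullet> \<xi> - \<mu>k k \<bullet> ((1 / t k) *\<^sub>R (D1 G (zb + t k *\<^sub>R vk k) (0, \<xi>) - A (0, \<xi>))))
        \<longlonglongrightarrow> us \<bullet> \<xi> - \<mu> \<bullet> D2 G zb (0, \<xi>) v"
      by (intro tendsto_intros lims dq)
    ultimately show ?thesis by (simp add: inner_diff_left hess_inner)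
  qed
  have "multiplier_sequence G K \<Gamma> zb r L \<kappa> t vk \<mu>k v \<mu> (us - hess \<mu> v)"
    using tpos lims feas[of "\<sigma> _"] m(1) m(2)[of "\<sigma> _"] wlim
    by unfold_locales (simp_all add: z_eq \<mu>k_def)
  then show ?thesis using that adj by blast
qed

end

section \<open>Construction of graph points\<close>

lemma tangent_cone_eventuallyI:
  assumes ev: "\<forall>\<^sub>F k in sequentially. t k > 0 \<and> z + t k *\<^sub>R wk k \<in> \<Omega>"
    and "t \<longlonglongrightarrow> 0" "wk \<longlonglongrightarrow> w"
  shows "w \<in> tangent_cone \<Omega> z"
proof -
  obtain N where "\<forall>k\<ge>N. t k > 0 \<and> z + t k *\<^sub>R wk k \<in> \<Omega>"
    using ev unfolding eventually_sequentially by blast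
  moreover have "(\<lambda>k. t (k + N)) \<longlonglongrightarrow> 0" "(\<lambda>k. wk (k + N)) \<longlonglongrightarrow> w"
    using assms(2,3) by (simp_all add: LIMSEQ_ignore_initial_segment)
  ultimately show ?thesis unfolding tangent_cone_def
    by (intro CollectI exI[of _ "\<lambda>k. t (k + N)"] exI[of _ "\<lambda>k. wk (k + N)"]) simp
qed

context parametric_system
begin

text \<open>Strong duality without dual attainment for the linear conic program defining the directional
  multipliers: only approximate dual solutions \<open>s\<close> are available.\<close>
lemma approximate_dual_solution:
  assumes \<mu>: "\<mu> \<in> polar_cone K"
    and max: "\<And>\<mu>'. \<mu>' \<in> polar_cone K \<Longrightarrow> adjoint A \<mu>' = adjoint A \<mu> \<Longrightarrow> \<mu>' \<bullet> \<eta> \<le> \<mu> \<bullet> \<eta>"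
    and \<delta>: "\<delta> > 0"
  obtains s k c where "k \<in> K" "norm (k + c *\<^sub>R A v - A s - \<eta>) < \<delta>" "\<mu> \<bullet> A s > - (\<mu> \<bullet> \<eta>) - \<delta>"
proof -
  \<comment> \<open>The set pairs constraint residuals with attainable objective values. The
    coefficient \<open>c\<close> is free in sign because the arc built from \<open>s\<close> also
    has the larger term \<open>t *\<^sub>R A v\<close> at its disposal.\<close>
  define S where "S = {(k + c *\<^sub>R A v - A s, \<rho>) | k c s \<rho>. k \<in> K \<and> \<rho> \<le> \<mu> \<bullet> A s}"
  have S_I: "(k + c *\<^sub>R A v - A s, \<rho>) \<in> S" if "k \<in> K" "\<rho> \<le> \<mu> \<bullet> A s" for k c s \<rho>
    using that unfolding S_def by blast
  have S_scale: "a *\<^sub>R \<sigma> \<in> S" if \<sigma>: "\<sigma> \<in> S" and a: "0 \<le> a" for a \<sigma>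
  proof -
    obtain k c s \<rho> where k: "\<sigma> = (k + c *\<^sub>R A v - A s, \<rho>)" "k \<in> K" "\<rho> \<le> \<mu> \<bullet> A s"
      using \<sigma> unfolding S_def by blast
    have "(a *\<^sub>R k + (a * c) *\<^sub>R A v - A (a *\<^sub>R s), a * \<rho>) \<in> S"
      using k a by (intro S_I K_scaleR) (auto simp: linear_cmul[OF A_linear] mult_left_mono)
    then show ?thesis by (simp add: k(1) linear_cmul[OF A_linear] algebra_simps)
  qed
  have S_add: "\<sigma> + \<sigma>' \<in> S" if \<sigma>: "\<sigma> \<in> S" "\<sigma>' \<in> S" for \<sigma> \<sigma>'
  proof -
    obtain k c s \<rho> where k: "\<sigma> = (k + c *\<^sub>R A v - A s, \<rho>)" "k \<in> K" "\<rho> \<le> \<mu> \<bullet> A s"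
      using \<sigma>(1) unfolding S_def by blast
    obtain k' c' s' \<rho>' where k': "\<sigma>' = (k' + c' *\<^sub>R A v - A s', \<rho>')" "k' \<in> K" "\<rho>' \<le> \<mu> \<bullet> A s'"
      using \<sigma>(2) unfolding S_def by blast
    have "((k + k') + (c + c') *\<^sub>R A v - A (s + s'), \<rho> + \<rho>') \<in> S"
      using k k' by (intro S_I K_add) (auto simp: linear_add[OF A_linear] inner_add_right)
    then show ?thesis by (simp add: k(1) k'(1) linear_add[OF A_linear] algebra_simps)
  qed
  have S_convex: "convex S"
    by (rule convexI) (intro S_add S_scale)
  have "(\<eta>, - (\<mu> \<bullet> \<eta>)) \<in> closure S"
  proof (rule ccontr)
    assume not_in: "(\<eta>, - (\<mu> \<bullet> \<eta>)) \<notin> closure S"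
    obtain a b where sep0: "a \<bullet> (\<eta>, - (\<mu> \<bullet> \<eta>)) < b" and sep: "\<And>\<sigma>. \<sigma> \<in> closure S \<Longrightarrow> a \<bullet> \<sigma> > b"
      using separating_hyperplane_closed_point[OF convex_closure[OF S_convex] closed_closure not_in] by blast
    have sepS: "a \<bullet> \<sigma> > b" if "\<sigma> \<in> S" for \<sigma> using sep closure_subset that by blast
    have "(0, 0) \<in> S" using S_I[OF zero_in_K, of 0 0 0] by (simp add: linear_0[OF A_linear])
    then have b: "b < 0" using sepS[of "(0, 0)"] by (simp add: inner_prod_def)
    have nonneg: "a \<bullet> \<sigma> \<ge> 0" if \<sigma>: "\<sigma> \<in> S" for \<sigma>
    proof (rule ccontr)
      assume neg: "\<not> a \<bullet> \<sigma> \<ge> 0"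
      have "(b / (a \<bullet> \<sigma>)) *\<^sub>R \<sigma> \<in> S" using neg b by (intro S_scale[OF \<sigma>]) (simp add: divide_nonpos_neg)
      from sepS[OF this] show False using neg by simp
    qed
    define \<nu> where "\<nu> = - fst a"
    define \<beta> where "\<beta> = - snd a"
    have le: "\<nu> \<bullet> (k + c *\<^sub>R A v - A s) + \<beta> * \<rho> \<le> 0" if "k \<in> K" "\<rho> \<le> \<mu> \<bullet> A s" for k c s \<rho>
      using nonneg[OF S_I[OF that, of c]] by (simp add: inner_prod_def \<nu>_def \<beta>_def)
    have \<beta>: "0 \<le> \<beta>" using le[OF zero_in_K, of "-1" 0 0] by (simp add: linear_0[OF A_linear])
    have \<nu>K: "\<nu> \<bullet> k \<le> 0" if "k \<in> K" for k using le[OF that, of 0 0 0] by (simp add: linear_0[OF A_linear])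
    have \<nu>A: "\<nu> \<bullet> A s = \<beta> * (\<mu> \<bullet> A s)" for s
      using le[OF zero_in_K, of "\<mu> \<bullet> A s" s 0] le[OF zero_in_K, of "\<mu> \<bullet> A (- s)" "- s" 0]
      by (simp add: linear_neg[OF A_linear])
    have gt: "\<nu> \<bullet> \<eta> > \<beta> * (\<mu> \<bullet> \<eta>)"
      using sep0 b by (simp add: inner_prod_def \<nu>_def \<beta>_def)
    \<comment> \<open>Dividing by \<open>1 + \<beta>\<close> after adding \<mu> also covers the
      degenerate separation \<open>\<beta> = 0\<close>, in which \<nu> is merely a recession
      direction of the multiplier set.\<close>
    define \<mu>' where "\<mu>' = (1 / (1 + \<beta>)) *\<^sub>R (\<mu> + \<nu>)"
    have "(1 + \<beta>) *\<^sub>R \<mu>' = \<mu> + \<nu>" using \<beta> by (simp add: \<mu>'_def)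
    then have \<mu>'_inner: "(1 + \<beta>) * (\<mu>' \<bullet> y) = \<mu> \<bullet> y + \<nu> \<bullet> y" for y
      by (metis inner_add_left inner_scaleR_left)
    have "\<mu>' \<in> polar_cone K"
      unfolding polar_cone_def
    proof (intro CollectI ballI)
      fix k assume k: "k \<in> K"
      then have "\<mu> \<bullet> k \<le> 0" using \<mu> by (auto simp: polar_cone_def)
      then show "\<mu>' \<bullet> k \<le> 0" using \<nu>K[OF k] \<beta>
        by (simp add: \<mu>'_def inner_add_left divide_nonpos_pos)
    qed
    moreover have "adjoint A \<mu>' = adjoint A \<mu>"
    proof (rule vector_eq_rdot[THEN iffD1], intro allI)
      fix s
      have "(1 + \<beta>) * (\<mu>' \<bullet> A s) = (1 + \<beta>) * (\<mu> \<bullet> A s)"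
        unfolding \<mu>'_inner \<nu>A by (simp add: distrib_right)
      then show "adjoint A \<mu>' \<bullet> s = adjoint A \<mu> \<bullet> s" using \<beta> by (simp add: adjoint_A)
    qed
    ultimately have "\<mu>' \<bullet> \<eta> \<le> \<mu> \<bullet> \<eta>" by (rule max)
    then have "(1 + \<beta>) * (\<mu>' \<bullet> \<eta>) \<le> (1 + \<beta>) * (\<mu> \<bullet> \<eta>)" using \<beta> by (intro mult_left_mono) auto
    then show False using gt unfolding \<mu>'_inner by (simp add: distrib_right)
  qed
  then obtain \<sigma> where \<sigma>: "\<sigma> \<in> S" "dist \<sigma> (\<eta>, - (\<mu> \<bullet> \<eta>)) < \<delta>" using \<delta> closure_approachable by blast
  obtain k c s \<rho> where k: "\<sigma> = (k + c *\<^sub>R A v - A s, \<rho>)" "k \<in> K" "\<rho> \<le> \<mu> \<bullet> A s"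
    using \<sigma>(1) unfolding S_def by blast
  have "norm (k + c *\<^sub>R A v - A s - \<eta>) < \<delta>"
    using dist_fst_le[of \<sigma> "(\<eta>, - (\<mu> \<bullet> \<eta>))"] \<sigma>(2) by (simp add: k(1) dist_norm)
  moreover have "\<bar>\<rho> + \<mu> \<bullet> \<eta>\<bar> < \<delta>"
    using dist_snd_le[of \<sigma> "(\<eta>, - (\<mu> \<bullet> \<eta>))"] \<sigma>(2) by (simp add: k(1) dist_norm)
  ultimately show ?thesis using that[OF k(2)] k(3) by (smt (verit))
qed

text \<open>Along \<open>zb + t *\<^sub>R v + (t\<^sup>2 / 2) *\<^sub>R s\<close> the expansion of
  \<open>G\<close> has second-order coefficient half of \<open>D2 G zb v v + A s\<close>, which is
  close to half of \<open>k + c *\<^sub>R A v\<close>. The distance to \<open>K\<close> is thus at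
  most \<open>e * t\<^sup>2\<close>, and the Robinson correction spoils the objective value by a
  multiple of the same quantity.\<close>

lemma second_order_feasible_arc:
  assumes Av: "A v \<in> K" and \<mu>: "\<mu> \<in> polar_cone K"
    and max: "\<And>\<mu>'. \<mu>' \<in> polar_cone K \<Longrightarrow> adjoint A \<mu>' = adjoint A \<mu> \<Longrightarrow>
      \<mu>' \<bullet> D2 G zb v v \<le> \<mu> \<bullet> D2 G zb v v"
    and \<delta>: "\<delta> > 0"
  obtains t d where "0 < t" "t < \<delta>" "norm d \<le> \<delta> * t" "zb + t *\<^sub>R v + d \<in> gph \<Gamma>"
    "\<mu> \<bullet> A d \<ge> - (t\<^sup>2 / 2) * (\<mu> \<bullet> D2 G zb v v) - \<delta> * t\<^sup>2"
proof -
  let ?\<eta> = "D2 G zb v v"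
  define m where "m = norm (adjoint A \<mu>) * (\<kappa> + 1)"
  \<comment> \<open>The value of the arc loses \<open>e / 2\<close> through the dual gap and
    \<open>m * e\<close> through the Robinson correction, both times \<open>t\<^sup>2\<close>; this
    choice keeps their sum below \<delta>.\<close>
  define e where "e = \<delta> / (1 + m)"
  have m: "0 \<le> m" using \<kappa>_nonneg by (simp add: m_def)
  then have e: "e > 0" using \<delta> by (simp add: e_def)
  have em: "e / 2 + m * e \<le> \<delta>"
  proof -
    have "e / 2 + m * e \<le> (1 + m) * e" using e by (simp add: algebra_simps)
    also have "\<dots> = \<delta>" using m by (simp add: e_def)
    finally show ?thesis .
  qed
  obtain s k c where k: "k \<in> K" and near: "norm (k + c *\<^sub>R A v - A s - ?\<eta>) < e"
    and val: "\<mu> \<bullet> A s > - (\<mu> \<bullet> ?\<eta>) - e"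
    using approximate_dual_solution[OF \<mu> max e] by blast
  define z where "z t = zb + t *\<^sub>R (v + (t / 2) *\<^sub>R s)" for t
  define Q where "Q t = (1 / t\<^sup>2) *\<^sub>R (G (z t) - t *\<^sub>R A (v + (t / 2) *\<^sub>R s))" for t
  have t0: "((\<lambda>t::real. t) \<longlongrightarrow> 0) (at_right 0)" by (rule tendsto_ident_at)
  have tpos: "\<forall>\<^sub>F t::real in at_right 0. t > 0" by (simp add: eventually_at_right_less)
  have "((\<lambda>t. v + (t / 2) *\<^sub>R s) \<longlongrightarrow> v + (0 / 2) *\<^sub>R s) (at_right 0)"
    by (intro tendsto_intros) simp_all
  then have v_lim: "((\<lambda>t. v + (t / 2) *\<^sub>R s) \<longlongrightarrow> v) (at_right 0)" by simp
  have "(Q \<longlongrightarrow> (1/2) *\<^sub>R ?\<eta>) (at_right 0)"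
    unfolding Q_def[abs_def] z_def by (rule second_order_tendsto[OF t0 tpos v_lim])
  then have "\<forall>\<^sub>F t in at_right 0. dist (Q t) ((1/2) *\<^sub>R ?\<eta>) < e / 2"
    using e by (intro tendstoD) auto
  moreover have "(z \<longlongrightarrow> zb) (at_right 0)"
    unfolding z_def[abs_def] using tendsto_add[OF tendsto_const[of zb] tendsto_scaleR[OF t0 v_lim]] by simp
  then have "\<forall>\<^sub>F t in at_right 0. z t \<in> ball zb r"
    using topological_tendstoD open_ball zb_ball by blast
  moreover have "((\<lambda>t. t * \<bar>c\<bar>) \<longlongrightarrow> 0) (at_right 0)"
    using tendsto_mult[OF t0 tendsto_const[of "\<bar>c\<bar>"]] by simp
  then have "\<forall>\<^sub>F t in at_right 0. t * \<bar>c\<bar> < 1" by (intro order_tendstoD) auto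
  moreover have "((\<lambda>t. t * (norm s / 2 + (\<kappa> + 1) * e)) \<longlongrightarrow> 0) (at_right 0)"
    using tendsto_mult[OF t0 tendsto_const[of "norm s / 2 + (\<kappa> + 1) * e"]] by simp
  then have "\<forall>\<^sub>F t in at_right 0. t * (norm s / 2 + (\<kappa> + 1) * e) < \<delta>" using \<delta> by (intro order_tendstoD) auto
  moreover have "\<forall>\<^sub>F t in at_right 0. t < \<delta>" using order_tendstoD(2)[OF t0 \<delta>] .
  ultimately have "\<forall>\<^sub>F t in at_right 0. 0 < t \<and> dist (Q t) ((1/2) *\<^sub>R ?\<eta>) < e / 2 \<and> z t \<in> ball zb r \<and>
      t * \<bar>c\<bar> < 1 \<and> t * (norm s / 2 + (\<kappa> + 1) * e) < \<delta> \<and> t < \<delta>"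
    using tpos by eventually_elim blast
  then obtain t where t: "0 < t" "dist (Q t) ((1/2) *\<^sub>R ?\<eta>) < e / 2" "z t \<in> ball zb r"
      "t * \<bar>c\<bar> < 1" "t * (norm s / 2 + (\<kappa> + 1) * e) < \<delta>" "t < \<delta>"
    using eventually_happens'[OF trivial_limit_at_right_real] by blast
  \<comment> \<open>A negative \<open>c\<close> is absorbed by the first-order term: the total
    coefficient of \<open>A v\<close> is nonnegative once
    \<open>t * \<bar>c\<bar> < 1\<close>.\<close>
  define k0 where "k0 = t *\<^sub>R A v + (t\<^sup>2 / 2) *\<^sub>R (k + c *\<^sub>R A v)"
  have "k0 = (t * (1 + t * c / 2)) *\<^sub>R A v + (t\<^sup>2 / 2) *\<^sub>R k"
    by (simp add: k0_def algebra_simps power2_eq_square)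
  moreover have "\<bar>t * c\<bar> < 1" using t(1,4) by (simp add: abs_mult)
  then have "0 \<le> t * (1 + t * c / 2)" using t(1) by (intro mult_nonneg_nonneg) auto
  ultimately have k0: "k0 \<in> K" using Av k by (auto intro!: K_add K_scaleR)
  have "G (z t) - k0 = t\<^sup>2 *\<^sub>R ((Q t - (1/2) *\<^sub>R ?\<eta>) - (1/2) *\<^sub>R (k + c *\<^sub>R A v - A s - ?\<eta>))"
  proof -
    have "G (z t) = t\<^sup>2 *\<^sub>R Q t + t *\<^sub>R A (v + (t / 2) *\<^sub>R s)" using t(1) by (simp add: Q_def)
    also have "A (v + (t / 2) *\<^sub>R s) = A v + (t / 2) *\<^sub>R A s"
      by (simp add: linear_add[OF A_linear] linear_cmul[OF A_linear])
    finally show ?thesis by (simp add: k0_def algebra_simps power2_eq_square)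
  qed
  moreover have "norm ((Q t - (1/2) *\<^sub>R ?\<eta>) - (1/2) *\<^sub>R (k + c *\<^sub>R A v - A s - ?\<eta>)) \<le> e / 2 + e / 2"
    by (rule order_trans[OF norm_triangle_ineq4 add_mono]) (use t(2) near in \<open>auto simp: dist_norm\<close>)
  ultimately have "dist (G (z t)) k0 \<le> t\<^sup>2 * e"
    by (simp add: dist_norm mult_left_mono)
  then have "infdist (G (z t)) K \<le> t\<^sup>2 * e" using infdist_le[OF k0, of "G (z t)"] by linarith
  then have i: "\<kappa> * infdist (G (z t)) K + e * t\<^sup>2 \<le> (\<kappa> + 1) * e * t\<^sup>2"
    using mult_left_mono[OF _ \<kappa>_nonneg] by (fastforce simp: algebra_simps)
  obtain x' where x': "x' \<in> \<Gamma> (fst (z t))" "norm (x' - snd (z t)) \<le> \<kappa> * infdist (G (z t)) K + e * t\<^sup>2"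
    using robinson[of "fst (z t)" "snd (z t)" "e * t\<^sup>2"] t(1,3) e unfolding prod.collapse
    by (metis mult_pos_pos zero_less_power)
  define y where "y = x' - snd (z t)"
  have y: "norm y \<le> (\<kappa> + 1) * e * t\<^sup>2" using x'(2) i by (simp add: y_def)
  define d where "d = (t\<^sup>2 / 2) *\<^sub>R s + (0, y)"
  have "norm d \<le> t\<^sup>2 / 2 * norm s + norm y"
    unfolding d_def using norm_triangle_ineq[of "(t\<^sup>2 / 2) *\<^sub>R s" "(0, y)"] by (simp add: norm_Pair)
  also have "\<dots> \<le> t * (t * (norm s / 2 + (\<kappa> + 1) * e))"
    using y by (simp add: power2_eq_square algebra_simps)
  also have "\<dots> \<le> \<delta> * t" using t(1,5) by (simp add: mult.commute)
  finally have "norm d \<le> \<delta> * t" .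
  moreover have "zb + t *\<^sub>R v + d = (fst (z t), x')"
    by (simp add: z_def d_def y_def prod_eq_iff power2_eq_square scaleR_add_right algebra_simps)
  then have "zb + t *\<^sub>R v + d \<in> gph \<Gamma>" using x'(1) by (simp add: gph_def)
  moreover have "\<mu> \<bullet> A d \<ge> - (t\<^sup>2 / 2) * (\<mu> \<bullet> ?\<eta>) - \<delta> * t\<^sup>2"
  proof -
    have "\<mu> \<bullet> A d = t\<^sup>2 / 2 * (\<mu> \<bullet> A s) + adjoint A \<mu> \<bullet> (0, y)"
      by (simp add: d_def linear_add[OF A_linear] linear_cmul[OF A_linear] inner_add_right adjoint_A)
    moreover have "\<bar>adjoint A \<mu> \<bullet> (0, y)\<bar> \<le> m * e * t\<^sup>2"
    proof -
      have "\<bar>adjoint A \<mu> \<bullet> (0, y)\<bar> \<le> norm (adjoint A \<mu>) * norm y"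
        using Cauchy_Schwarz_ineq2[of "adjoint A \<mu>" "(0, y)"] by (simp add: norm_Pair)
      also have "\<dots> \<le> norm (adjoint A \<mu>) * ((\<kappa> + 1) * e * t\<^sup>2)" using y by (intro mult_left_mono) auto
      finally show ?thesis by (simp add: m_def mult_ac)
    qed
    moreover have "t\<^sup>2 / 2 * (\<mu> \<bullet> A s) \<ge> t\<^sup>2 / 2 * (- (\<mu> \<bullet> ?\<eta>) - e)"
      using val by (intro mult_left_mono) auto
    moreover have "t\<^sup>2 * (e / 2 + m * e) \<le> t\<^sup>2 * \<delta>" using em by (intro mult_left_mono) auto
    ultimately show ?thesis by (simp add: algebra_simps)
  qed
  ultimately show ?thesis using that t(1,6) by blast
qed

text \<open>Maximization over a closed ball guarantees a maximizer. If it is interior to that ball,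
  the gradient of the objective is a regular normal, since the remainder is quadratic. Radius
  \<open>r / 2\<close> in each component keeps the pair in the ball of radius
  \<open>r\<close>.\<close>

lemma proximal_normal:
  assumes p1: "dist (fst zb) p1 < r / 2" and x1: "x1 \<in> \<Gamma> p1" "dist (snd zb) x1 \<le> r / 2" and \<rho>: "0 \<le> \<rho>"
  obtains x where "x \<in> \<Gamma> p1" "dist (snd zb) x \<le> r / 2"
    "c \<bullet> x1 - \<rho> / 2 * (norm (x1 - m))\<^sup>2 \<le> c \<bullet> x - \<rho> / 2 * (norm (x - m))\<^sup>2"
    "dist (snd zb) x < r / 2 \<Longrightarrow> c - \<rho> *\<^sub>R (x - m) \<in> regular_normal_cone (\<Gamma> p1) x"
proof -
  have ball: "(p1, x) \<in> ball zb r" if "dist (snd zb) x \<le> r / 2" for x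
  proof -
    have "dist zb (p1, x) \<le> dist (fst zb) p1 + dist (snd zb) x"
      using sqrt_sum_squares_le_sum[of "dist (fst zb) p1" "dist (snd zb) x"] by (simp add: dist_prod_def)
    then show ?thesis using p1 that by simp
  qed
  define S where "S = cball (snd zb) (r / 2) \<inter> (\<lambda>x. G (p1, x)) -` K"
  have S_iff: "x \<in> S \<longleftrightarrow> dist (snd zb) x \<le> r / 2 \<and> x \<in> \<Gamma> p1" for x
    using \<Gamma>_iff[OF ball, of x] by (auto simp: S_def)
  have "continuous_on (cball (snd zb) (r / 2)) (\<lambda>x. G (p1, x))"
  proof (rule continuous_at_imp_continuous_on, intro ballI)
    fix x assume "x \<in> cball (snd zb) (r / 2)"
    then have "isCont G (p1, x)" using G_derivative[OF ball, of x] has_derivative_continuous by fastforce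
    then show "isCont (\<lambda>x. G (p1, x)) x" by (intro isCont_o2[of x "Pair p1" G]) (auto intro!: continuous_intros)
  qed
  then have "closed S" unfolding S_def by (intro continuous_closed_preimage) (use K in auto)
  moreover have "bounded S" unfolding S_def by (intro bounded_Int disjI1 bounded_cball)
  ultimately have "compact S" by (simp add: compact_eq_bounded_closed)
  moreover have x1S: "x1 \<in> S" using x1 S_iff by simp
  moreover have "continuous_on S (\<lambda>x. c \<bullet> x - \<rho> / 2 * (norm (x - m))\<^sup>2)" by (intro continuous_intros)
  ultimately obtain x where x: "x \<in> S"
    "\<And>x'. x' \<in> S \<Longrightarrow> c \<bullet> x' - \<rho> / 2 * (norm (x' - m))\<^sup>2 \<le> c \<bullet> x - \<rho> / 2 * (norm (x - m))\<^sup>2"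
    using continuous_attains_sup[of S "\<lambda>x. c \<bullet> x - \<rho> / 2 * (norm (x - m))\<^sup>2"] by blast
  have "c - \<rho> *\<^sub>R (x - m) \<in> regular_normal_cone (\<Gamma> p1) x" if inside: "dist (snd zb) x < r / 2"
    unfolding regular_normal_cone_def
  proof (intro CollectI conjI allI impI)
    show "x \<in> \<Gamma> p1" using x(1) S_iff by blast
    fix \<epsilon> :: real assume \<epsilon>: "\<epsilon> > 0"
    \<comment> \<open>The first entry keeps \<open>x'\<close> among the competitors; the second
      bounds the quadratic remainder, with the added 1 covering \<open>\<rho> = 0\<close>.\<close>
    define \<delta> where "\<delta> = min (r / 2 - dist (snd zb) x) (2 * \<epsilon> / (\<rho> + 1))"
    have \<delta>: "\<delta> > 0" using inside \<epsilon> \<rho> by (simp add: \<delta>_def)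
    have "(c - \<rho> *\<^sub>R (x - m)) \<bullet> (x' - x) \<le> \<epsilon> * norm (x' - x)" if x': "x' \<in> \<Gamma> p1" "dist x' x < \<delta>" for x'
    proof -
      have "dist (snd zb) x' \<le> r / 2"
        using x'(2) dist_triangle[of "snd zb" x' x] by (simp add: \<delta>_def dist_commute)
      then have le: "c \<bullet> x' - \<rho> / 2 * (norm (x' - m))\<^sup>2 \<le> c \<bullet> x - \<rho> / 2 * (norm (x - m))\<^sup>2"
        using x(2) x'(1) S_iff by blast
      have sq: "(norm (x' - m))\<^sup>2 = (norm (x' - x))\<^sup>2 + 2 * ((x - m) \<bullet> (x' - x)) + (norm (x - m))\<^sup>2"
        by (simp add: power2_norm_eq_inner algebra_simps inner_diff_left inner_diff_right inner_commute)
      have "\<rho> / 2 * (norm (x' - m))\<^sup>2 = \<rho> / 2 * (norm (x' - x))\<^sup>2 + \<rho> * ((x - m) \<bullet> (x' - x)) + \<rho> / 2 * (norm (x - m))\<^sup>2"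
        unfolding sq by (simp add: distrib_left)
      then have "(c - \<rho> *\<^sub>R (x - m)) \<bullet> (x' - x) \<le> (\<rho> / 2 * norm (x' - x)) * norm (x' - x)"
        using le by (simp add: inner_diff_left inner_diff_right power2_eq_square algebra_simps)
      also have "\<dots> \<le> \<epsilon> * norm (x' - x)"
      proof (rule mult_right_mono)
        have "norm (x' - x) < 2 * \<epsilon> / (\<rho> + 1)" using x'(2) by (simp add: \<delta>_def dist_norm)
        then have "norm (x' - x) * (\<rho> + 1) < 2 * \<epsilon>" using \<rho> by (simp add: pos_less_divide_eq)
        then show "\<rho> / 2 * norm (x' - x) \<le> \<epsilon>"
          by (simp add: algebra_simps) (smt (verit) norm_ge_zero)
      qed simp
      finally show ?thesis .
    qed
    then show "\<exists>\<delta>>0. \<forall>x'\<in>\<Gamma> p1. dist x' x < \<delta> \<longrightarrow>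
        (c - \<rho> *\<^sub>R (x - m)) \<bullet> (x' - x) \<le> \<epsilon> * norm (x' - x)"
      using \<delta> by blast
  qed
  then show ?thesis using that[of x] x S_iff x1S by blast
qed

text \<open>Points of the graph are produced as maximizers of \<open>\<langle>xbs + t us, x\<rangle>\<close> with a quadratic penalty
  centred at \<open>xb + t u\<close>.  For a large penalty \<open>\<rho>\<close> the second-order expansion forces the maximizers to
  deviate from the centre by \<open>o(t)\<close> only.\<close>
lemma graph_tangent_superset:
  assumes Av: "A v \<in> K" and \<mu>: "\<mu> \<in> polar_cone K" and \<mu>Av: "\<mu> \<bullet> A v = 0"
    and max: "\<And>\<mu>'. \<mu>' \<in> polar_cone K \<Longrightarrow> adjoint A \<mu>' = adjoint A \<mu> \<Longrightarrow>
      \<mu>' \<bullet> D2 G zb v v \<le> \<mu> \<bullet> D2 G zb v v"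
    and xbs: "\<And>\<xi>. \<mu> \<bullet> A (0, \<xi>) = xbs \<bullet> \<xi>"
    and \<zeta>: "\<And>a. A a \<in> K \<Longrightarrow> \<mu> \<bullet> A a = 0 \<Longrightarrow> \<zeta> \<bullet> a \<le> 0" and \<zeta>v: "\<zeta> \<bullet> v = 0"
    and us: "us = hess \<mu> v + snd \<zeta>"
  shows "(v, us) \<in> tangent_cone (gph normal_map) (zb, xbs)"
proof -
  let ?\<eta> = "D2 G zb v v"
  \<comment> \<open>Since \<open>d n\<close> is no longer than \<open>t n\<close>, this bound keeps
    all arc points within \<open>r / 2\<close> of \<open>zb\<close>, as the proximal construction
    requires.\<close>
  define \<delta>0 where "\<delta>0 = min 1 (r / (2 * (norm v + 2)))"
  define \<delta> where "\<delta> n = \<delta>0 / (real n + 1)" for n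
  have nv: "norm v + 2 > 0" using norm_ge_zero[of v] by linarith
  have \<delta>0: "0 < \<delta>0" "\<delta>0 \<le> 1" "\<delta>0 * (norm v + 2) \<le> r / 2"
  proof -
    show "0 < \<delta>0" "\<delta>0 \<le> 1" using r_pos nv by (auto simp: \<delta>0_def)
    have "\<delta>0 * (norm v + 2) \<le> r / (2 * (norm v + 2)) * (norm v + 2)"
      using nv by (intro mult_right_mono) (auto simp: \<delta>0_def)
    also have "r / (2 * a) * a = r / 2" if "a > 0" for a :: real using that by simp
    then have "r / (2 * (norm v + 2)) * (norm v + 2) = r / 2" using nv by blast
    finally show "\<delta>0 * (norm v + 2) \<le> r / 2" .
  qed
  have \<delta>: "0 < \<delta> n" "\<delta> n \<le> \<delta>0" for n
    using \<delta>0 by (auto simp: \<delta>_def field_simps)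
  have \<delta>_lim: "\<delta> \<longlonglongrightarrow> 0"
    unfolding \<delta>_def[abs_def] using LIMSEQ_inverse_real_of_nat_add[of 0] tendsto_mult_right_zero[OF LIMSEQ_inverse_real_of_nat, of \<delta>0]
    by (simp add: field_simps)
  have "\<exists>t d. 0 < t \<and> t < \<delta> n \<and> norm d \<le> \<delta> n * t \<and> zb + t *\<^sub>R v + d \<in> gph \<Gamma> \<and>
    \<mu> \<bullet> A d \<ge> - (t\<^sup>2 / 2) * (\<mu> \<bullet> ?\<eta>) - \<delta> n * t\<^sup>2" for n
    using second_order_feasible_arc[OF Av \<mu> max \<delta>(1)[of n]] by metis
  then obtain t d where t: "\<And>n. 0 < t n" "\<And>n. t n < \<delta> n" and d: "\<And>n. norm (d n) \<le> \<delta> n * t n"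
    and arc: "\<And>n. zb + t n *\<^sub>R v + d n \<in> gph \<Gamma>"
    and arc_val: "\<And>n. \<mu> \<bullet> A (d n) \<ge> - ((t n)\<^sup>2 / 2) * (\<mu> \<bullet> ?\<eta>) - \<delta> n * (t n)\<^sup>2" by metis
  have t_lim: "t \<longlonglongrightarrow> 0"
    by (rule tendsto_sandwich[OF _ _ tendsto_const \<delta>_lim]) (use t in \<open>auto simp: less_imp_le\<close>)
  \<comment> \<open>Half of \<rho> is \<open>norm \<mu> * L + 1\<close>: the first part outweighs
    the linearization error of \<open>G\<close>, and the 1 leaves a full
    \<open>(norm (X n))\<^sup>2\<close> in the growth estimate.\<close>
  define \<rho> where "\<rho> = 2 * (norm \<mu> * L + 1)"
  have \<rho>: "0 \<le> \<rho>" using L_nonneg by (simp add: \<rho>_def)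
  define b where "b n = zb + t n *\<^sub>R v" for n
  define p where "p n = fst (b n + d n)" for n
  define c where "c n = xbs + t n *\<^sub>R us" for n
  have arc_small: "norm (t n *\<^sub>R v + d n) < r / 2" for n
  proof -
    have "norm (t n *\<^sub>R v + d n) \<le> t n * norm v + \<delta> n * t n"
      using norm_triangle_ineq[of "t n *\<^sub>R v" "d n"] d[of n] t(1)[of n] by simp
    also have "\<dots> \<le> t n * norm v + 1 * t n"
      using \<delta>(2)[of n] \<delta>0(2) t(1)[of n] by (intro add_left_mono mult_right_mono) auto
    also have "\<dots> = t n * (norm v + 1)" by (simp add: algebra_simps)
    also have "\<dots> \<le> \<delta>0 * (norm v + 1)"
      using t(2)[of n] \<delta>(2)[of n] by (intro mult_right_mono) auto
    also have "\<dots> < \<delta>0 * (norm v + 2)" using \<delta>0(1) by (intro mult_strict_left_mono) auto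
    finally show ?thesis using \<delta>0(3) by linarith
  qed
  have b_ball: "b n \<in> ball zb r" for n
  proof -
    have "norm (t n *\<^sub>R v) \<le> \<delta>0 * norm v" using t[of n] \<delta>(2)[of n] by (auto intro!: mult_right_mono)
    also have "\<dots> < \<delta>0 * (norm v + 2)" using \<delta>0(1) by (intro mult_strict_left_mono) auto
    finally show ?thesis using \<delta>0(3) r_pos by (simp add: b_def dist_norm)
  qed
  have arc_dist: "dist zb (b n + d n) < r / 2" for n
  proof -
    have "dist zb (zb + y) = norm y" for y by (simp add: dist_norm)
    then show ?thesis using arc_small[of n] by (simp only: b_def add.assoc)
  qed
  have "\<exists>x. x \<in> \<Gamma> (p n) \<and> dist (snd zb) x \<le> r / 2 \<and>
      c n \<bullet> snd (b n + d n) - \<rho> / 2 * (norm (snd (b n + d n) - snd (b n)))\<^sup>2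
        \<le> c n \<bullet> x - \<rho> / 2 * (norm (x - snd (b n)))\<^sup>2 \<and>
      (dist (snd zb) x < r / 2 \<longrightarrow> c n - \<rho> *\<^sub>R (x - snd (b n)) \<in> regular_normal_cone (\<Gamma> (p n)) x)" for n
  proof (rule proximal_normal[of "p n" "snd (b n + d n)" \<rho> "c n" "snd (b n)"])
    show "dist (fst zb) (p n) < r / 2" "dist (snd zb) (snd (b n + d n)) \<le> r / 2"
      using dist_fst_le[of zb "b n + d n"] dist_snd_le[of zb "b n + d n"] arc_dist[of n]
      by (auto simp: p_def simp del: fst_add snd_add)
    show "snd (b n + d n) \<in> \<Gamma> (p n)"
      using arc[of n] by (simp add: p_def b_def gph_def split_beta)
  qed (use \<rho> in blast)+
  then obtain x where x: "\<And>n. x n \<in> \<Gamma> (p n)" "\<And>n. dist (snd zb) (x n) \<le> r / 2"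
    and x_val: "\<And>n. c n \<bullet> snd (b n + d n) - \<rho> / 2 * (norm (snd (b n + d n) - snd (b n)))\<^sup>2
        \<le> c n \<bullet> x n - \<rho> / 2 * (norm (x n - snd (b n)))\<^sup>2"
    and x_normal: "\<And>n. dist (snd zb) (x n) < r / 2 \<Longrightarrow>
        c n - \<rho> *\<^sub>R (x n - snd (b n)) \<in> regular_normal_cone (\<Gamma> (p n)) (x n)"
    by metis
  \<comment> \<open>Deviations from the centre in units of \<open>t n\<close>. The parameter part is
    inherited from the arc and tends to 0; for the x-part, determined by the maximizer, this is the
    crux.\<close>
  define P where "P n = (1 / t n) *\<^sub>R fst (d n)" for n
  define X where "X n = (1 / t n) *\<^sub>R (x n - snd (b n))" for n
  define Y where "Y n = (P n, X n)" for n
  have tY: "t n *\<^sub>R Y n = (fst (d n), x n - snd (b n))" and z: "b n + t n *\<^sub>R Y n = (p n, x n)" for n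
    using t(1)[of n] by (auto simp: Y_def P_def X_def p_def prod_eq_iff)
  have d_fst: "norm (fst (d n)) \<le> \<delta> n * t n" and d_snd: "norm (snd (d n)) \<le> \<delta> n * t n" for n
    using norm_fst_le[of "fst (d n)" "snd (d n)"] norm_snd_le[of "snd (d n)" "fst (d n)"] d[of n] by simp_all
  have P_le: "norm (P n) \<le> \<delta> n" for n
    unfolding P_def by (rule norm_divide_le[OF t(1)]) (use d_fst[of n] in \<open>simp add: mult.commute\<close>)
  have P_lim: "P \<longlonglongrightarrow> 0"
    by (rule Lim_null_comparison[OF _ \<delta>_lim]) (use P_le in simp)
  have z_ball: "b n + t n *\<^sub>R Y n \<in> ball zb r" for n
  proof -
    have "dist zb (p n, x n) \<le> dist (fst zb) (p n) + dist (snd zb) (x n)"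
      using sqrt_sum_squares_le_sum[of "dist (fst zb) (p n)" "dist (snd zb) (x n)"] by (simp add: dist_prod_def)
    moreover have "dist (fst zb) (p n) < r / 2"
      using dist_fst_le[of zb "b n + d n"] arc_dist[of n] by (simp add: p_def del: fst_add)
    ultimately show ?thesis using x(2)[of n] z[of n] by simp
  qed
  have z_feas: "G (b n + t n *\<^sub>R Y n) \<in> K" for n
    using gph_iff[OF z_ball, of n] x(1)[of n] by (simp add: z gph_def)
  define o1 where "o1 n = \<delta> n + norm us * \<delta> n + \<rho> / 2 * (\<delta> n)\<^sup>2" for n
  have o1_lim: "o1 \<longlonglongrightarrow> 0"
    unfolding o1_def[abs_def] by (auto intro!: tendsto_eq_intros \<delta>_lim)
  \<comment> \<open>the maximizer does at least as well as the point of the feasible arc\<close>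
  have arc_bound: "\<mu> \<bullet> A (Y n) \<ge> - t n * ((\<mu> \<bullet> ?\<eta>) / 2 + o1 n + us \<bullet> X n - \<rho> / 2 * (norm (X n))\<^sup>2)" for n
  proof -
    let ?d2 = "snd (d n)" and ?V = "(\<mu> \<bullet> ?\<eta>) / 2 + o1 n + us \<bullet> X n - \<rho> / 2 * (norm (X n))\<^sup>2"
    have split: "\<mu> \<bullet> A (a, y) = \<mu> \<bullet> A (a, 0) + xbs \<bullet> y" for a y
    proof -
      have "A (a, y) = A (a, 0) + A (0, y)" by (simp flip: linear_add[OF A_linear])
      then show ?thesis by (simp add: inner_add_right xbs)
    qed
    have tx: "x n - snd (b n) = t n *\<^sub>R X n" using t(1)[of n] by (simp add: X_def)
    have xeq: "c n \<bullet> x n = c n \<bullet> snd (b n) + t n * (c n \<bullet> X n)"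
      using arg_cong[OF tx, of "\<lambda>y. c n \<bullet> y"] by (simp add: inner_diff_right)
    have "c n \<bullet> ?d2 - \<rho> / 2 * (norm ?d2)\<^sup>2 \<le> t n * (c n \<bullet> X n) - \<rho> / 2 * ((t n)\<^sup>2 * (norm (X n))\<^sup>2)"
      using x_val[of n] by (simp add: tx xeq inner_add_right power_mult_distrib)
    moreover have "t n * (\<mu> \<bullet> A (Y n)) = \<mu> \<bullet> A (d n) - xbs \<bullet> ?d2 + t n * (xbs \<bullet> X n)"
    proof -
      have "t n * (\<mu> \<bullet> A (Y n)) = \<mu> \<bullet> A (t n *\<^sub>R Y n)" by (simp add: linear_cmul[OF A_linear])
      also have "\<dots> = \<mu> \<bullet> A (fst (d n), 0) + xbs \<bullet> (x n - snd (b n))" unfolding tY by (rule split)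
      also have "\<dots> = \<mu> \<bullet> A (fst (d n), 0) + t n * (xbs \<bullet> X n)" by (simp add: tx)
      finally show ?thesis using split[of "fst (d n)" ?d2] by simp
    qed
    moreover have "t n * (us \<bullet> ?d2) \<ge> - ((t n)\<^sup>2 * (norm us * \<delta> n))"
    proof -
      have "\<bar>us \<bullet> ?d2\<bar> \<le> norm us * (\<delta> n * t n)"
        using Cauchy_Schwarz_ineq2[of us ?d2] mult_left_mono[OF d_snd[of n] norm_ge_zero[of us]] by linarith
      then have "t n * \<bar>us \<bullet> ?d2\<bar> \<le> t n * (norm us * (\<delta> n * t n))"
        using t(1)[of n] by (intro mult_left_mono) auto
      moreover have "- (t n * \<bar>us \<bullet> ?d2\<bar>) \<le> t n * (us \<bullet> ?d2)"
        using t(1)[of n] by (simp add: abs_if)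
      ultimately show ?thesis by (simp add: power2_eq_square mult_ac)
    qed
    moreover have "\<rho> / 2 * (norm ?d2)\<^sup>2 \<le> (t n)\<^sup>2 * (\<rho> / 2 * (\<delta> n)\<^sup>2)"
    proof -
      have "(norm ?d2)\<^sup>2 \<le> (\<delta> n * t n)\<^sup>2" using d_snd by (intro power_mono) auto
      then have "\<rho> / 2 * (norm ?d2)\<^sup>2 \<le> \<rho> / 2 * (\<delta> n * t n)\<^sup>2" using \<rho> by (intro mult_left_mono) auto
      then show ?thesis by (simp add: power_mult_distrib mult_ac)
    qed
    moreover have "c n \<bullet> y = xbs \<bullet> y + t n * (us \<bullet> y)" for y by (simp add: c_def inner_add_left)
    ultimately have "t n * (\<mu> \<bullet> A (Y n)) \<ge> - ((t n)\<^sup>2 * ?V)"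
      using arc_val[of n] by (simp add: o1_def algebra_simps power2_eq_square)
    then have "t n * (- t n * ?V) \<le> t n * (\<mu> \<bullet> A (Y n))" by (simp add: power2_eq_square mult.assoc)
    then show ?thesis using t(1)[of n] by (rule mult_left_le_imp_le)
  qed
  define Rm where "Rm n = (1 / (t n)\<^sup>2) *\<^sub>R (G (b n) - t n *\<^sub>R A v)" for n
  have tev: "\<forall>\<^sub>F n in sequentially. t n > 0" using t(1) by simp
  have Rm_lim: "Rm \<longlonglongrightarrow> (1/2) *\<^sub>R ?\<eta>"
    unfolding Rm_def[abs_def] b_def by (rule second_order_tendsto[OF t_lim tev tendsto_const])
  \<comment> \<open>\<open>G\<close> is expanded at the centre \<open>b n\<close>, and
    \<open>q\<close> records the change of derivative between \<open>zb\<close> and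
    \<open>b n\<close>. Paired with \<mu>, it produces the Hessian part of \<open>us\<close> in the
    limit.\<close>
  define q where "q n = (1 / t n) *\<^sub>R (D1 G (b n) (Y n) - A (Y n))" for n
  \<comment> \<open>Feasibility bounds the pairing of \<mu> with the expansion above, and the arc
    bounds its linear term below. The term with \<open>A v\<close> drops out by
    \<open>\<mu>Av\<close>, leaving an inequality that can be divided by
    \<open>(t n)\<^sup>2\<close>.\<close>
  have growth0: "(norm (X n))\<^sup>2 \<le> us \<bullet> X n + norm \<mu> * L * (norm (P n))\<^sup>2
      - \<mu> \<bullet> Rm n + (\<mu> \<bullet> ?\<eta>) / 2 + o1 n - \<mu> \<bullet> q n" for n
  proof -
    have "norm (G (b n + t n *\<^sub>R Y n) - G (b n) - D1 G (b n) (t n *\<^sub>R Y n)) \<le> L * norm (t n *\<^sub>R Y n) * norm (t n *\<^sub>R Y n)"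
      by (rule linearization_bound_segment[OF b_ball z_ball])
    also have "\<dots> = (t n)\<^sup>2 * (L * ((norm (P n))\<^sup>2 + (norm (X n))\<^sup>2))"
    proof -
      have "(norm (Y n))\<^sup>2 = (norm (P n))\<^sup>2 + (norm (X n))\<^sup>2" by (simp add: Y_def norm_Pair)
      then show ?thesis using t(1)[of n] by (metis (no_types, opaque_lifting) abs_of_pos mult.assoc mult.left_commute norm_scaleR power2_eq_square)
    qed
    finally have lin: "norm (G (b n + t n *\<^sub>R Y n) - G (b n) - D1 G (b n) (t n *\<^sub>R Y n))
        \<le> (t n)\<^sup>2 * (L * ((norm (P n))\<^sup>2 + (norm (X n))\<^sup>2))" .
    have Gb: "G (b n) = t n *\<^sub>R A v + (t n)\<^sup>2 *\<^sub>R Rm n" using t(1)[of n] by (simp add: Rm_def)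
    have "D1 G (b n) (t n *\<^sub>R Y n) = t n *\<^sub>R A (Y n) + (t n)\<^sup>2 *\<^sub>R q n"
      using t(1)[of n] linear_cmul[OF D1_linear[OF b_ball], of n "t n" "Y n"]
      by (simp add: q_def power2_eq_square scaleR_diff_right)
    then have "\<mu> \<bullet> (G (b n) + D1 G (b n) (t n *\<^sub>R Y n)) = (t n)\<^sup>2 * (\<mu> \<bullet> Rm n) + t n * (\<mu> \<bullet> A (Y n)) + (t n)\<^sup>2 * (\<mu> \<bullet> q n)"
      by (simp add: Gb inner_add_right \<mu>Av)
    moreover have "\<mu> \<bullet> (G (b n) + D1 G (b n) (t n *\<^sub>R Y n)) \<le>
        \<mu> \<bullet> G (b n + t n *\<^sub>R Y n) + norm \<mu> * ((t n)\<^sup>2 * (L * ((norm (P n))\<^sup>2 + (norm (X n))\<^sup>2)))"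
      using Cauchy_Schwarz_ineq2[of \<mu> "G (b n + t n *\<^sub>R Y n) - G (b n) - D1 G (b n) (t n *\<^sub>R Y n)"]
        mult_left_mono[OF lin norm_ge_zero[of \<mu>]]
      unfolding inner_diff_right inner_add_right by linarith
    moreover have "\<mu> \<bullet> G (b n + t n *\<^sub>R Y n) \<le> 0" using \<mu> z_feas[of n] by (auto simp: polar_cone_def)
    moreover have "t n * (- t n * ((\<mu> \<bullet> ?\<eta>) / 2 + o1 n + us \<bullet> X n - \<rho> / 2 * (norm (X n))\<^sup>2)) \<le> t n * (\<mu> \<bullet> A (Y n))"
      using arc_bound[of n] t(1)[of n] by (intro mult_left_mono) auto
    ultimately have "(t n)\<^sup>2 * (\<rho> / 2 * (norm (X n))\<^sup>2 - norm \<mu> * (L * ((norm (P n))\<^sup>2 + (norm (X n))\<^sup>2)))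
        \<le> (t n)\<^sup>2 * ((\<mu> \<bullet> ?\<eta>) / 2 + o1 n + us \<bullet> X n - \<mu> \<bullet> Rm n - \<mu> \<bullet> q n)"
      by (simp add: algebra_simps power2_eq_square)
    then have "\<rho> / 2 * (norm (X n))\<^sup>2 - norm \<mu> * (L * ((norm (P n))\<^sup>2 + (norm (X n))\<^sup>2))
        \<le> (\<mu> \<bullet> ?\<eta>) / 2 + o1 n + us \<bullet> X n - \<mu> \<bullet> Rm n - \<mu> \<bullet> q n"
      by (rule mult_left_le_imp_le) (rule zero_less_power[OF t(1)])
    moreover have "\<rho> / 2 = norm \<mu> * L + 1" by (simp add: \<rho>_def)
    ultimately show ?thesis by (simp add: algebra_simps)
  qed
  define s where "s n = norm \<mu> * L * (norm (P n))\<^sup>2 - \<mu> \<bullet> Rm n + (\<mu> \<bullet> ?\<eta>) / 2 + o1 n" for n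
  have "s \<longlonglongrightarrow> norm \<mu> * L * (norm (0::'p))\<^sup>2 - \<mu> \<bullet> ((1/2) *\<^sub>R ?\<eta>) + (\<mu> \<bullet> ?\<eta>) / 2 + 0"
    unfolding s_def[abs_def] by (intro tendsto_intros P_lim Rm_lim o1_lim)
  then have s_lim: "s \<longlonglongrightarrow> 0" by simp
  have growth: "(norm (X n))\<^sup>2 \<le> us \<bullet> X n + s n - \<mu> \<bullet> q n" for n
    using growth0[of n] by (simp add: s_def)
  \<comment> \<open>The growth estimate is quadratic in \<open>X n\<close> on the left and at most
    linear on the right.\<close>
  have "bounded (range X)"
  proof -
    obtain S where S: "\<And>n. \<bar>s n\<bar> \<le> S"
      using convergent_imp_Bseq[OF convergentI[OF s_lim]] unfolding Bseq_def by auto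
    define M where "M = norm \<mu> * (L * norm v)"
    have M: "0 \<le> M" using L_nonneg by (simp add: M_def)
    have "norm (X n) \<le> norm us + M + (S + M) + 1" for n
    proof -
      have "norm (D1 G (b n) (Y n) - A (Y n)) \<le> t n * (L * norm v * norm (Y n))"
        using D1_lipschitz[OF b_ball zb_ball, of n "Y n"] t(1)[of n] by (simp add: b_def mult_ac)
      then have "norm (q n) \<le> L * norm v * norm (Y n)" unfolding q_def by (rule norm_divide_le[OF t(1)])
      also have "norm (Y n) \<le> norm (P n) + norm (X n)" unfolding Y_def by (rule norm_Pair_le)
      then have "L * norm v * norm (Y n) \<le> L * norm v * (1 + norm (X n))"
        using P_le[of n] \<delta>(2)[of n] \<delta>0(2) L_nonneg by (intro mult_left_mono) auto
      finally have "norm \<mu> * norm (q n) \<le> M * (1 + norm (X n))"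
        unfolding M_def mult.assoc[of "norm \<mu>"] by (intro mult_left_mono) (simp_all add: mult.assoc)
      then have "- (\<mu> \<bullet> q n) \<le> M * (1 + norm (X n))"
        using Cauchy_Schwarz_ineq2[of \<mu> "q n"] by linarith
      then have *: "norm (X n) * norm (X n) \<le> norm us * norm (X n) + S + M * (1 + norm (X n))"
        using growth[of n] S[of n] norm_cauchy_schwarz[of us "X n"] by (simp add: power2_eq_square)
      have S0: "0 \<le> S" using S[of n] by linarith
      show ?thesis
      proof (cases "norm (X n) \<le> 1")
        case True
        then show ?thesis using S0 M norm_ge_zero[of us] by linarith
      next
        case False
        then have "S + M \<le> (S + M) * norm (X n)"
          using S0 M mult_left_mono[of 1 "norm (X n)" "S + M"] by simp
        then have "norm (X n) * norm (X n) \<le> (norm us + M + (S + M)) * norm (X n)"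
          using * by (simp add: algebra_simps)
        then have "norm (X n) \<le> norm us + M + (S + M)"
          by (rule mult_right_le_imp_le) (use False in linarith)
        then show ?thesis by simp
      qed
    qed
    then show ?thesis unfolding bounded_iff by blast
  qed
  then obtain X0 \<sigma> where \<sigma>: "strict_mono (\<sigma> :: nat \<Rightarrow> nat)" and X_lim: "(X \<circ> \<sigma>) \<longlonglongrightarrow> X0"
    using bounded_imp_convergent_subsequence by blast
  have sub: "(f \<circ> \<sigma>) \<longlonglongrightarrow> l" if "f \<longlonglongrightarrow> l" for f :: "nat \<Rightarrow> 'z::topological_space" and l
    using LIMSEQ_subseq_LIMSEQ[OF that \<sigma>] .
  have Y_lim: "(Y \<circ> \<sigma>) \<longlonglongrightarrow> (0, X0)"
    using tendsto_Pair[OF sub[OF P_lim] X_lim] by (simp add: Y_def[abs_def] o_def)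
  \<comment> \<open>In the limit the growth estimate reads
    \<open>(norm X0)\<^sup>2 \<le> \<zeta> \<bullet> (0, X0)\<close>, since the Hessian part of
    \<open>us\<close> cancels. The two-sided bound on the pairing of \<mu> makes
    \<open>v + (0, X0)\<close> a critical direction, so that polarity of \<zeta> and
    \<open>\<zeta> \<bullet> v = 0\<close> give the opposite sign.\<close>
  have X0: "X0 = 0"
  proof -
    have t\<sigma>: "(t \<circ> \<sigma>) \<longlonglongrightarrow> 0" "\<forall>\<^sub>F n in sequentially. (t \<circ> \<sigma>) n > 0"
      using sub[OF t_lim] t(1) by auto
    have q_lim: "(\<lambda>n. q (\<sigma> n)) \<longlonglongrightarrow> D2 G zb (0, X0) v"
      using D1_quotient_tendsto[OF t\<sigma> tendsto_const[of v] Y_lim] by (simp add: q_def b_def o_def)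
    have X\<sigma>: "(\<lambda>n. X (\<sigma> n)) \<longlonglongrightarrow> X0" and Y\<sigma>: "(\<lambda>n. Y (\<sigma> n)) \<longlonglongrightarrow> (0, X0)"
      and s\<sigma>: "(\<lambda>n. s (\<sigma> n)) \<longlonglongrightarrow> 0" and o\<sigma>: "(\<lambda>n. o1 (\<sigma> n)) \<longlonglongrightarrow> 0" and tt: "(\<lambda>n. t (\<sigma> n)) \<longlonglongrightarrow> 0"
      using X_lim Y_lim sub[OF s_lim] sub[OF o1_lim] t\<sigma>(1) by (simp_all add: o_def)
    have "(\<lambda>n. us \<bullet> X (\<sigma> n) + s (\<sigma> n) - \<mu> \<bullet> q (\<sigma> n)) \<longlonglongrightarrow> us \<bullet> X0 + 0 - \<mu> \<bullet> D2 G zb (0, X0) v"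
      by (intro tendsto_intros X\<sigma> s\<sigma> q_lim)
    moreover have "(\<lambda>n. (norm (X (\<sigma> n)))\<^sup>2) \<longlonglongrightarrow> (norm X0)\<^sup>2" by (intro tendsto_intros X\<sigma>)
    ultimately have "(norm X0)\<^sup>2 \<le> us \<bullet> X0 + 0 - \<mu> \<bullet> D2 G zb (0, X0) v"
      using growth by (intro LIMSEQ_le) auto
    then have X0_le: "(norm X0)\<^sup>2 \<le> \<zeta> \<bullet> (0, X0)"
      by (simp add: us inner_add_left hess_inner inner_prod_def)
    let ?v = "v + (0, X0)"
    have "(\<lambda>n. v + (Y \<circ> \<sigma>) n) \<longlonglongrightarrow> ?v" by (intro tendsto_intros Y_lim)
    from first_order_tendsto[OF t\<sigma> this]
    have G_lim: "(\<lambda>n. (1 / t (\<sigma> n)) *\<^sub>R G (zb + t (\<sigma> n) *\<^sub>R (v + Y (\<sigma> n)))) \<longlonglongrightarrow> A ?v" by (simp add: o_def)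
    have G_K: "(1 / t (\<sigma> n)) *\<^sub>R G (zb + t (\<sigma> n) *\<^sub>R (v + Y (\<sigma> n))) \<in> K" for n
      using K_scaleR[OF z_feas[of "\<sigma> n"], of "1 / t (\<sigma> n)"] t(1)[of "\<sigma> n"]
      by (simp add: b_def scaleR_add_right add.assoc)
    have AvK: "A ?v \<in> K" by (rule closed_sequentially[OF K(1) _ G_lim]) (rule G_K)
    have Av_eq: "\<mu> \<bullet> A ?v = \<mu> \<bullet> A (0, X0)"
      by (simp add: linear_add[OF A_linear] inner_add_right \<mu>Av)
    have "\<mu> \<bullet> A ?v \<le> 0" using \<mu> AvK by (auto simp: polar_cone_def)
    moreover have "0 \<le> \<mu> \<bullet> A (0, X0)"
    proof (rule LIMSEQ_le)
      show "(\<lambda>n. \<mu> \<bullet> A (Y (\<sigma> n))) \<longlonglongrightarrow> \<mu> \<bullet> A (0, X0)"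
        by (intro tendsto_intros bounded_linear.tendsto[OF A_bounded_linear] Y\<sigma>)
      have "(\<lambda>n. - t (\<sigma> n) * ((\<mu> \<bullet> ?\<eta>) / 2 + o1 (\<sigma> n) + us \<bullet> X (\<sigma> n) - \<rho> / 2 * (norm (X (\<sigma> n)))\<^sup>2))
          \<longlonglongrightarrow> - 0 * ((\<mu> \<bullet> ?\<eta>) / 2 + 0 + us \<bullet> X0 - \<rho> / 2 * (norm X0)\<^sup>2)"
        by (intro tendsto_intros tt o\<sigma> X\<sigma>)
      then show "(\<lambda>n. - t (\<sigma> n) * ((\<mu> \<bullet> ?\<eta>) / 2 + o1 (\<sigma> n) + us \<bullet> X (\<sigma> n) - \<rho> / 2 * (norm (X (\<sigma> n)))\<^sup>2)) \<longlonglongrightarrow> 0"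
        by simp
      show "\<exists>N. \<forall>n\<ge>N. - t (\<sigma> n) * ((\<mu> \<bullet> ?\<eta>) / 2 + o1 (\<sigma> n) + us \<bullet> X (\<sigma> n) - \<rho> / 2 * (norm (X (\<sigma> n)))\<^sup>2) \<le> \<mu> \<bullet> A (Y (\<sigma> n))"
        using arc_bound by blast
    qed
    ultimately have "\<mu> \<bullet> A ?v = 0" using Av_eq by simp
    from \<zeta>[OF AvK this] have "\<zeta> \<bullet> (0, X0) \<le> 0" by (simp add: inner_add_right \<zeta>v)
    with X0_le have "(norm X0)\<^sup>2 \<le> 0" by linarith
    then show ?thesis by simp
  qed
  \<comment> \<open>The proximal normal equals
    \<open>xbs + t n *\<^sub>R (us - \<rho> *\<^sub>R X n)\<close>. As \<open>X\<close> tends to 0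
    along \<sigma>, the perturbation of \<open>us\<close> vanishes; the maximizers approach
    \<open>snd zb\<close>, so they are eventually interior and the normal is available.\<close>
  define wk where "wk n = (v + Y n, us - \<rho> *\<^sub>R X n)" for n
  show ?thesis
  proof (rule tangent_cone_eventuallyI)
    show "(t \<circ> \<sigma>) \<longlonglongrightarrow> 0" by (rule sub[OF t_lim])
    have "(\<lambda>n. (v + (Y \<circ> \<sigma>) n, us - \<rho> *\<^sub>R (X \<circ> \<sigma>) n)) \<longlonglongrightarrow> (v + (0, X0), us - \<rho> *\<^sub>R X0)"
      by (intro tendsto_intros Y_lim X_lim)
    then show "(wk \<circ> \<sigma>) \<longlonglongrightarrow> (v, us)" by (simp add: X0 wk_def[abs_def] o_def flip: zero_prod_def)
    have "(\<lambda>n. snd zb + (t \<circ> \<sigma>) n *\<^sub>R (snd v + (X \<circ> \<sigma>) n)) \<longlonglongrightarrow> snd zb + 0 *\<^sub>R (snd v + X0)"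
      by (intro tendsto_intros sub[OF t_lim] X_lim)
    moreover have "snd zb + t n *\<^sub>R (snd v + X n) = x n" for n
      using t(1)[of n] by (simp add: X_def b_def scaleR_add_right)
    ultimately have "(x \<circ> \<sigma>) \<longlonglongrightarrow> snd zb" by (simp add: o_def)
    then have "\<forall>\<^sub>F n in sequentially. dist (x (\<sigma> n)) (snd zb) < r / 2"
      using r_pos by (intro tendstoD) (auto simp: o_def)
    then show "\<forall>\<^sub>F n in sequentially. (t \<circ> \<sigma>) n > 0 \<and> (zb, xbs) + (t \<circ> \<sigma>) n *\<^sub>R (wk \<circ> \<sigma>) n \<in> gph normal_map"
    proof eventually_elim
      case (elim n)
      let ?n = "\<sigma> n"
      have "zb + t ?n *\<^sub>R (v + Y ?n) = (p ?n, x ?n)"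
        using z[of ?n] by (simp add: b_def scaleR_add_right add.assoc)
      moreover have "xbs + t ?n *\<^sub>R (us - \<rho> *\<^sub>R X ?n) = c ?n - \<rho> *\<^sub>R (x ?n - snd (b ?n))"
        using t(1)[of ?n] by (simp add: c_def X_def scaleR_diff_right)
      ultimately have "(zb, xbs) + t ?n *\<^sub>R wk ?n = ((p ?n, x ?n), c ?n - \<rho> *\<^sub>R (x ?n - snd (b ?n)))"
        by (simp add: wk_def)
      then show ?case using x_normal[of ?n] elim t(1)[of ?n]
        by (simp add: gph_def normal_map_def dist_commute)
    qed
  qed
qed

end

section \<open>The graphical derivative\<close>

text \<open>Shrinking a fixed direction \<open>a\<close> that stays in the set turns the limsup
  condition into \<open>\<zeta> \<bullet> a \<le> 0\<close>. In a convex cone this applies to every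
  element and, since \<open>(1 - s) *\<^sub>R v\<close> remains in the cone, also to
  \<open>- v\<close>; hence the orthogonality.\<close>

lemma regular_normal_cone_convex_cone:
  fixes C :: "'a::real_inner set"
  assumes C: "convex C" "cone C"
  shows "\<zeta> \<in> regular_normal_cone C v \<longleftrightarrow> v \<in> C \<and> (\<forall>a\<in>C. \<zeta> \<bullet> a \<le> 0) \<and> \<zeta> \<bullet> v = 0"
proof
  assume \<zeta>: "\<zeta> \<in> regular_normal_cone C v"
  then have v: "v \<in> C" by (simp add: regular_normal_cone_def)
  have le: "\<zeta> \<bullet> a \<le> 0" if a: "\<And>s. 0 < s \<Longrightarrow> s < 1 \<Longrightarrow> v + s *\<^sub>R a \<in> C" for a
  proof (rule ccontr)
    assume "\<not> \<zeta> \<bullet> a \<le> 0"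
    then have pos: "\<zeta> \<bullet> a > 0" by simp
    \<comment> \<open>Exceeding \<open>norm a\<close> strictly, \<open>n\<close> makes the tolerance
      \<open>(\<zeta> \<bullet> a) / n\<close> too small for the inequality along \<open>a\<close>,
      and it also covers \<open>a = 0\<close>.\<close>
    define n where "n = norm a + 1"
    have n: "n > 0" "norm a < n" using norm_ge_zero[of a] by (auto simp: n_def simp del: norm_ge_zero)
    have e: "(\<zeta> \<bullet> a) / n > 0" using pos n(1) by simp
    have "\<forall>\<epsilon>>0. \<exists>\<delta>>0. \<forall>z'\<in>C. dist z' v < \<delta> \<longrightarrow> \<zeta> \<bullet> (z' - v) \<le> \<epsilon> * norm (z' - v)"
      using \<zeta> by (simp add: regular_normal_cone_def)
    from this[rule_format, OF e] obtain \<delta> where \<delta>: "\<delta> > 0" "\<And>z'. z' \<in> C \<Longrightarrow> dist z' v < \<delta> \<Longrightarrow>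
        \<zeta> \<bullet> (z' - v) \<le> (\<zeta> \<bullet> a) / n * norm (z' - v)"
      by blast
    define s where "s = min (1 / 2) (\<delta> / n)"
    have s: "0 < s" "s < 1" "s \<le> \<delta> / n" using \<delta>(1) n by (auto simp: s_def)
    have "s * norm a < s * n" using s(1) n(2) by simp
    also have "\<dots> \<le> \<delta>" using s(3) n(1) by (simp add: pos_le_divide_eq)
    finally have "dist (v + s *\<^sub>R a) v < \<delta>" using s(1) by (simp add: dist_norm)
    from \<delta>(2)[OF a[OF s(1,2)] this] have "s * (\<zeta> \<bullet> a) \<le> s * ((\<zeta> \<bullet> a) / n * norm a)"
      using s(1) by (simp add: mult_ac)
    then have "\<zeta> \<bullet> a \<le> (\<zeta> \<bullet> a) / n * norm a" by (rule mult_left_le_imp_le) (rule s(1))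
    also have "\<dots> < (\<zeta> \<bullet> a) / n * n" using n pos by (intro mult_strict_left_mono) auto
    finally show False using n(1) by simp
  qed
  have "\<zeta> \<bullet> a \<le> 0" if "a \<in> C" for a
    using that v C convex_cone[of C] by (intro le) (simp add: cone_def)
  moreover have "\<zeta> \<bullet> (- v) \<le> 0"
  proof (rule le)
    fix s :: real assume "0 < s" "s < 1"
    then have "(1 - s) *\<^sub>R v \<in> C" using v C(2) by (simp add: cone_def)
    then show "v + s *\<^sub>R - v \<in> C" by (simp add: scaleR_diff_left)
  qed
  ultimately show "v \<in> C \<and> (\<forall>a\<in>C. \<zeta> \<bullet> a \<le> 0) \<and> \<zeta> \<bullet> v = 0" using v by fastforce
next
  assume \<zeta>: "v \<in> C \<and> (\<forall>a\<in>C. \<zeta> \<bullet> a \<le> 0) \<and> \<zeta> \<bullet> v = 0"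
  have "\<zeta> \<bullet> (z' - v) \<le> \<epsilon> * norm (z' - v)" if "z' \<in> C" "0 < \<epsilon>" for z' \<epsilon>
  proof -
    have "\<zeta> \<bullet> (z' - v) \<le> 0" using \<zeta> that(1) by (simp add: inner_diff_right)
    also have "0 \<le> \<epsilon> * norm (z' - v)" using that(2) by simp
    finally show ?thesis .
  qed
  then show "\<zeta> \<in> regular_normal_cone C v"
    using \<zeta> unfolding regular_normal_cone_def by (auto intro!: exI[of _ "1::real"])
qed

context parametric_system
begin

lemma normal_cone_tangent:
  "\<zeta> \<in> regular_normal_cone (tangent_cone (gph \<Gamma>) zb) v \<longleftrightarrow>
    A v \<in> K \<and> (\<forall>a. A a \<in> K \<longrightarrow> \<zeta> \<bullet> a \<le> 0) \<and> \<zeta> \<bullet> v = 0"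
proof -
  have "convex {a. A a \<in> K}"
    by (rule convexI) (simp add: linear_add[OF A_linear] linear_cmul[OF A_linear] K_add K_scaleR)
  moreover have "cone {a. A a \<in> K}"
    by (simp add: cone_def linear_cmul[OF A_linear] K_scaleR)
  ultimately show ?thesis by (simp add: regular_normal_cone_convex_cone tangent_gph)
qed

lemma normal_cone_critical:
  assumes "adjoint A \<mu> = zs"
  shows "\<zeta> \<in> regular_normal_cone (critical_cone (gph \<Gamma>) zb zs) v \<longleftrightarrow>
    A v \<in> K \<and> \<mu> \<bullet> A v = 0 \<and> (\<forall>a. A a \<in> K \<longrightarrow> \<mu> \<bullet> A a = 0 \<longrightarrow> \<zeta> \<bullet> a \<le> 0) \<and> \<zeta> \<bullet> v = 0"
proof -
  have eq: "critical_cone (gph \<Gamma>) zb zs = {a. A a \<in> K \<and> \<mu> \<bullet> A a = 0}"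
    by (auto simp: critical_cone_def tangent_gph adjoint_A simp flip: assms)
  have conv: "convex {a. A a \<in> K \<and> \<mu> \<bullet> A a = 0}"
    by (rule convexI) (simp add: linear_add[OF A_linear] linear_cmul[OF A_linear] K_add K_scaleR inner_add_right)
  have "cone {a. A a \<in> K \<and> \<mu> \<bullet> A a = 0}"
    by (simp add: cone_def linear_cmul[OF A_linear] K_scaleR)
  from regular_normal_cone_convex_cone[OF conv this] show ?thesis unfolding eq by blast
qed

theorem graph_tangent:
  assumes P_or_poly: "char_subspace G K zb = UNIV \<or> polyhedron K"
  shows "(v, us) \<in> tangent_cone (gph normal_map) (zb, xbs) \<longleftrightarrow>
    (\<exists>zs \<in> regular_normal_cone (tangent_cone (gph \<Gamma>) zb) v. snd zs = xbs \<and>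
      (\<exists>\<mu> \<in> mult_set_dir G K zb zs v.
        us \<in> {frechet_derivative (\<lambda>z. adjoint (Dx G z) \<mu>) (at zb) v + w | w.
          w \<in> snd ` regular_normal_cone (critical_cone (gph \<Gamma>) zb zs) v}))"
    (is "?L \<longleftrightarrow> ?R")
proof
  assume ?L
  then obtain t vk \<mu>k \<mu> where seq: "multiplier_sequence G K \<Gamma> zb r L \<kappa> t vk \<mu>k v \<mu> (us - hess \<mu> v)"
    and xbs: "\<And>\<xi>. \<mu> \<bullet> A (0, \<xi>) = xbs \<bullet> \<xi>"
    using graph_tangent_sequences by blast
  interpret S: multiplier_sequence G K \<Gamma> zb r L \<kappa> t vk \<mu>k v \<mu> "us - hess \<mu> v" by (rule seq)
  obtain \<zeta> where \<zeta>: "snd \<zeta> = us - hess \<mu> v" "\<zeta> \<bullet> v = 0"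
      "\<And>a. A a \<in> K \<Longrightarrow> \<mu> \<bullet> A a = 0 \<Longrightarrow> \<zeta> \<bullet> a \<le> 0"
    and max: "\<And>\<mu>'. \<mu>' \<in> polar_cone K \<Longrightarrow> adjoint A \<mu>' = adjoint A \<mu> \<Longrightarrow>
      \<mu>' \<bullet> D2 G zb v v \<le> \<mu> \<bullet> D2 G zb v v"
    using P_or_poly S.full_characteristic_subspace S.polyhedral_case by blast
  define zs where "zs = adjoint A \<mu>"
  have "zs \<in> regular_normal_cone (tangent_cone (gph \<Gamma>) zb) v"
    using S.Av_in_K S.\<mu>_Av S.\<mu>_polar by (auto simp: normal_cone_tangent zs_def adjoint_A polar_cone_def)
  moreover have "snd zs = xbs"
  proof -
    have "snd zs \<bullet> \<xi> = xbs \<bullet> \<xi>" for \<xi>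
      using adjoint_A[of \<mu> "(0, \<xi>)"] xbs[of \<xi>] by (simp add: zs_def inner_prod_def)
    then show ?thesis by (metis vector_eq_rdot)
  qed
  moreover have "\<mu> \<in> mult_set_dir G K zb zs v"
    using S.\<mu>_polar max by (auto simp: mult_set_dir_def mult_set_def zs_def)
  moreover have "\<zeta> \<in> regular_normal_cone (critical_cone (gph \<Gamma>) zb zs) v"
    using S.Av_in_K S.\<mu>_Av \<zeta> normal_cone_critical[OF zs_def[symmetric]] by blast
  moreover have "us = frechet_derivative (\<lambda>z. adjoint (Dx G z) \<mu>) (at zb) v + snd \<zeta>"
    by (simp add: frechet_derivative_hess \<zeta>(1))
  ultimately show ?R by blast
next
  assume ?R
  then obtain zs \<mu> \<zeta> where zs: "zs \<in> regular_normal_cone (tangent_cone (gph \<Gamma>) zb) v" "snd zs = xbs"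
    and \<mu>: "\<mu> \<in> mult_set_dir G K zb zs v"
    and \<zeta>: "\<zeta> \<in> regular_normal_cone (critical_cone (gph \<Gamma>) zb zs) v"
    and us: "us = frechet_derivative (\<lambda>z. adjoint (Dx G z) \<mu>) (at zb) v + snd \<zeta>"
    by blast
  have adj: "adjoint A \<mu> = zs" and polar: "\<mu> \<in> polar_cone K"
    and max: "\<mu>' \<in> polar_cone K \<Longrightarrow> adjoint A \<mu>' = adjoint A \<mu> \<Longrightarrow>
      \<mu>' \<bullet> D2 G zb v v \<le> \<mu> \<bullet> D2 G zb v v" for \<mu>'
    using \<mu> by (auto simp: mult_set_dir_def mult_set_def)
  note crit = \<zeta>[unfolded normal_cone_critical[OF adj]]
  show ?L
  proof (rule graph_tangent_superset[of v \<mu> xbs \<zeta>])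
    show "\<mu> \<bullet> A (0, \<xi>) = xbs \<bullet> \<xi>" for \<xi>
      using adjoint_A[of \<mu> "(0, \<xi>)"] zs(2) by (simp add: adj inner_prod_def)
    show "us = hess \<mu> v + snd \<zeta>" using us by (simp add: frechet_derivative_hess)
  qed (use crit polar max in blast)+
qed

end

text \<open>One radius serves the derivative estimates, the reduction to \<open>K\<close> and
  Robinson stability. The points behind the Robinson distance lie in the domain of the reduction by
  definition, so they belong to \<open>\<Gamma> p\<close> even outside the ball; the slack
  \<epsilon> selects one of them without attainment of the infimum.\<close>

lemma reduced_system:
  fixes g :: "'p::euclidean_space \<times> 'x::euclidean_space \<Rightarrow> 'y::euclidean_space"
    and h :: "'y \<Rightarrow> 'e::euclidean_space"
  assumes g_C2: "C2_around g (pb, xb)"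
    and K: "closed K" "convex K" "cone K"
    and gV: "g (pb, xb) \<in> V" and h_C2: "C2_on V h" and h_zero: "h (g (pb, xb)) = 0"
    and red: "C \<inter> V = {y \<in> V. h y \<in> K}"
    and \<Gamma>_def: "\<And>p. \<Gamma> p = {x. g (p, x) \<in> C}" and G_def: "G = (\<lambda>z. h (g z))"
    and xb: "xb \<in> \<Gamma> pb" and RS: "robinson_stable G (g -` V) K pb xb"
  obtains r L \<kappa> where "parametric_system G K \<Gamma> (pb, xb) r L \<kappa>"
proof -
  obtain U where U: "(pb, xb) \<in> U" "C2_on U g" using g_C2 unfolding C2_around_def by blast
  obtain r0 L where r0: "0 < r0" "0 \<le> L" "ball (pb, xb) r0 \<subseteq> g -` V"
    and G': "\<And>z. z \<in> ball (pb, xb) r0 \<Longrightarrow> (G has_derivative D1 G z) (at z)"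
    and lip: "\<And>z z' a. z \<in> ball (pb, xb) r0 \<Longrightarrow> z' \<in> ball (pb, xb) r0 \<Longrightarrow>
       norm (D1 G z a - D1 G z' a) \<le> L * norm (z - z') * norm a"
    and diff: "\<And>a. (\<lambda>z. D1 G z a) differentiable (at (pb, xb))"
    by (rule C2_compose_local[OF U(2,1) h_C2 gV G_def]) (rule that)
  obtain \<kappa> W N where \<kappa>: "0 \<le> \<kappa>" and WN: "open W" "pb \<in> W" "open N" "xb \<in> N"
    and stable: "\<forall>p\<in>W. \<forall>x\<in>N. (p, x) \<in> g -` V \<longrightarrow>
      {x'. (p, x') \<in> g -` V \<and> G (p, x') \<in> K} \<noteq> {} \<and>
      infdist x {x'. (p, x') \<in> g -` V \<and> G (p, x') \<in> K} \<le> \<kappa> * infdist (G (p, x)) K"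
    using RS unfolding robinson_stable_def by (elim exE conjE) (rule that)
  have "open (W \<times> N)" "(pb, xb) \<in> W \<times> N" using WN by (auto intro: open_Times)
  then obtain r1 where r1: "0 < r1" "ball (pb, xb) r1 \<subseteq> W \<times> N"
    unfolding open_contains_ball by blast
  define r where "r = min r0 r1"
  have sub: "ball (pb, xb) r \<subseteq> ball (pb, xb) r0" "ball (pb, xb) r \<subseteq> W \<times> N"
    using r1(2) by (auto simp: r_def)
  have in_C: "y \<in> C \<longleftrightarrow> h y \<in> K" if "y \<in> V" for y using red that by blast
  have robinson: "\<exists>x'\<in>\<Gamma> p. norm (x' - x) \<le> \<kappa> * infdist (G (p, x)) K + \<epsilon>"
    if px: "(p, x) \<in> ball (pb, xb) r" and \<epsilon>: "0 < \<epsilon>" for p x \<epsilon>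
  proof -
    let ?S = "{x'. (p, x') \<in> g -` V \<and> G (p, x') \<in> K}"
    have S: "?S \<noteq> {}" "infdist x ?S \<le> \<kappa> * infdist (G (p, x)) K"
    proof -
      have "p \<in> W" "x \<in> N" "(p, x) \<in> g -` V" using px sub r0(3) by blast+
      from stable[rule_format, OF this] show "?S \<noteq> {}" "infdist x ?S \<le> \<kappa> * infdist (G (p, x)) K" by simp_all
    qed
    have "(INF a\<in>?S. dist x a) < \<kappa> * infdist (G (p, x)) K + \<epsilon>"
      using S(2) \<epsilon> by (simp only: flip: infdist_notempty[OF S(1)])
    then obtain x' where x': "x' \<in> ?S" "dist x x' < \<kappa> * infdist (G (p, x)) K + \<epsilon>"
      using S(1) by (meson cINF_less_iff bdd_below_image_dist)
    have "x' \<in> \<Gamma> p" using x'(1) in_C by (auto simp: \<Gamma>_def G_def)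
    then show ?thesis using x'(2) by (intro bexI[of _ x']) (auto simp: dist_norm norm_minus_commute)
  qed
  have "parametric_system G K \<Gamma> (pb, xb) r L \<kappa>"
  proof
    show "x \<in> \<Gamma> p \<longleftrightarrow> G (p, x) \<in> K" if "(p, x) \<in> ball (pb, xb) r" for p x
    proof -
      have "g (p, x) \<in> V" using that sub(1) r0(3) by blast
      then show ?thesis using in_C by (simp add: \<Gamma>_def G_def)
    qed
    show "0 < r" using r0(1) r1(1) by (simp add: r_def)
    show "G (pb, xb) = 0" using h_zero by (simp add: G_def)
    show "snd (pb, xb) \<in> \<Gamma> (fst (pb, xb))" using xb by simp
    show "norm (D1 G z a - D1 G z' a) \<le> L * norm (z - z') * norm a"
      if "z \<in> ball (pb, xb) r" "z' \<in> ball (pb, xb) r" for z z' a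
      by (rule lip[OF subsetD[OF sub(1) that(1)] subsetD[OF sub(1) that(2)]])
    show "(G has_derivative D1 G z) (at z)" if "z \<in> ball (pb, xb) r" for z
      by (rule G'[OF subsetD[OF sub(1) that]])
  qed (fact K r0(2) \<kappa> diff robinson)+
  then show ?thesis by (rule that)
qed

theorem theorem4p2:
  fixes g :: "'p::euclidean_space \<times> 'x::euclidean_space \<Rightarrow> 'y::euclidean_space"
    and h :: "'y \<Rightarrow> 'e::euclidean_space"
    and C :: "'y set" and K :: "'e set" and V :: "'y set"
    and pb :: 'p and xb :: 'x and xbs :: 'x
    and \<Gamma> :: "'p \<Rightarrow> 'x set" and \<Psi> :: "'p \<times> 'x \<Rightarrow> 'x set"
    and G :: "'p \<times> 'x \<Rightarrow> 'e"
  assumes g_C2: "C2_around g (pb, xb)"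
    and C_closed: "closed C"
    and K_cone: "closed K" "convex K" "cone K"
    and V_open: "open V" and gV: "g (pb, xb) \<in> V"
    and h_C2: "C2_on V h"
    and h_zero: "h (g (pb, xb)) = 0"
    and h_surj: "surj (D1 h (g (pb, xb)))"
    and red: "C \<inter> V = {y \<in> V. h y \<in> K}"
    and \<Gamma>_def: "\<And>p. \<Gamma> p = {x. g (p, x) \<in> C}"
    and \<Psi>_def: "\<And>p x. \<Psi> (p, x) = regular_normal_cone (\<Gamma> p) x"
    and G_def: "G = (\<lambda>z. h (g z))"
    and xb_feas: "xb \<in> \<Gamma> pb"
    and xbs_normal: "xbs \<in> regular_normal_cone (\<Gamma> pb) xb"
    and RS: "robinson_stable G (g -` V) K pb xb"
    and P_or_poly: "char_subspace G K (pb, xb) = UNIV \<or> polyhedron K"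
  shows "tangent_cone (gph \<Psi>) ((pb, xb), xbs) =
           {((q, u), us). \<exists>zs \<in> regular_normal_cone (tangent_cone (gph \<Gamma>) (pb, xb)) (q, u).
              snd zs = xbs \<and>
              (\<exists>\<mu> \<in> mult_set_dir G K (pb, xb) zs (q, u).
                 us \<in> {frechet_derivative (\<lambda>z. adjoint (Dx G z) \<mu>) (at (pb, xb)) (q, u) + w | w.
                         w \<in> snd ` regular_normal_cone (critical_cone (gph \<Gamma>) (pb, xb) zs) (q, u)})}
       \<and> (\<forall>v. graphical_derivative \<Psi> (pb, xb) xbs v =
           \<Union>{{frechet_derivative (\<lambda>z. adjoint (Dx G z) \<mu>) (at (pb, xb)) v + w | w.
                  w \<in> snd ` regular_normal_cone (critical_cone (gph \<Gamma>) (pb, xb) zs) v} | zs \<mu>.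
               zs \<in> regular_normal_cone (tangent_cone (gph \<Gamma>) (pb, xb)) v \<and> snd zs = xbs \<and>
               \<mu> \<in> mult_set_dir G K (pb, xb) zs v})"
proof -
  obtain r L \<kappa> where sys: "parametric_system G K \<Gamma> (pb, xb) r L \<kappa>"
    using reduced_system[OF g_C2 K_cone gV h_C2 h_zero red \<Gamma>_def G_def xb_feas RS] .
  interpret parametric_system G K \<Gamma> "(pb, xb)" r L \<kappa> by (rule sys)
  have "\<Psi> = normal_map" by (auto simp: fun_eq_iff normal_map_def \<Psi>_def)
  note tangent = graph_tangent[OF P_or_poly, of _ _ xbs, folded this]
  show ?thesis
  proof (intro conjI allI)
    show "tangent_cone (gph \<Psi>) ((pb, xb), xbs) =
           {((q, u), us). \<exists>zs \<in> regular_normal_cone (tangent_cone (gph \<Gamma>) (pb, xb)) (q, u).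
              snd zs = xbs \<and>
              (\<exists>\<mu> \<in> mult_set_dir G K (pb, xb) zs (q, u).
                 us \<in> {frechet_derivative (\<lambda>z. adjoint (Dx G z) \<mu>) (at (pb, xb)) (q, u) + w | w.
                         w \<in> snd ` regular_normal_cone (critical_cone (gph \<Gamma>) (pb, xb) zs) (q, u)})}"
      by (rule set_eqI) (simp only: split_paired_all tangent mem_Collect_eq case_prod_conv)
  next
    fix v
    show "graphical_derivative \<Psi> (pb, xb) xbs v =
           \<Union>{{frechet_derivative (\<lambda>z. adjoint (Dx G z) \<mu>) (at (pb, xb)) v + w | w.
                  w \<in> snd ` regular_normal_cone (critical_cone (gph \<Gamma>) (pb, xb) zs) v} | zs \<mu>.
               zs \<in> regular_normal_cone (tangent_cone (gph \<Gamma>) (pb, xb)) v \<and> snd zs = xbs \<and>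
               \<mu> \<in> mult_set_dir G K (pb, xb) zs v}"
      unfolding graphical_derivative_def tangent by (rule set_eqI) blast
  qed
qed


end
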